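(* Let $f$ be a generator (in the sense of the context) and $\xi=h(X_T)$, where $h:\Gamma\to\mathbb{R}$ is $\mathcal{E}$-measurable and $\mathbb{E}|h(X_T)|^2<\infty$. Assume: (1) for almost all $(s,\omega)$, the map $(y,z)\mapsto f(s,X_s(\omega),y,z(\cdot))$ is continuous on $\mathbb{R}\times L^2(\Gamma,\mathcal{E},v(s,X_s(\omega),dy))$; (2) there exist $\lambda>0$ and $\alpha\in(0,1)$ such that $|f(s,x,y,z(\cdot))|\le \lambda\left[1+|y|^{\alpha}+\|z(\cdot)\|^{\alpha}\right]$ for all $s,x,y,z$; (3) for every integer $M\ge1$ there is a constant $L_M>0$ such that, $\mathbb{P}$-a.s., for all $s$ and with $x=X_s$, $$|f(s,x,y,z(\cdot))-f(s,x,y',z'(\cdot))|\le L_M\left(|y-y'|+\|z(\cdot)-z'(\cdot)\|\right)$$ for all $y,y',z,z'$ with $|y|<M$, $|y'|<M$, $\|z(\cdot)\|<M$, $\|z'(\cdot)\|<M$; moreover there is a positive constant $L$ with $L_M\le L+\sqrt{\log M}$ for every integer $M\ge1$. Let $(f_n)_{n\in\mathbb{N}}$ be a sequence of generators and $(\xi_n)_{n\in\mathbb{N}}$ a sequence of $\mathcal{F}_{[t,T]}$-measurable square integrable random variables such that: (4) for every $M$, $\Phi_M(f_n-f)\to0$ as $n\to\infty$; (5) $\mathbb{E}|\xi_n-\xi|^2\to0$ as $n\to\infty$; (6) there exists $\lambda>0$ such that, $\mathbb{P}$-a.s., for all $s\in[t,T]$ and with $x=X_s$, $\sup_n|f_n(s,x,y,z(\cdot))|\le\lambda\left[1+|y|^{\alpha}+\|z(\cdot)\|^{\alpha}\right]$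 for all $y,z$ (with $\alpha$ as in (2)). For each $n$, let $(Y^n,Z^n)$ be a (not necessarily unique) solution of BSDE $(f_n,\xi_n)$, and let $(Y,Z)$ be the solution of BSDE $(f,\xi)$. Then, for $s\in[t,T]$, $$\lim_{n\to\infty}\left(\mathbb{E}\int_s^T|Y_r^n-Y_r|^2dr+\mathbb{E}\int_s^T\|Z_r^n(\cdot)-Z_r(\cdot)\|^2dr\right)=0.$$
   Context: Fix $T>0$ and $t\in[0,T)$. $(\Gamma,\mathcal{E})$ is a measurable space whose $\sigma$-algebra contains all one-point sets. $X$ is a normal jump Markov process on $\Gamma$ with laws $\mathbb{P}^{t,x}$: (a) $\mathbb{P}^{t,x}(X_t=x)=1$; (b) for $t\le s$, $A\in\mathcal{E}$, the map $x\mapsto\mathbb{P}^{t,x}(X_s\in A)$ is $\mathcal{E}$-measurable; (c) for $r\le t\le s$, $A\in\mathcal{E}$, $\mathbb{P}^{r,x}(X_s\in A\mid\mathcal{F}_{[r,t]})=\mathbb{P}^{t,X_t}(X_s\in A)$, $\mathbb{P}^{r,x}$-a.s.; (d) for every $\omega$ and $t\ge0$ there is $\delta>0$ with $X_s(\omega)=X_t(\omega)$ for $s\in[t,t+\delta]$; (e) each trajectory has finitely many jumps on every bounded interval. A starting point $x\in\Gamma$ at time $t$ is fixed; $\mathbb{P}=\mathbb{P}^{t,x}$ and $\mathbb{E}$ is its expectation. $\mathbb{F}^t=(\mathcal{F}_{[t,s]})_{s\ge t}$ is the filtration generated by $X$ from time $t$ on, completed by the $\mathbb{P}$-null sets. $v(s,x,A)$,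 $s\in[0,T]$, $x\in\Gamma$, $A\in\mathcal{E}$, is the rate (transition) measure of $X$, with $\sup_{s\in[0,T],x\in\Gamma}v(s,x,\Gamma)<\infty$ and $v(s,x,\{x\})=0$. With $T_n$ the jump times of $X$ after $t$, $p(ds\,dy)=\sum_n\delta_{(T_n,X_{T_n})}$ is the associated random measure; its compensator (dual predictable projection) is $v(s,X_{s-},dy)\,ds$, and $q(ds\,dy)=p(ds\,dy)-v(s,X_{s-},dy)\,ds$. For $z\in L^2(\Gamma,\mathcal{E},v(s,x,dy))$, $\|z(\cdot)\|=\left(\int_\Gamma|z(y)|^2v(s,x,dy)\right)^{1/2}$; for a process, $\|Z_s(\cdot)\|$ is computed with $v(s,X_s,dy)$. $\mathcal{B}$ is the Banach space of pairs $(Y,Z)$ on $[t,T]$, with $Y$ real-valued and progressively measurable and $Z=(Z_s(\omega,y))$ real-valued and $\mathcal{P}\otimes\mathcal{E}$-measurable ($\mathcal{P}$ the predictable $\sigma$-algebra), such that $\|(Y,Z)\|_{\mathcal{B}}^2=\mathbb{E}\int_t^T|Y_r|^2dr+\mathbb{E}\int_t^T\|Z_r(\cdot)\|^2dr<\infty$ (elements at zero distance being identified). A generator is a family of maps $g(s,x,y,\cdot):L^2(\Gamma,\mathcal{E},v(s,x,dy))\to\mathbb{R}$, for $s\in[0,T]$, $x\in\Gamma$, $y\in\mathbb{R}$, such that $(\omega,s)\mapsto g(s,X_s,Y_s,Z_s(\cdot))$ is progressively measurable whenever $Y$ is progressively measurable and $Z$ is $\mathcal{P}\otimes\mathcal{E}$-measurable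 with $\mathbb{E}\int_t^T\|Z_s(\cdot)\|^2ds<\infty$. For $f$ it is also assumed that, for every bounded $\mathcal{E}$-measurable $z:\Gamma\to\mathbb{R}$, $(s,x,y)\mapsto f(s,x,y,z(\cdot))$ is $B([0,T])\otimes\mathcal{E}\otimes B(\mathbb{R})$-measurable. A solution of BSDE $(g,\eta)$ is a pair $(Y,Z)\in\mathcal{B}$ satisfying $Y_s=\eta+\int_s^Tg(r,X_r,Y_r,Z_r(\cdot))dr-\int_s^T\int_\Gamma Z_r(y)q(dr\,dy)$ for $s\in[t,T]$. Under (1)-(3) and the assumption on $h$, BSDE $(f,\xi)$ has exactly one solution. $\Phi_M(g)=\left(\mathbb{E}\int_t^T\sup_{|y|\le M,\ \|z(\cdot)\|\le M}|g(s,X_s,y,z(\cdot))|^2ds\right)^{1/2}$, the supremum being over $y\in\mathbb{R}$ and $z\in L^2(\Gamma,\mathcal{E},v(s,X_s,dy))$ (read as an upper integral if the supremum is not measurable). *)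

theory Defs
  imports "HOL-Probability.Probability"
begin

section \<open>Jump Markov processes\<close>

text \<open>
  Processes are functions \<open>X :: real \<Rightarrow> 'w \<Rightarrow> 'g\<close>, used only at nonnegative times; the state
  space \<open>(\<Gamma>, \<E>)\<close> is the measurable space carried by \<open>E :: 'g measure\<close> (its measure plays no role).
\<close>

definition traj_sigma :: "'w set \<Rightarrow> 'g measure \<Rightarrow> (real \<Rightarrow> 'w \<Rightarrow> 'g) \<Rightarrow> real set \<Rightarrow> 'w measure" where
  "traj_sigma \<Omega> E X I = sigma \<Omega> {X r -` A \<inter> \<Omega> |r A. r \<in> I \<and> A \<in> sets E}"

text \<open>
  Jump times are the discontinuities of the trajectory for the discrete topology on the state
  space. For trajectories that are right continuous in that topology and have finitely many jumps
  on bounded intervals, these are exactly the successive times \<open>T\<^sub>n\<close> at which \<open>X\<close> changes its value.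
\<close>

definition jump_times :: "(real \<Rightarrow> 'w \<Rightarrow> 'g) \<Rightarrow> real \<Rightarrow> 'w \<Rightarrow> real set" where
  "jump_times X t \<omega> = {s. t < s \<and> \<not> (\<forall>\<^sub>F r in at_left s. X r \<omega> = X s \<omega>)}"

definition left_lim :: "(real \<Rightarrow> 'w \<Rightarrow> 'g) \<Rightarrow> real \<Rightarrow> 'w \<Rightarrow> 'g" where
  "left_lim X s \<omega> = (THE x. \<forall>\<^sub>F r in at_left s. X r \<omega> = x)"

definition normal_jump_markov ::
  "'w set \<Rightarrow> 'g measure \<Rightarrow> (real \<Rightarrow> 'w \<Rightarrow> 'g) \<Rightarrow> (real \<Rightarrow> 'g \<Rightarrow> 'w measure) \<Rightarrow> bool" where
  "normal_jump_markov \<Omega> E X P \<longleftrightarrow>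
     (\<forall>r\<ge>0. \<forall>\<omega>\<in>\<Omega>. X r \<omega> \<in> space E) \<and>
     (\<forall>r\<ge>0. \<forall>x\<in>space E. prob_space (P r x) \<and> space (P r x) = \<Omega> \<and>
        sets (P r x) = sets (traj_sigma \<Omega> E X {r..})) \<and>
     (\<forall>r\<ge>0. \<forall>x\<in>space E. measure (P r x) {\<omega>\<in>\<Omega>. X r \<omega> = x} = 1) \<and>
     (\<forall>r s. 0 \<le> r \<and> r \<le> s \<longrightarrow> (\<forall>A\<in>sets E.
        (\<lambda>x. measure (P r x) {\<omega>\<in>\<Omega>. X s \<omega> \<in> A}) \<in> borel_measurable E)) \<and>
     (\<forall>r t s. 0 \<le> r \<and> r \<le> t \<and> t \<le> s \<longrightarrow> (\<forall>x\<in>space E. \<forall>A\<in>sets E. AE \<omega> in P r x.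
        real_cond_exp (P r x) (traj_sigma \<Omega> E X {r..t}) (indicator {\<omega>'\<in>\<Omega>. X s \<omega>' \<in> A}) \<omega>
          = measure (P t (X t \<omega>)) {\<omega>'\<in>\<Omega>. X s \<omega>' \<in> A})) \<and>
     (\<forall>\<omega>\<in>\<Omega>. \<forall>r\<ge>0. \<exists>\<delta>>0. \<forall>s\<in>{r..r + \<delta>}. X s \<omega> = X r \<omega>) \<and>
     (\<forall>\<omega>\<in>\<Omega>. \<forall>b. finite (jump_times X 0 \<omega> \<inter> {..b}))"

section \<open>Filtration, measurability of processes, and the rate measure\<close>

text \<open>
  \<open>Q\<close> is the law of the process started at time \<open>t\<close>; the null sets adjoined are those of its completion.
\<close>

definition completed_filtration ::
  "'g measure \<Rightarrow> (real \<Rightarrow> 'w \<Rightarrow> 'g) \<Rightarrow> 'w measure \<Rightarrow> real \<Rightarrow> real \<Rightarrow> 'w measure" where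
  "completed_filtration E X Q t s =
     sigma (space Q) (sets (traj_sigma (space Q) E X {t..s}) \<union> null_sets (completion Q))"

definition progressive :: "(real \<Rightarrow> 'w measure) \<Rightarrow> real \<Rightarrow> real \<Rightarrow> (real \<Rightarrow> 'w \<Rightarrow> real) \<Rightarrow> bool" where
  "progressive F t T Y \<longleftrightarrow> (\<forall>s\<in>{t..T}.
     (\<lambda>(r, \<omega>). Y r \<omega>) \<in> borel_measurable (restrict_space borel {t..s} \<Otimes>\<^sub>M F s))"

definition predictable_sigma :: "(real \<Rightarrow> 'w measure) \<Rightarrow> real \<Rightarrow> real \<Rightarrow> (real \<times> 'w) measure" where
  "predictable_sigma F t T = sigma ({t..T} \<times> space (F t))
     ({{t} \<times> A |A. A \<in> sets (F t)} \<union>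
      {{a<..b} \<times> A |a b A. t \<le> a \<and> a < b \<and> b \<le> T \<and> A \<in> sets (F a)})"

definition predictable_field ::
  "'g measure \<Rightarrow> (real \<Rightarrow> 'w measure) \<Rightarrow> real \<Rightarrow> real \<Rightarrow> (real \<Rightarrow> 'w \<Rightarrow> 'g \<Rightarrow> 'b::topological_space) \<Rightarrow> bool" where
  "predictable_field E F t T Z \<longleftrightarrow>
     (\<lambda>((s, \<omega>), y). Z s \<omega> y) \<in> borel_measurable (predictable_sigma F t T \<Otimes>\<^sub>M E)"

text \<open>The random measure \<open>p\<close>, i.e. the sum of the Dirac masses at the points \<open>(T\<^sub>n, X\<^bsub>T\<^sub>n\<^esub>)\<close>.\<close>

definition jump_measure ::
  "'g measure \<Rightarrow> (real \<Rightarrow> 'w \<Rightarrow> 'g) \<Rightarrow> real \<Rightarrow> 'w \<Rightarrow> (real \<times> 'g) measure" where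
  "jump_measure E X t \<omega> =
     distr (count_space (jump_times X t \<omega>)) (borel \<Otimes>\<^sub>M E) (\<lambda>r. (r, X r \<omega>))"

text \<open>
  The last conjunct says that, under every law, \<open>v(s, X\<^bsub>s-\<^esub>, dy) ds\<close> is the dual predictable
  projection of \<open>p\<close>: both integrate all nonnegative predictable fields to the same expectation.
\<close>

definition rate_measure ::
  "'g measure \<Rightarrow> (real \<Rightarrow> 'w \<Rightarrow> 'g) \<Rightarrow> (real \<Rightarrow> 'g \<Rightarrow> 'w measure) \<Rightarrow>
   (real \<Rightarrow> 'g \<Rightarrow> 'g measure) \<Rightarrow> real \<Rightarrow> bool" where
  "rate_measure E X P v T \<longleftrightarrow>
     (\<forall>s\<in>{0..T}. \<forall>x\<in>space E. sets (v s x) = sets E) \<and>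
     (\<forall>A\<in>sets E. (\<lambda>(s, x). emeasure (v s x) A)
        \<in> borel_measurable (restrict_space borel {0..T} \<Otimes>\<^sub>M E)) \<and>
     (SUP (s, x)\<in>{0..T} \<times> space E. emeasure (v s x) (space E)) < \<infinity> \<and>
     (\<forall>s\<in>{0..T}. \<forall>x\<in>space E. emeasure (v s x) {x} = 0) \<and>
     (\<forall>r x. 0 \<le> r \<and> r < T \<and> x \<in> space E \<longrightarrow>
       (\<forall>H :: real \<Rightarrow> 'w \<Rightarrow> 'g \<Rightarrow> ennreal.
         predictable_field E (completed_filtration E X (P r x) r) r T H \<longrightarrow>
         (\<integral>\<^sup>+\<omega>. (\<integral>\<^sup>+p\<in>{r<..T} \<times> space E. H (fst p) \<omega> (snd p) \<partial>jump_measure E X r \<omega>)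
            \<partial>completion (P r x)) =
         (\<integral>\<^sup>+\<omega>. (\<integral>\<^sup>+s\<in>{r<..T}. (\<integral>\<^sup>+y. H s \<omega> y \<partial>v s (left_lim X s \<omega>)) \<partial>lborel)
            \<partial>completion (P r x))))"

section \<open>Square integrable functions and generators\<close>

text \<open>
  Elements of \<open>L\<^sup>2\<close> are represented by functions; maps on \<open>L\<^sup>2\<close> are maps on functions that do not
  distinguish almost everywhere equal square integrable representatives.
\<close>

definition L2 :: "'g measure \<Rightarrow> ('g \<Rightarrow> real) set" where
  "L2 m = {z \<in> borel_measurable m. integrable m (\<lambda>y. (z y)\<^sup>2)}"

definition L2_norm :: "'g measure \<Rightarrow> ('g \<Rightarrow> real) \<Rightarrow> real" where
  "L2_norm m z = sqrt (\<integral>y. (z y)\<^sup>2 \<partial>m)"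

definition continuous_on_L2 :: "'g measure \<Rightarrow> (real \<Rightarrow> ('g \<Rightarrow> real) \<Rightarrow> real) \<Rightarrow> bool" where
  "continuous_on_L2 m \<phi> \<longleftrightarrow>
     (\<forall>y. \<forall>z\<in>L2 m. \<forall>\<epsilon>>0. \<exists>\<delta>>0. \<forall>y'. \<forall>z'\<in>L2 m.
        \<bar>y' - y\<bar> < \<delta> \<and> L2_norm m (\<lambda>u. z' u - z u) < \<delta> \<longrightarrow> \<bar>\<phi> y' z' - \<phi> y z\<bar> < \<epsilon>)"

type_synonym 'g gen = "real \<Rightarrow> 'g \<Rightarrow> real \<Rightarrow> ('g \<Rightarrow> real) \<Rightarrow> real"

text \<open>
  For \<open>Z\<close> with finite norm, \<open>Z\<^sub>s(\<omega>, \<cdot>)\<close> is in \<open>L\<^sup>2(v(s, X\<^sub>s(\<omega>), dy))\<close> only for almost all \<open>(s, \<omega>)\<close>.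
  Elsewhere \<open>g(s, X\<^sub>s, Y\<^sub>s, Z\<^sub>s(\<cdot>))\<close> is read as 0; no value of \<open>g\<close> outside its domain is ever used.
\<close>

definition gen_process ::
  "(real \<Rightarrow> 'w \<Rightarrow> 'g) \<Rightarrow> (real \<Rightarrow> 'g \<Rightarrow> 'g measure) \<Rightarrow> 'g gen \<Rightarrow>
   (real \<Rightarrow> 'w \<Rightarrow> real) \<Rightarrow> (real \<Rightarrow> 'w \<Rightarrow> 'g \<Rightarrow> real) \<Rightarrow> real \<Rightarrow> 'w \<Rightarrow> real" where
  "gen_process X v g Y Z s \<omega> =
     (if Z s \<omega> \<in> L2 (v s (X s \<omega>)) then g s (X s \<omega>) (Y s \<omega>) (Z s \<omega>) else 0)"

definition Z_norm_sq ::
  "'w measure \<Rightarrow> (real \<Rightarrow> 'w \<Rightarrow> 'g) \<Rightarrow> (real \<Rightarrow> 'g \<Rightarrow> 'g measure) \<Rightarrow> real \<Rightarrow> real \<Rightarrow>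
   (real \<Rightarrow> 'w \<Rightarrow> 'g \<Rightarrow> real) \<Rightarrow> ennreal" where
  "Z_norm_sq M X v s T Z =
     (\<integral>\<^sup>+\<omega>. (\<integral>\<^sup>+r\<in>{s..T}. (\<integral>\<^sup>+y. ennreal ((Z r \<omega> y)\<^sup>2) \<partial>v r (X r \<omega>)) \<partial>lborel) \<partial>M)"

definition Y_norm_sq ::
  "'w measure \<Rightarrow> real \<Rightarrow> real \<Rightarrow> (real \<Rightarrow> 'w \<Rightarrow> real) \<Rightarrow> ennreal" where
  "Y_norm_sq M s T Y = (\<integral>\<^sup>+\<omega>. (\<integral>\<^sup>+r\<in>{s..T}. ennreal ((Y r \<omega>)\<^sup>2) \<partial>lborel) \<partial>M)"

definition generator ::
  "'w measure \<Rightarrow> (real \<Rightarrow> 'w measure) \<Rightarrow> 'g measure \<Rightarrow> (real \<Rightarrow> 'w \<Rightarrow> 'g) \<Rightarrow>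
   (real \<Rightarrow> 'g \<Rightarrow> 'g measure) \<Rightarrow> real \<Rightarrow> real \<Rightarrow> 'g gen \<Rightarrow> bool" where
  "generator M F E X v t T g \<longleftrightarrow>
     (\<forall>s\<in>{0..T}. \<forall>x\<in>space E. \<forall>y. \<forall>z\<in>L2 (v s x). \<forall>z'\<in>L2 (v s x).
        (AE u in v s x. z u = z' u) \<longrightarrow> g s x y z = g s x y z') \<and>
     (\<forall>Y Z. progressive F t T Y \<and> predictable_field E F t T Z \<and> Z_norm_sq M X v t T Z < \<infinity> \<longrightarrow>
        progressive F t T (gen_process X v g Y Z))"

definition bounded_field_measurable :: "'g measure \<Rightarrow> real \<Rightarrow> 'g gen \<Rightarrow> bool" where
  "bounded_field_measurable E T f \<longleftrightarrow>
     (\<forall>z\<in>borel_measurable E. (\<exists>C. \<forall>u\<in>space E. \<bar>z u\<bar> \<le> C) \<longrightarrow>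
        (\<lambda>(s, x, y). f s x y z)
          \<in> borel_measurable (restrict_space borel {0..T} \<Otimes>\<^sub>M E \<Otimes>\<^sub>M borel))"

text \<open>
  The library integral \<open>\<integral>\<^sup>+\<close> of a nonmeasurable function is its lower integral, so the upper integral
  has to be introduced separately.
\<close>

definition upper_nn_integral :: "'a measure \<Rightarrow> ('a \<Rightarrow> ennreal) \<Rightarrow> ennreal" where
  "upper_nn_integral N u =
     (INF w\<in>{w \<in> borel_measurable N. \<forall>p\<in>space N. u p \<le> w p}. \<integral>\<^sup>+p. w p \<partial>N)"

definition ennreal_sqrt :: "ennreal \<Rightarrow> ennreal" where
  "ennreal_sqrt a = (if a = \<infinity> then \<infinity> else ennreal (sqrt (enn2real a)))"

definition Phi ::
  "'w measure \<Rightarrow> (real \<Rightarrow> 'w \<Rightarrow> 'g) \<Rightarrow> (real \<Rightarrow> 'g \<Rightarrow> 'g measure) \<Rightarrow> real \<Rightarrow> real \<Rightarrow>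
   real \<Rightarrow> 'g gen \<Rightarrow> ennreal" where
  "Phi M X v t T R g = ennreal_sqrt (upper_nn_integral (restrict_space lborel {t..T} \<Otimes>\<^sub>M M)
     (\<lambda>(s, \<omega>). SUP (y, z)\<in>{(y, z). \<bar>y\<bar> \<le> R \<and> z \<in> L2 (v s (X s \<omega>)) \<and> L2_norm (v s (X s \<omega>)) z \<le> R}.
        ennreal (\<bar>g s (X s \<omega>) y z\<bar>\<^sup>2)))"

section \<open>Solutions\<close>

definition in_B ::
  "'w measure \<Rightarrow> (real \<Rightarrow> 'w measure) \<Rightarrow> 'g measure \<Rightarrow> (real \<Rightarrow> 'w \<Rightarrow> 'g) \<Rightarrow>
   (real \<Rightarrow> 'g \<Rightarrow> 'g measure) \<Rightarrow> real \<Rightarrow> real \<Rightarrow>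
   (real \<Rightarrow> 'w \<Rightarrow> real) \<Rightarrow> (real \<Rightarrow> 'w \<Rightarrow> 'g \<Rightarrow> real) \<Rightarrow> bool" where
  "in_B M F E X v t T Y Z \<longleftrightarrow>
     progressive F t T Y \<and> predictable_field E F t T Z \<and>
     Y_norm_sq M t T Y + Z_norm_sq M X v t T Z < \<infinity>"

definition q_integral ::
  "'g measure \<Rightarrow> (real \<Rightarrow> 'w \<Rightarrow> 'g) \<Rightarrow> (real \<Rightarrow> 'g \<Rightarrow> 'g measure) \<Rightarrow> real \<Rightarrow> real \<Rightarrow> real \<Rightarrow>
   (real \<Rightarrow> 'w \<Rightarrow> 'g \<Rightarrow> real) \<Rightarrow> 'w \<Rightarrow> real" where
  "q_integral E X v t s T Z \<omega> =
     (LINT p:{s<..T} \<times> space E|jump_measure E X t \<omega>. Z (fst p) \<omega> (snd p))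
     - (LINT r:{s<..T}|lborel. (LINT y|v r (left_lim X r \<omega>). Z r \<omega> y))"

text \<open>
  Elements of the Banach space are classes of pairs of processes modulo distance zero, so a solution is
  given by a representative, for which the equation is required almost surely for each time.
\<close>

definition bsde_solution ::
  "'w measure \<Rightarrow> (real \<Rightarrow> 'w measure) \<Rightarrow> 'g measure \<Rightarrow> (real \<Rightarrow> 'w \<Rightarrow> 'g) \<Rightarrow>
   (real \<Rightarrow> 'g \<Rightarrow> 'g measure) \<Rightarrow> real \<Rightarrow> real \<Rightarrow> 'g gen \<Rightarrow> ('w \<Rightarrow> real) \<Rightarrow>
   (real \<Rightarrow> 'w \<Rightarrow> real) \<Rightarrow> (real \<Rightarrow> 'w \<Rightarrow> 'g \<Rightarrow> real) \<Rightarrow> bool" where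
  "bsde_solution M F E X v t T g \<eta> Y Z \<longleftrightarrow>
     in_B M F E X v t T Y Z \<and>
     (AE \<omega> in M. set_integrable lborel {t..T} (\<lambda>r. gen_process X v g Y Z r \<omega>)) \<and>
     (\<forall>s\<in>{t..T}. AE \<omega> in M.
        Y s \<omega> = \<eta> \<omega> + (LINT r:{s..T}|lborel. gen_process X v g Y Z r \<omega>)
                    - q_integral E X v t s T Z \<omega>)"

end

theory Submission
  imports Defs
begin

text \<open>
  The proof replaces Ito's formula by an energy inequality. Write \<open>R s\<close> for the compensated integral
  of \<open>Z\<close> over \<open>(s, T]\<close>. It is orthogonal to the square integrable \<open>F s\<close>-measurable variables; expanding the
  square of \<open>\<eta> + (integral of g over [s, T]) = Y s + R s\<close> by Fubini and bounding the second moment of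
  \<open>R s\<close> from below along partitions gives
  \<open>E |Y s|^2 + E (integral of \<parallel>Z\<parallel>^2) \<le> E |\<eta>|^2 + 2 E (integral of g Y)\<close>. Applied to the difference of
  two solutions, this yields a priori bounds, since the drivers grow sublinearly. Where all norms stay
  below \<open>m\<close>, the drivers are Lipschitz with constant \<open>Lip m\<close>; the complement contributes
  \<open>O(m powr (\<alpha> - 1))\<close>. The Gronwall factor \<open>exp (c * (Lip m)^2 * d)\<close> over a time step \<open>d\<close> is of order
  \<open>m\<close> to a power proportional to \<open>d\<close>, so for small \<open>d\<close> the complement is negligible, and finitely many
  backward steps cover \<open>[t, T]\<close>.
\<close>

section \<open>Auxiliary results on sums, integrals and inequalities\<close>

text \<open>The equation is known only almost surely at each fixed time, for representatives without
  assumed path regularity, so no calculus along trajectories is at hand. All arguments use fixed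
  times, Fubini on the product space \<open>N\<close>, and orthogonality. A second obstacle is that
  the sum of the jumps of a field need not be measurable on a general state space, while the
  compensator formula is then only an identity of lower integrals. The equation itself repairs this:
  it identifies the jump sum almost surely with a measurable variable, and \<open>M\<close> is
  complete. The square root of the logarithm in the bound on the Lipschitz constants is what turns
  the Gronwall exponential into a power of \<open>m\<close>; the step length makes this power
  \<open>(1 - \<alpha>) / 2\<close>, half of the gain on the complement. The net factor
  \<open>m powr (- (1 - \<alpha>) / 2)\<close> is made small by choosing \<open>m\<close> once,
  before \<open>n\<close>. Hence the distance of the generators is needed for one fixed radius at a
  time, and the step length depends neither on \<open>m\<close> nor on \<open>n\<close>.\<close>

definition grid :: "real \<Rightarrow> real \<Rightarrow> nat \<Rightarrow> nat \<Rightarrow> real" where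
  "grid a b n i = a + real i * (b - a) / real n"

lemma grid_0 [simp]: "grid a b n 0 = a"
  by (simp add: grid_def)

lemma grid_n [simp]: "n > 0 \<Longrightarrow> grid a b n n = b"
  by (simp add: grid_def)

lemma grid_Suc: "grid a b n (Suc i) - grid a b n i = (b - a) / real n"
  by (simp add: grid_def field_simps add_divide_distrib diff_divide_distrib)

lemma grid_mono: "a \<le> b \<Longrightarrow> i \<le> j \<Longrightarrow> grid a b n i \<le> grid a b n j"
  by (auto simp: grid_def intro!: divide_right_mono mult_right_mono)

text \<open>For \<open>n = 0\<close> division by zero collapses every point to \<open>a\<close>, so
  no positivity of \<open>n\<close> has to be carried along.\<close>

lemma grid_mem: "a \<le> b \<Longrightarrow> i \<le> n \<Longrightarrow> grid a b n i \<in> {a..b}"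
  using grid_mono[of a b 0 i n] grid_mono[of a b i n n] by (cases "n = 0") (auto simp: grid_def)

text \<open>Half-open cells are disjoint and tile \<open>{p 0<..p k}\<close>, even when some are
  empty because \<open>p\<close> is only monotone. It serves the jumps of a trajectory and, with a
  singleton \<open>S\<close>, the count of cells containing a given time.\<close>

lemma sum_over_cells:
  fixes p :: "nat \<Rightarrow> real" and h :: "real \<Rightarrow> real"
  assumes "finite S" "\<And>i j. i \<le> j \<Longrightarrow> p i \<le> p j"
  shows "(\<Sum>i<k. \<Sum>r\<in>S \<inter> {p i<..p (Suc i)}. h r) = (\<Sum>r\<in>S \<inter> {p 0<..p k}. h r)"
proof (induction k)
  case (Suc k)
  have "S \<inter> {p 0<..p (Suc k)} = S \<inter> {p 0<..p k} \<union> S \<inter> {p k<..p (Suc k)}"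
    using assms(2)[of 0 k] assms(2)[of k "Suc k"] by auto
  then have "(\<Sum>r\<in>S \<inter> {p 0<..p (Suc k)}. h r)
    = (\<Sum>r\<in>S \<inter> {p 0<..p k}. h r) + (\<Sum>r\<in>S \<inter> {p k<..p (Suc k)}. h r)"
    using assms(1) by (simp add: sum.union_disjoint[symmetric]) (subst sum.union_disjoint; auto)
  then show ?case using Suc by simp
qed auto

text \<open>Once the mesh is below the minimal distance of the points, every cell contains at most one.\<close>

lemma grid_sum_eventually:
  fixes c \<phi> :: "real \<Rightarrow> real"
  assumes S: "finite S" "S \<subseteq> {a<..b}" and ab: "a \<le> b" and \<phi>: "\<phi> 0 = 0"
  shows "\<forall>\<^sub>F n in sequentially.
    (\<Sum>i<n. \<phi> (\<Sum>r\<in>S \<inter> {grid a b n i<..grid a b n (Suc i)}. c r)) = (\<Sum>r\<in>S. \<phi> (c r))"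
proof -
  obtain d where d: "d > 0" "\<And>r u. r \<in> S \<Longrightarrow> u \<in> S \<Longrightarrow> r \<noteq> u \<Longrightarrow> d \<le> dist r u"
  proof -
    \<comment> \<open>The inserted 1 keeps the minimum defined when \<open>S\<close> has at most one
      point.\<close>
    let ?D = "insert 1 ((\<lambda>(r, u). dist r u) ` {(r, u) \<in> S \<times> S. r \<noteq> u})"
    have "finite {(r, u) \<in> S \<times> S. r \<noteq> u}"
      by (rule finite_subset[of _ "S \<times> S"]) (use S(1) in auto)
    then have D: "finite ?D" by blast
    have "Min ?D > 0" using D by (subst Min_gr_iff) auto
    moreover have "Min ?D \<le> dist r u" if "r \<in> S" "u \<in> S" "r \<noteq> u" for r u
      by (rule Min_le[OF D]) (use that in force)
    ultimately show ?thesis using that by blast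
  qed
  have "(\<lambda>n. (b - a) / real n) \<longlonglongrightarrow> 0"
    by real_asymp
  then have ev: "\<forall>\<^sub>F n in sequentially. (b - a) / real n < d"
    using d(1) order_tendstoD(2) by blast
  show ?thesis
    using ev eventually_gt_at_top[of 0]
  proof eventually_elim
    case (elim n)
    have cell: "\<phi> (\<Sum>r\<in>S \<inter> {grid a b n i<..grid a b n (Suc i)}. c r)
        = (\<Sum>r\<in>S \<inter> {grid a b n i<..grid a b n (Suc i)}. \<phi> (c r))" for i
    proof -
      let ?C = "S \<inter> {grid a b n i<..grid a b n (Suc i)}"
      have "r = u" if "r \<in> ?C" "u \<in> ?C" for r u
      proof (rule ccontr)
        assume "r \<noteq> u"
        then have "d \<le> dist r u" using d(2) that by auto
        moreover have "dist r u \<le> (b - a) / real n"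
          using that grid_Suc[of a b n i] by (auto simp: dist_real_def)
        ultimately show False using elim by simp
      qed
      \<comment> \<open>With at most one summand \<open>\<phi>\<close> commutes with the sum; the
        empty cell uses \<open>\<phi> 0 = 0\<close>.\<close>
      then have "?C = {} \<or> (\<exists>r. ?C = {r})" by blast
      then show ?thesis using \<phi> by auto
    qed
    have "(\<Sum>i<n. \<Sum>r\<in>S \<inter> {grid a b n i<..grid a b n (Suc i)}. \<phi> (c r)) = (\<Sum>r\<in>S. \<phi> (c r))"
      using sum_over_cells[OF S(1), of "grid a b n" "\<lambda>r. \<phi> (c r)" n] grid_mono[OF ab] elim S(2)
      by (simp add: Int_absorb2)
    then show ?case using cell by simp
  qed
qed

section \<open>Second moment and growth inequalities\<close>

text \<open>Cauchy-Schwarz against the constant 1, read off from the nonnegative integral of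
  \<open>(f - mean)^2\<close>. Total mass 0 is treated apart because the mean divides by it.\<close>

lemma (in finite_measure) integral_power2_le:
  fixes f :: "'a \<Rightarrow> real"
  assumes f: "f \<in> borel_measurable M" and f2: "integrable M (\<lambda>x. (f x)\<^sup>2)"
  shows "integrable M f" "(\<integral>x. f x \<partial>M)\<^sup>2 \<le> measure M (space M) * (\<integral>x. (f x)\<^sup>2 \<partial>M)"
proof -
  show int: "integrable M f"
    by (rule square_integrable_imp_integrable[OF f f2])
  let ?m = "measure M (space M)" and ?c = "\<integral>x. f x \<partial>M"
  show "?c\<^sup>2 \<le> ?m * (\<integral>x. (f x)\<^sup>2 \<partial>M)"
  proof (cases "?m = 0")
    case True
    then have "AE x in M. False"
      by (auto simp: AE_iff_measurable[OF _ refl] emeasure_eq_measure)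
    then have "AE x in M. f x = 0" by (auto elim: eventually_mono)
    then have "?c = 0" by (simp add: integral_eq_zero_AE)
    then show ?thesis using True by simp
  next
    case False
    then have m: "?m > 0" using measure_nonneg[of M "space M"] by linarith
    have "0 \<le> (\<integral>x. (f x - ?c / ?m)\<^sup>2 \<partial>M)" by simp
    also have "\<dots> = (\<integral>x. (f x)\<^sup>2 - 2 * (?c / ?m) * f x + (?c / ?m)\<^sup>2 \<partial>M)"
      by (rule Bochner_Integration.integral_cong) (auto simp: power2_eq_square algebra_simps)
    also have "\<dots> = (\<integral>x. (f x)\<^sup>2 \<partial>M) - 2 * (?c / ?m) * ?c + (?c / ?m)\<^sup>2 * ?m"
      using int f2 by simp
    also have "\<dots> = (\<integral>x. (f x)\<^sup>2 \<partial>M) - ?c\<^sup>2 / ?m"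
      using m by (simp add: power2_eq_square field_simps)
    finally show ?thesis using m by (simp add: field_simps)
  qed
qed

text \<open>Working on the restricted space yields the factor \<open>measure M A\<close> instead of
  the total mass. For a cell of a partition this small factor makes the squared increments of the
  compensator negligible.\<close>

lemma (in finite_measure) integral_indicator_power2_le:
  fixes f :: "'a \<Rightarrow> real"
  assumes f: "f \<in> borel_measurable M" and f2: "integrable M (\<lambda>x. (f x)\<^sup>2)" and A[measurable]: "A \<in> sets M"
  shows "(\<integral>x. indicator A x * f x \<partial>M)\<^sup>2 \<le> measure M A * (\<integral>x. indicator A x * (f x)\<^sup>2 \<partial>M)"
proof -
  note f[measurable]
  have sp: "A \<inter> space M \<in> sets M" by simp
  interpret A: finite_measure "restrict_space M A"
    by (rule finite_measureI) (simp add: emeasure_restrict_space emeasure_eq_measure)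
  have i: "integrable (restrict_space M A) (\<lambda>x. (f x)\<^sup>2)"
    by (subst integrable_restrict_space[OF sp])
       (auto intro!: integrable_mult_indicator[where 'b=real, simplified] f2)
  have "(\<integral>x. f x \<partial>restrict_space M A)\<^sup>2
     \<le> measure (restrict_space M A) (space (restrict_space M A)) * (\<integral>x. (f x)\<^sup>2 \<partial>restrict_space M A)"
    by (rule A.integral_power2_le) (auto intro: i measurable_restrict_space1)
  then show ?thesis
    by (simp add: integral_restrict_space[OF sp] measure_restrict_space[OF sp] space_restrict_space Int_absorb2 sets.sets_into_space)
qed

lemma square_diff_le: "((x::real) - y)\<^sup>2 \<le> 2 * x\<^sup>2 + 2 * y\<^sup>2"
  using sum_squares_bound[of x "-y"] by (simp add: power2_diff)

lemma integrable_square_sum: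
  fixes f h :: "'a \<Rightarrow> real"
  assumes "integrable B (\<lambda>\<omega>. (f \<omega>)\<^sup>2)" "integrable B (\<lambda>\<omega>. (h \<omega>)\<^sup>2)"
    "f \<in> borel_measurable B" "h \<in> borel_measurable B"
  shows "integrable B (\<lambda>\<omega>. f \<omega> * h \<omega>)" "integrable B (\<lambda>\<omega>. (f \<omega> + h \<omega>)\<^sup>2)" "integrable B (\<lambda>\<omega>. (f \<omega> - h \<omega>)\<^sup>2)"
proof -
  note assms(3,4)[measurable]
  show p: "integrable B (\<lambda>\<omega>. f \<omega> * h \<omega>)"
  proof (rule Bochner_Integration.integrable_bound[OF Bochner_Integration.integrable_add[OF assms(1,2)]])
    have "\<bar>a * b\<bar> \<le> a\<^sup>2 + b\<^sup>2" for a b :: real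
      using sum_squares_bound[of "\<bar>a\<bar>" "\<bar>b\<bar>"] mult_nonneg_nonneg[OF abs_ge_zero[of a] abs_ge_zero[of b]]
      unfolding abs_mult power2_abs by linarith
    then show "AE \<omega> in B. norm (f \<omega> * h \<omega>) \<le> norm ((f \<omega>)\<^sup>2 + (h \<omega>)\<^sup>2)" by simp
  qed measurable
  show "integrable B (\<lambda>\<omega>. (f \<omega> + h \<omega>)\<^sup>2)" "integrable B (\<lambda>\<omega>. (f \<omega> - h \<omega>)\<^sup>2)"
    using p assms(1,2) by (simp_all add: power2_sum power2_diff mult.assoc)
qed

text \<open>The combination \<open>u1 + u2 + 2 * u3\<close> is the shape of the envelope
  \<open>Q\<close> used for localisation. The constants are those of Cauchy-Schwarz for three terms,
  the last of which is \<open>2 * u3\<close>.\<close>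

lemma integrable_square_sum3:
  fixes u1 u2 u3 :: "'a \<Rightarrow> real"
  assumes [measurable]: "u1 \<in> borel_measurable B" "u2 \<in> borel_measurable B" "u3 \<in> borel_measurable B"
    and i: "integrable B (\<lambda>p. (u1 p)\<^sup>2)" "integrable B (\<lambda>p. (u2 p)\<^sup>2)" "integrable B (\<lambda>p. (u3 p)\<^sup>2)"
  shows "integrable B (\<lambda>p. (u1 p + u2 p + 2 * u3 p)\<^sup>2)"
    and "(\<integral>p. (u1 p + u2 p + 2 * u3 p)\<^sup>2 \<partial>B)
      \<le> 3 * (\<integral>p. (u1 p)\<^sup>2 \<partial>B) + 3 * (\<integral>p. (u2 p)\<^sup>2 \<partial>B) + 12 * (\<integral>p. (u3 p)\<^sup>2 \<partial>B)"
proof -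
  let ?h = "\<lambda>p. 3 * (u1 p)\<^sup>2 + 3 * (u2 p)\<^sup>2 + 12 * (u3 p)\<^sup>2"
  have le: "(x + y + 2 * z)\<^sup>2 \<le> 3 * x\<^sup>2 + 3 * y\<^sup>2 + 12 * z\<^sup>2" for x y z :: real
    using sum_squares_bound[of x y] sum_squares_bound[of x "2 * z"] sum_squares_bound[of y "2 * z"]
    by (simp add: power2_eq_square algebra_simps)
  have h: "integrable B ?h" using i by simp
  show s: "integrable B (\<lambda>p. (u1 p + u2 p + 2 * u3 p)\<^sup>2)"
    by (rule Bochner_Integration.integrable_bound[OF h]) (use le in auto)
  have "(\<integral>p. (u1 p + u2 p + 2 * u3 p)\<^sup>2 \<partial>B) \<le> (\<integral>p. ?h p \<partial>B)"
    by (rule integral_mono[OF s h le])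
  then show "(\<integral>p. (u1 p + u2 p + 2 * u3 p)\<^sup>2 \<partial>B)
      \<le> 3 * (\<integral>p. (u1 p)\<^sup>2 \<partial>B) + 3 * (\<integral>p. (u2 p)\<^sup>2 \<partial>B) + 12 * (\<integral>p. (u3 p)\<^sup>2 \<partial>B)"
    using i by simp
qed

text \<open>The power is bounded by \<open>1 + q\<close>, which gives linear growth
  \<open>C * (2 + q)\<close>; then \<open>(2 + q)^2 \<le> 8 + 2 * q^2\<close> gives the second
  moment.\<close>

lemma (in finite_measure) sublinear_growth:
  fixes g q :: "'a \<Rightarrow> real"
  assumes le: "AE p in M. \<bar>g p\<bar> \<le> C * (1 + q p powr \<alpha>)" and C: "0 < C" and \<alpha>: "0 < \<alpha>" "\<alpha> < 1"
    and q: "\<And>p. 0 \<le> q p" "integrable M (\<lambda>p. (q p)\<^sup>2)" and g [measurable]: "g \<in> borel_measurable M"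
  shows "integrable M (\<lambda>p. (g p)\<^sup>2)" "(\<integral>p. (g p)\<^sup>2 \<partial>M) \<le> (\<integral>p. C\<^sup>2 * (8 + 2 * (q p)\<^sup>2) \<partial>M)"
    and "AE p in M. \<bar>g p\<bar> \<le> C * (2 + q p)"
proof -
  have powr_le: "x powr \<alpha> \<le> 1 + x" if "x \<ge> 0" for x :: real
  proof (cases "x \<le> 1")
    case True
    then have "x powr \<alpha> \<le> 1" using that \<alpha> by (intro powr_le1) auto
    then show ?thesis using that by simp
  next
    case False
    then have "x powr \<alpha> \<le> x powr 1" using \<alpha> by (intro powr_mono) auto
    then show ?thesis using that by simp
  qed
  show linear: "AE p in M. \<bar>g p\<bar> \<le> C * (2 + q p)"
    using le
  proof eventually_elim
    case (elim p)
    have "C * (1 + q p powr \<alpha>) \<le> C * (2 + q p)"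
      using C powr_le[OF q(1)[of p]] by (intro mult_left_mono) auto
    with elim show ?case by simp
  qed
  have ae: "AE p in M. (g p)\<^sup>2 \<le> C\<^sup>2 * (8 + 2 * (q p)\<^sup>2)"
    using linear
  proof eventually_elim
    case (elim p)
    then have "(g p)\<^sup>2 \<le> (C * (2 + q p))\<^sup>2"
      by (intro power2_le_iff_abs_le[THEN iffD2]) (use C q(1)[of p] in auto)
    also have "\<dots> = C\<^sup>2 * (2 + q p)\<^sup>2" by (simp add: power_mult_distrib)
    also have "\<dots> \<le> C\<^sup>2 * (8 + 2 * (q p)\<^sup>2)"
      using sum_squares_bound[of 2 "q p"] by (intro mult_left_mono) (auto simp: power2_sum)
    finally show ?case .
  qed
  have i: "integrable M (\<lambda>p. C\<^sup>2 * (8 + 2 * (q p)\<^sup>2))" using q(2) by simp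
  show gi: "integrable M (\<lambda>p. (g p)\<^sup>2)"
    by (rule Bochner_Integration.integrable_bound[OF i]) (use ae in \<open>auto elim: eventually_mono\<close>)
  show "(\<integral>p. (g p)\<^sup>2 \<partial>M) \<le> (\<integral>p. C\<^sup>2 * (8 + 2 * (q p)\<^sup>2) \<partial>M)"
    by (rule integral_mono_AE[OF gi i ae])
qed

section \<open>The square of an integral and a backward Gronwall inequality\<close>

text \<open>Fubini on the square, split along the diagonal: both triangles contribute equally. This
  is the chain rule for the square of an antiderivative, in a form that asks only for integrability
  of \<open>f\<close>.\<close>

lemma integral_square_eq_iterated:
  fixes f :: "real \<Rightarrow> real"
  assumes f: "integrable lborel f"
  shows "integrable lborel (\<lambda>r. f r * (\<integral>u. indicator {r..} u * f u \<partial>lborel))"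
    and "(\<integral>r. f r \<partial>lborel)\<^sup>2 = 2 * (\<integral>r. f r * (\<integral>u. indicator {r..} u * f u \<partial>lborel) \<partial>lborel)"
proof -
  have [measurable]: "f \<in> borel_measurable borel" using f by auto
  have ff: "integrable (lborel \<Otimes>\<^sub>M lborel) (\<lambda>(r, u). f r * f u)"
    by (rule lborel_pair.Fubini_integrable) (use f in \<open>auto simp: abs_mult\<close>)
  have i1: "integrable (lborel \<Otimes>\<^sub>M lborel) (\<lambda>(r, u). (if r \<le> u then 1 else 0) * (f r * f u))"
    by (rule Bochner_Integration.integrable_bound[OF ff]) auto
  have i2: "integrable (lborel \<Otimes>\<^sub>M lborel) (\<lambda>(r, u). (if u < r then 1 else 0) * (f r * f u))"
    by (rule Bochner_Integration.integrable_bound[OF ff]) auto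
  have e1: "(\<integral>u. (if r \<le> u then 1 else 0) * (f r * f u) \<partial>lborel) = f r * (\<integral>u. indicator {r..} u * f u \<partial>lborel)" for r
    unfolding integral_mult_right_zero[symmetric]
    by (rule Bochner_Integration.integral_cong) (auto simp: indicator_def)
  \<comment> \<open>The open triangle and the closed ray \<open>{u..}\<close> differ in a single
    point, which has measure zero.\<close>
  have e2: "(\<integral>r. (if u < r then 1 else 0) * (f r * f u) \<partial>lborel) = f u * (\<integral>r. indicator {u..} r * f r \<partial>lborel)" for u
    unfolding integral_mult_right_zero[symmetric]
    by (intro integral_cong_AE) (auto simp: indicator_def intro!: eventually_mono[OF AE_lborel_singleton[of u]])
  show "integrable lborel (\<lambda>r. f r * (\<integral>u. indicator {r..} u * f u \<partial>lborel))"
    using lborel_pair.integrable_fst'[OF i1] by (simp add: e1)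
  have "(\<integral>r. f r \<partial>lborel)\<^sup>2 = (\<integral>r. (\<integral>u. f r * f u \<partial>lborel) \<partial>lborel)"
    by (simp add: power2_eq_square)
  also have "\<dots> = (\<integral>p. (case p of (r, u) \<Rightarrow> f r * f u) \<partial>(lborel \<Otimes>\<^sub>M lborel))"
    using lborel_pair.integral_fst'[OF ff] by simp
  also have "\<dots> = (\<integral>p. (case p of (r, u) \<Rightarrow> (if r \<le> u then 1 else 0) * (f r * f u))
      + (case p of (r, u) \<Rightarrow> (if u < r then 1 else 0) * (f r * f u)) \<partial>(lborel \<Otimes>\<^sub>M lborel))"
    by (rule Bochner_Integration.integral_cong) auto
  also have "\<dots> = (\<integral>p. (case p of (r, u) \<Rightarrow> (if r \<le> u then 1 else 0) * (f r * f u)) \<partial>(lborel \<Otimes>\<^sub>M lborel))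
      + (\<integral>p. (case p of (r, u) \<Rightarrow> (if u < r then 1 else 0) * (f r * f u)) \<partial>(lborel \<Otimes>\<^sub>M lborel))"
    by (rule Bochner_Integration.integral_add[OF i1 i2])
  also have "\<dots> = 2 * (\<integral>r. f r * (\<integral>u. indicator {r..} u * f u \<partial>lborel) \<partial>lborel)"
    using lborel_pair.integral_fst'[OF i1] lborel_pair.integral_snd[OF i2] by (simp add: e1 e2)
  finally show "(\<integral>r. f r \<partial>lborel)\<^sup>2 = 2 * (\<integral>r. f r * (\<integral>u. indicator {r..} u * f u \<partial>lborel) \<partial>lborel)" .
qed

text \<open>
  Instead of iterating the inequality, one bounds the supremum of \<open>u s * exp (- 2 * k * (b - s))\<close> by
  \<open>A\<close> plus half of itself. This costs the factors 2, which do not matter here.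
\<close>

lemma backward_gronwall:
  fixes u :: "real \<Rightarrow> real"
  assumes k: "k > 0" and A: "A \<ge> 0"
    and u: "u \<in> borel_measurable borel" "\<And>s. s \<in> {a..b} \<Longrightarrow> 0 \<le> u s" "\<And>s. s \<in> {a..b} \<Longrightarrow> u s \<le> B"
    and le: "\<And>s. s \<in> {a..b} \<Longrightarrow> u s \<le> A + k * (LINT r:{s..b}|lborel. u r)"
    and s: "s \<in> {a..b}"
  shows "A + k * (LINT r:{s..b}|lborel. u r) \<le> 2 * A * exp (2 * k * (b - s))"
proof -
  \<comment> \<open>The rate \<open>2 * k\<close>, twice the constant of the inequality, makes
    integration of the majorant cost exactly one half:
    \<open>k * (c / (2 * k)) = c / 2\<close>.\<close>
  define w where "w s = u s * exp (- (2 * k * (b - s)))" for s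
  define c where "c = (SUP s\<in>{a..b}. w s)"
  have wB: "w s \<le> B" if "s \<in> {a..b}" for s
  proof -
    have "w s \<le> u s * 1" unfolding w_def using that u(2) k by (intro mult_left_mono) auto
    then show ?thesis using u(3)[OF that] by simp
  qed
  \<comment> \<open>The bound \<open>B\<close> enters through this finiteness of the supremum only;
    it is what permits absorbing \<open>c / 2\<close> later, and it leaves no trace in the final
    estimate.\<close>
  have bdd: "bdd_above (w ` {a..b})" using wB by (intro bdd_aboveI[of _ B]) auto
  have wc: "w s \<le> c" if "s \<in> {a..b}" for s
    unfolding c_def using that bdd by (rule cSUP_upper)
  have uc: "u s \<le> c * exp (2 * k * (b - s))" if "s \<in> {a..b}" for s
  proof -
    have "u s = w s * exp (2 * k * (b - s))" by (simp add: w_def mult.assoc exp_minus)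
    also have "\<dots> \<le> c * exp (2 * k * (b - s))" using wc[OF that] by (intro mult_right_mono) auto
    finally show ?thesis .
  qed
  have c0: "0 \<le> c" using wc[OF s] u(2)[OF s] unfolding w_def by (smt (verit) exp_ge_zero mult_nonneg_nonneg)
  have int: "(LINT r:{s..b}|lborel. c * exp (2 * k * (b - r))) = c / (2 * k) * (exp (2 * k * (b - s)) - 1)"
    and intb: "set_integrable lborel {s..b} (\<lambda>r. c * exp (2 * k * (b - r)))" if "s \<in> {a..b}" for s
  proof -
    have "((\<lambda>r. - (c / (2 * k)) * exp (2 * k * (b - r))) has_vector_derivative c * exp (2 * k * (b - r))) (at r within {s..b})" for r
      using k by (auto intro!: derivative_eq_intros simp: has_real_derivative_iff_has_vector_derivative[symmetric] field_simps)
    then have "(LINT r:{s..b}|lborel. c * exp (2 * k * (b - r))) = - (c / (2 * k)) * exp (2 * k * (b - b)) - (- (c / (2 * k)) * exp (2 * k * (b - s)))"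
      unfolding set_lebesgue_integral_def using that
      by (intro integral_FTC_atLeastAtMost) (auto intro!: continuous_intros)
    also have "\<dots> = c / (2 * k) * (exp (2 * k * (b - s)) - 1)" by (simp add: algebra_simps)
    finally show "(LINT r:{s..b}|lborel. c * exp (2 * k * (b - r))) = c / (2 * k) * (exp (2 * k * (b - s)) - 1)" .
    show "set_integrable lborel {s..b} (\<lambda>r. c * exp (2 * k * (b - r)))"
      by (intro borel_integrable_atLeastAtMost' continuous_intros)
  qed
  have intu: "set_integrable lborel {s..b} u" if "s \<in> {a..b}" for s
    by (rule set_integrable_bound[OF intb[OF that]])
       (use that u uc in \<open>auto intro!: AE_I2 order_trans[OF _ abs_ge_self] simp: set_borel_measurable_def\<close>)
  have est: "k * (LINT r:{s..b}|lborel. u r) \<le> c / 2 * (exp (2 * k * (b - s)) - 1)" if "s \<in> {a..b}" for s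
  proof -
    have "(LINT r:{s..b}|lborel. u r) \<le> (LINT r:{s..b}|lborel. c * exp (2 * k * (b - r)))"
      using that uc by (intro set_integral_mono intu intb) auto
    then have "k * (LINT r:{s..b}|lborel. u r) \<le> k * (c / (2 * k) * (exp (2 * k * (b - s)) - 1))"
      unfolding int[OF that] using k by (intro mult_left_mono) auto
    then show ?thesis using k by simp
  qed
  have wA: "w s \<le> A + c / 2" if "s \<in> {a..b}" for s
  proof -
    let ?e = "exp (2 * k * (b - s))"
    have e1: "?e \<ge> 1" using that k by simp
    have "u s \<le> A + c / 2 * (?e - 1)" using le[OF that] est[OF that] by linarith
    also have "\<dots> \<le> A * ?e + c / 2 * ?e"
      using mult_left_mono[OF e1 A] c0 by (intro add_mono mult_left_mono) auto
    finally have "u s \<le> (A + c / 2) * ?e" by (simp add: algebra_simps)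
    then have "w s \<le> ((A + c / 2) * ?e) * exp (- (2 * k * (b - s)))"
      unfolding w_def by (rule mult_right_mono) simp
    also have "\<dots> = A + c / 2"
      by (simp only: mult.assoc exp_minus_inverse mult_1_right)
    finally show ?thesis .
  qed
  have "(SUP s\<in>{a..b}. w s) \<le> A + c / 2" using s by (intro cSUP_least) (auto intro: wA)
  then have "c \<le> A + c / 2" by (simp add: c_def[symmetric])
  then have c2: "c \<le> 2 * A" by simp
  have e1: "exp (2 * k * (b - s)) \<ge> 1" using s k by simp
  have "c / 2 * (exp (2 * k * (b - s)) - 1) \<le> A * (exp (2 * k * (b - s)) - 1)"
    using c2 e1 by (intro mult_right_mono) auto
  then have "A + k * (LINT r:{s..b}|lborel. u r) \<le> A + A * (exp (2 * k * (b - s)) - 1)"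
    using est[OF s] by linarith
  also have "\<dots> \<le> 2 * A * exp (2 * k * (b - s))" using A by (simp add: right_diff_distrib)
  finally show ?thesis .
qed

lemma tendsto_0_le_eps:
  fixes f :: "nat \<Rightarrow> real"
  assumes "\<And>r. r > 0 \<Longrightarrow> \<forall>\<^sub>F n in sequentially. f n \<le> r" "\<And>n. 0 \<le> f n"
  shows "f \<longlonglongrightarrow> 0"
proof (rule order_tendstoI)
  fix r :: real assume "0 < r"
  then have "\<forall>\<^sub>F n in sequentially. f n \<le> r / 2" by (intro assms(1)) simp
  then show "\<forall>\<^sub>F n in sequentially. f n < r" by eventually_elim (use \<open>0 < r\<close> in auto)
next
  fix r :: real assume "r < 0"
  then show "\<forall>\<^sub>F n in sequentially. r < f n" by (intro always_eventually allI) (metis assms(2) less_le_trans)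
qed

section \<open>Kernels, completeness and upper integrals\<close>

text \<open>Scaling by \<open>1 / C\<close> turns a kernel of uniformly bounded mass into a
  subprobability kernel, for which measurability of the integral is standard; the factor is put back
  afterwards.\<close>

lemma nn_integral_bounded_kernel_measurable:
  fixes K :: "'a \<Rightarrow> 'b \<Rightarrow> ennreal" and \<kappa> :: "'a \<Rightarrow> 'b measure"
  assumes K: "(\<lambda>(p, y). K p y) \<in> borel_measurable (N \<Otimes>\<^sub>M E)"
    and sets: "\<And>p. p \<in> space N \<Longrightarrow> sets (\<kappa> p) = sets E"
    and meas: "\<And>A. A \<in> sets E \<Longrightarrow> (\<lambda>p. emeasure (\<kappa> p) A) \<in> borel_measurable N"
    and bound: "\<And>p. p \<in> space N \<Longrightarrow> emeasure (\<kappa> p) (space E) \<le> ennreal C" and C: "C > 0"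
    and ne: "space E \<noteq> {}"
  shows "(\<lambda>p. \<integral>\<^sup>+y. K p y \<partial>\<kappa> p) \<in> borel_measurable N"
proof -
  let ?\<kappa> = "\<lambda>p. scale_measure (ennreal (1 / C)) (\<kappa> p)"
  have "?\<kappa> \<in> measurable N (subprob_algebra E)"
  proof (rule measurable_subprob_algebra)
    fix p assume p: "p \<in> space N"
    have sp: "space (\<kappa> p) = space E" using sets[OF p] by (rule sets_eq_imp_space_eq)
    have "ennreal (1 / C) * emeasure (\<kappa> p) (space E) \<le> ennreal (1 / C) * ennreal C"
      by (intro mult_left_mono bound p) auto
    also have "\<dots> = 1" using C by (simp add: ennreal_mult[symmetric])
    finally show "subprob_space (?\<kappa> p)"
      using ne by (intro subprob_spaceI) (auto simp: space_scale_measure sp)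
    show "sets (?\<kappa> p) = sets E" using sets[OF p] by simp
  next
    fix A assume [measurable]: "A \<in> sets E"
    have [measurable]: "(\<lambda>p. emeasure (\<kappa> p) A) \<in> borel_measurable N" by (rule meas) fact
    show "(\<lambda>p. emeasure (?\<kappa> p) A) \<in> borel_measurable N" by simp
  qed
  then have m: "(\<lambda>p. \<integral>\<^sup>+y. K p y \<partial>?\<kappa> p) \<in> borel_measurable N"
    by (rule nn_integral_measurable_subprob_algebra2[OF K])
  have eq: "(\<integral>\<^sup>+y. K p y \<partial>\<kappa> p) = ennreal C * (\<integral>\<^sup>+y. K p y \<partial>?\<kappa> p)" if p: "p \<in> space N" for p
  proof -
    have "K p \<in> borel_measurable (\<kappa> p)"
      using measurable_compose[OF measurable_Pair1'[OF p] K] sets[OF p] by (simp cong: measurable_cong_sets)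
    then have "(\<integral>\<^sup>+y. K p y \<partial>?\<kappa> p) = ennreal (1 / C) * (\<integral>\<^sup>+y. K p y \<partial>\<kappa> p)"
      by (rule nn_integral_scale_measure)
    then show ?thesis using C by (simp add: mult.assoc[symmetric] ennreal_mult[symmetric])
  qed
  show ?thesis
    by (subst measurable_cong[OF eq]) (use m in auto)
qed

text \<open>The preimages under \<open>f\<close> and \<open>g\<close> differ by subsets of a null
  set, and completeness makes these measurable. It is the device that makes jump sums
  measurable.\<close>

lemma (in complete_measure) borel_measurable_AE_cong:
  fixes f g :: "'a \<Rightarrow> 'b::topological_space"
  assumes f: "f \<in> borel_measurable M" and eq: "AE x in M. f x = g x"
  shows "g \<in> borel_measurable M"
proof (rule measurableI)
  fix A :: "'b set" assume A: "A \<in> sets borel"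
  have "{x \<in> space M. \<not> f x = g x} \<in> null_sets M" using eq by (simp add: AE_iff_null_sets)
  then have n: "{x \<in> space M. f x \<noteq> g x} \<in> null_sets M" by simp
  have n': "(g -` A \<inter> space M) \<inter> {x \<in> space M. f x \<noteq> g x} \<in> null_sets M"
    by (rule complete2[OF _ n]) auto
  have "g -` A \<inter> space M = ((f -` A \<inter> space M) - {x \<in> space M. f x \<noteq> g x}) \<union>
      ((g -` A \<inter> space M) \<inter> {x \<in> space M. f x \<noteq> g x})" by auto
  also have "\<dots> \<in> sets M"
    using measurable_sets[OF f A] null_setsD2[OF n] null_setsD2[OF n'] by (intro sets.Un sets.Diff)
  finally show "g -` A \<inter> space M \<in> sets M" .
qed auto

lemma ennreal_sqrt_less_top: "ennreal_sqrt a < \<infinity> \<longleftrightarrow> a < \<infinity>"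
  by (auto simp: ennreal_sqrt_def less_top)

lemma enn2real_ennreal_sqrt: "a < \<infinity> \<Longrightarrow> (enn2real (ennreal_sqrt a))\<^sup>2 = enn2real a"
  by (simp add: ennreal_sqrt_def)

text \<open>Replaces a possibly nonmeasurable function by a measurable majorant of almost the same
  integral. The slack is later \<open>1 / real (Suc n)\<close> and disappears in the limit.\<close>

lemma upper_nn_integral_approx:
  assumes "upper_nn_integral B u < \<infinity>" and \<epsilon>: "\<epsilon> > 0"
  obtains w where "w \<in> borel_measurable B" "\<And>p. p \<in> space B \<Longrightarrow> u p \<le> w p"
    "(\<integral>\<^sup>+p. w p \<partial>B) < \<infinity>" "enn2real (\<integral>\<^sup>+p. w p \<partial>B) \<le> enn2real (upper_nn_integral B u) + \<epsilon>"
proof -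
  let ?U = "upper_nn_integral B u"
  have "?U < ennreal (enn2real ?U + \<epsilon>)"
    using assms by (metis ennreal_enn2real ennreal_lessI enn2real_nonneg less_add_same_cancel1 add_nonneg_pos infinity_ennreal_def)
  then obtain w where w: "w \<in> borel_measurable B" "\<forall>p\<in>space B. u p \<le> w p" "(\<integral>\<^sup>+p. w p \<partial>B) < ennreal (enn2real ?U + \<epsilon>)"
    unfolding upper_nn_integral_def by (auto simp: INF_less_iff)
  show ?thesis
  proof (rule that[OF w(1)])
    show "(\<integral>\<^sup>+p. w p \<partial>B) < \<infinity>" using w(3) by (rule order_less_trans) simp
    have "enn2real (\<integral>\<^sup>+p. w p \<partial>B) \<le> enn2real (ennreal (enn2real ?U + \<epsilon>))"
      using w(3) by (intro enn2real_mono) auto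
    then show "enn2real (\<integral>\<^sup>+p. w p \<partial>B) \<le> enn2real ?U + \<epsilon>" using \<epsilon> by (simp del: ennreal_plus)
  qed (use w(2) in auto)
qed

section \<open>The jump process and its compensator\<close>

text \<open>\<open>M\<close> and \<open>F\<close> are parameters tied down by equations, so that all
  facts come out in terms of the variables that the theorem fixes.\<close>

locale jump_process =
  fixes \<Omega> :: "'w set" and E :: "'g measure"
    and X :: "real \<Rightarrow> 'w \<Rightarrow> 'g" and P :: "real \<Rightarrow> 'g \<Rightarrow> 'w measure"
    and v :: "real \<Rightarrow> 'g \<Rightarrow> 'g measure"
    and T t :: real and x :: 'g
    and M :: "'w measure" and F :: "real \<Rightarrow> 'w measure"
  assumes t_nonneg: "0 \<le> t" and t_less_T: "t < T"
    and markov: "normal_jump_markov \<Omega> E X P"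
    and rate: "rate_measure E X P v T"
    and x: "x \<in> space E"
    and M_def: "M = completion (P t x)"
    and F_def: "F = completed_filtration E X (P t x) t"
begin

section \<open>The completed law, its filtration, and joint measurability of the trajectory\<close>

abbreviation LT :: "real measure" where "LT \<equiv> restrict_space lborel {t..T}"
abbreviation N :: "(real \<times> 'w) measure" where "N \<equiv> LT \<Otimes>\<^sub>M M"

lemma P_facts: "prob_space (P t x)" "space (P t x) = \<Omega>" "sets (P t x) = sets (traj_sigma \<Omega> E X {t..})"
proof -
  have "\<forall>r\<ge>0. \<forall>x\<in>space E. prob_space (P r x) \<and> space (P r x) = \<Omega> \<and>
      sets (P r x) = sets (traj_sigma \<Omega> E X {r..})"
    using markov unfolding normal_jump_markov_def by (elim conjE)
  with t_nonneg x show "prob_space (P t x)" "space (P t x) = \<Omega>"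
      "sets (P t x) = sets (traj_sigma \<Omega> E X {t..})" by auto
qed

lemma space_M [simp]: "space M = \<Omega>"
  using P_facts by (simp add: M_def)

sublocale M: prob_space M
  unfolding M_def using P_facts(1) by (intro prob_space.prob_space_completion)

sublocale M: complete_measure M
  unfolding M_def by (rule completion.complete_measure_axioms)

lemma X_space:
  assumes "r \<ge> 0" "\<omega> \<in> \<Omega>" shows "X r \<omega> \<in> space E"
proof -
  have "\<forall>r\<ge>0. \<forall>\<omega>\<in>\<Omega>. X r \<omega> \<in> space E"
    using markov unfolding normal_jump_markov_def by (elim conjE)
  with assms show ?thesis by simp
qed

lemma X_right_const:
  assumes "r \<ge> 0" "\<omega> \<in> \<Omega>" shows "\<exists>\<delta>>0. \<forall>s\<in>{r..r + \<delta>}. X s \<omega> = X r \<omega>"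
proof -
  have "\<forall>\<omega>\<in>\<Omega>. \<forall>r\<ge>0. \<exists>\<delta>>0. \<forall>s\<in>{r..r + \<delta>}. X s \<omega> = X r \<omega>"
    using markov unfolding normal_jump_markov_def by (elim conjE)
  with assms show ?thesis by blast
qed

lemma finite_jumps:
  assumes "\<omega> \<in> \<Omega>" shows "finite (jump_times X t \<omega> \<inter> {a<..b})"
proof -
  have "\<forall>\<omega>\<in>\<Omega>. \<forall>b. finite (jump_times X 0 \<omega> \<inter> {..b})"
    using markov unfolding normal_jump_markov_def by (elim conjE)
  with assms have "finite (jump_times X 0 \<omega> \<inter> {..b})" by simp
  then show ?thesis
    by (rule finite_subset[rotated]) (use t_nonneg in \<open>auto simp: jump_times_def\<close>)
qed

lemma sets_traj_sigma: "sets (traj_sigma \<Omega> E X I) = sigma_sets \<Omega> {X r -` A \<inter> \<Omega> |r A. r \<in> I \<and> A \<in> sets E}"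
  unfolding traj_sigma_def by (intro sets_measure_of) auto

lemma measurable_X: "r \<ge> t \<Longrightarrow> X r \<in> measurable M E"
proof (rule measurableI)
  fix A assume r: "r \<ge> t" and A: "A \<in> sets E"
  have "X r -` A \<inter> \<Omega> \<in> sets (P t x)"
    unfolding P_facts sets_traj_sigma using r A by (intro sigma_sets.Basic) auto
  then show "X r -` A \<inter> space M \<in> sets M" by (simp add: M_def P_facts)
qed (use X_space t_nonneg in auto)

lemma space_F [simp]: "space (F s) = \<Omega>"
  unfolding F_def completed_filtration_def by (simp add: P_facts space_measure_of_conv)

lemma F_gen_sub: "sets (traj_sigma \<Omega> E X {t..s}) \<union> null_sets (completion (P t x)) \<subseteq> Pow \<Omega>"
proof -
  have "A \<subseteq> \<Omega>" if "A \<in> null_sets (completion (P t x))" for A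
    using null_setsD2[OF that] sets.sets_into_space[of A "completion (P t x)"] P_facts by auto
  then show ?thesis
    using sets.space_closed[of "traj_sigma \<Omega> E X {t..s}"]
    unfolding traj_sigma_def space_measure_of_conv by blast
qed

lemma sets_F: "sets (F s) = sigma_sets \<Omega> (sets (traj_sigma \<Omega> E X {t..s}) \<union> null_sets (completion (P t x)))"
  unfolding F_def completed_filtration_def P_facts using F_gen_sub by (rule sets_measure_of)

lemma sets_F_subset_M: "sets (F s) \<subseteq> sets M"
proof -
  have "sets (traj_sigma \<Omega> E X {t..s}) \<subseteq> sets (P t x)"
    unfolding P_facts sets_traj_sigma by (rule sigma_sets_mono') auto
  then have "sets (traj_sigma \<Omega> E X {t..s}) \<union> null_sets (completion (P t x)) \<subseteq> sets M"
    by (auto simp: M_def)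
  then show ?thesis
    unfolding sets_F using sets.sigma_sets_subset[of _ M] by simp
qed

lemma sets_F_mono: "s \<le> s' \<Longrightarrow> sets (F s) \<subseteq> sets (F s')"
proof -
  assume "s \<le> s'"
  then have "{t..s} \<subseteq> {t..s'}" by auto
  then have "sets (traj_sigma \<Omega> E X {t..s}) \<subseteq> sets (traj_sigma \<Omega> E X {t..s'})"
    unfolding sets_traj_sigma by (intro sigma_sets_mono') blast
  then show ?thesis unfolding sets_F by (intro sigma_sets_mono' Un_mono) auto
qed

lemma measurable_F_M: "f \<in> measurable (F s) B \<Longrightarrow> f \<in> measurable M B"
  using sets_F_subset_M[of s] by (auto simp: measurable_def)

lemma measurable_F_mono: "f \<in> measurable (F s) B \<Longrightarrow> s \<le> s' \<Longrightarrow> f \<in> measurable (F s') B"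
  using sets_F_mono[of s s'] by (auto simp: measurable_def)

lemma space_LT [simp]: "space LT = {t..T}"
  by (simp add: space_restrict_space)

sublocale LT: finite_measure LT
  by (rule finite_measureI) (simp add: emeasure_restrict_space emeasure_lborel_Icc_eq)

sublocale N: pair_sigma_finite LT M ..

sublocale N: finite_measure N
  by (rule finite_measure_pair_measure) unfold_locales

lemma space_N: "space N = {t..T} \<times> \<Omega>"
  by (simp add: space_pair_measure)

lemma measurable_id_LT: "(\<lambda>r. r) \<in> borel_measurable LT"
  by (rule measurable_restrict_space1) auto

lemma measurable_time_N [measurable]: "fst \<in> borel_measurable N"
proof -
  have "(\<lambda>p. fst p) \<in> borel_measurable N"
    by (rule measurable_compose[OF measurable_fst measurable_id_LT])
  then show ?thesis by simp
qed

text \<open>Right continuity in the discrete topology: approximating \<open>r\<close> from the right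
  by times with countably many values, \<open>X\<close> eventually agrees exactly with its value at
  \<open>r\<close>. The limit is taken for indicators of \<open>A\<close>, because the state space
  carries no topology.\<close>

lemma measurable_X_joint [measurable]: "(\<lambda>(r, \<omega>). X r \<omega>) \<in> measurable N E"
proof (rule measurableI)
  fix p assume "p \<in> space N"
  then show "(case p of (r, \<omega>) \<Rightarrow> X r \<omega>) \<in> space E" using X_space t_nonneg by (auto simp: space_N)
next
  fix A assume A: "A \<in> sets E"
  \<comment> \<open>The least multiple of \<open>1 / Suc n\<close> strictly above \<open>r\<close>.
    The maximum with \<open>t\<close> changes nothing for \<open>r \<ge> t\<close>, but makes
    \<open>measurable_X\<close> applicable for every integer in place of the floor.\<close>
  define d where "d n r = max t ((of_int \<lfloor>r * real (Suc n)\<rfloor> + 1) / real (Suc n))" for n and r :: real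
  have d_bounds: "r \<le> d n r" "d n r \<le> r + 1 / real (Suc n)" if "t \<le> r" for n r
  proof -
    have "r * real (Suc n) < of_int \<lfloor>r * real (Suc n)\<rfloor> + 1" by linarith
    then have "r < (of_int \<lfloor>r * real (Suc n)\<rfloor> + 1) / real (Suc n)" by (simp add: less_divide_eq)
    then show "r \<le> d n r" unfolding d_def by simp
    have "of_int \<lfloor>r * real (Suc n)\<rfloor> + 1 \<le> r * real (Suc n) + 1" by linarith
    then have "(of_int \<lfloor>r * real (Suc n)\<rfloor> + 1) / real (Suc n) \<le> (r * real (Suc n) + 1) / real (Suc n)"
      by (rule divide_right_mono) simp
    moreover have "(r * real (Suc n) + 1) / real (Suc n) = r + 1 / real (Suc n)"
      by (simp add: add_divide_distrib)
    ultimately show "d n r \<le> r + 1 / real (Suc n)" using that unfolding d_def by (auto intro: order_trans)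
  qed
  have lim: "(\<lambda>n. indicator A (X (d n r) \<omega>) :: real) \<longlonglongrightarrow> indicator A (X r \<omega>)" if "r \<in> {t..T}" "\<omega> \<in> \<Omega>" for r \<omega>
  proof -
    have "0 \<le> r" using that t_nonneg by simp
    from X_right_const[OF this that(2)]
    obtain \<delta> where \<delta>: "\<delta> > 0" "\<And>s. s \<in> {r..r + \<delta>} \<Longrightarrow> X s \<omega> = X r \<omega>"
      by blast
    have "(\<lambda>n. 1 / real (Suc n)) \<longlonglongrightarrow> 0" by real_asymp
    then have "\<forall>\<^sub>F n in sequentially. 1 / real (Suc n) < \<delta>" using \<delta>(1) by (rule order_tendstoD)
    then have "\<forall>\<^sub>F n in sequentially. indicator A (X (d n r) \<omega>) = (indicator A (X r \<omega>) :: real)"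
    proof eventually_elim
      case (elim n)
      have "d n r \<in> {r..r + \<delta>}" using d_bounds[of r n] elim that by auto
      from \<delta>(2)[OF this] show ?case by simp
    qed
    then show ?thesis by (rule tendsto_eventually)
  qed
  have approx: "(\<lambda>p. indicator A (X (d n (fst p)) (snd p)) :: real) \<in> borel_measurable N" for n
  proof -
    have "(\<lambda>p. fst p * real (Suc n)) \<in> borel_measurable N"
      using measurable_time_N by (rule borel_measurable_times) simp
    then have fl: "(\<lambda>p. \<lfloor>fst p * real (Suc n)\<rfloor>) \<in> measurable N (count_space UNIV)"
      by (rule measurable_compose) simp
    have "(\<lambda>p. indicator A (X (max t ((of_int k + 1) / real (Suc n))) (snd p)) :: real) \<in> borel_measurable N" for k :: int
    proof -

      have "(\<lambda>\<omega>. indicator A (X (max t ((of_int k + 1) / real (Suc n))) \<omega>) :: real) \<in> borel_measurable M"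
        by (rule measurable_compose[OF measurable_X borel_measurable_indicator[OF A]]) simp
      then show ?thesis by (rule measurable_compose[OF measurable_snd])
    qed
    from measurable_compose_countable[OF this fl] show ?thesis unfolding d_def .
  qed
  have "(\<lambda>p. indicator A (X (fst p) (snd p)) :: real) \<in> borel_measurable N"
  proof (rule borel_measurable_LIMSEQ_real)
    show "(\<lambda>n. indicator A (X (d n (fst p)) (snd p)) :: real) \<longlonglongrightarrow> indicator A (X (fst p) (snd p))"
      if "p \<in> space N" for p
      using that by (intro lim) (auto simp: space_N)
  qed (rule approx)
  then have "{p \<in> space N. indicator A (X (fst p) (snd p)) = (1::real)} \<in> sets N" by measurable
  also have "{p \<in> space N. indicator A (X (fst p) (snd p)) = (1::real)} = (\<lambda>(r, \<omega>). X r \<omega>) -` A \<inter> space N"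
    by (auto simp: indicator_def split: if_splits)
  finally show "(\<lambda>(r, \<omega>). X r \<omega>) -` A \<inter> space N \<in> sets N" .
qed

section \<open>The rate kernel along the trajectory\<close>

lemma sets_v: "s \<in> {t..T} \<Longrightarrow> y \<in> space E \<Longrightarrow> sets (v s y) = sets E"
  using rate t_nonneg unfolding rate_measure_def by auto

lemma space_v: "s \<in> {t..T} \<Longrightarrow> y \<in> space E \<Longrightarrow> space (v s y) = space E"
  using sets_v by (rule sets_eq_imp_space_eq)

lemma v_bound_ex: "\<exists>C>0. \<forall>s\<in>{t..T}. \<forall>y\<in>space E. emeasure (v s y) (space E) \<le> ennreal C"
proof -
  let ?S = "SUP (s, x)\<in>{0..T} \<times> space E. emeasure (v s x) (space E)"
  have S: "?S < \<infinity>" using rate unfolding rate_measure_def by (elim conjE)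
  \<comment> \<open>The summand 1 keeps the bound positive even if the rate vanishes; positivity is
    needed for scaling the kernel.\<close>
  have le: "emeasure (v s y) (space E) \<le> ennreal (enn2real ?S + 1)" if "s \<in> {t..T}" "y \<in> space E" for s y
  proof -
    have "emeasure (v s y) (space E) \<le> ?S"
      using that t_nonneg by (intro SUP_upper2[of "(s, y)"]) auto
    also have "\<dots> = ennreal (enn2real ?S)" using S by (simp add: less_top)
    also have "\<dots> \<le> ennreal (enn2real ?S + 1)" by (rule ennreal_leI) simp
    finally show ?thesis .
  qed
  show ?thesis by (rule exI[of _ "enn2real ?S + 1"]) (use le in \<open>auto intro: add_nonneg_pos\<close>)
qed

definition vmax :: real where
  "vmax = (SOME C. C > 0 \<and> (\<forall>s\<in>{t..T}. \<forall>y\<in>space E. emeasure (v s y) (space E) \<le> ennreal C))"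

lemma vmax_pos: "vmax > 0"
  and v_le_vmax: "s \<in> {t..T} \<Longrightarrow> y \<in> space E \<Longrightarrow> emeasure (v s y) (space E) \<le> ennreal vmax"
  using someI_ex[OF v_bound_ex] unfolding vmax_def by auto

lemma finite_measure_v: "s \<in> {t..T} \<Longrightarrow> y \<in> space E \<Longrightarrow> finite_measure (v s y)"
  using v_le_vmax[of s y] by (intro finite_measureI) (auto simp: space_v top_unique)

lemma measure_v_le:
  assumes "s \<in> {t..T}" "y \<in> space E" shows "measure (v s y) (space (v s y)) \<le> vmax"
  using enn2real_mono[OF v_le_vmax[OF assms]] vmax_pos assms by (simp add: measure_def space_v)

abbreviation measurable_field :: "(real \<Rightarrow> 'w \<Rightarrow> 'g \<Rightarrow> 'b::topological_space) \<Rightarrow> bool" where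
  "measurable_field Z \<equiv> (\<lambda>((r, \<omega>), y). Z r \<omega> y) \<in> borel_measurable (N \<Otimes>\<^sub>M E)"

text \<open>The measures \<open>v r (X r \<omega>)\<close> form the pull-back of the rate kernel
  along the jointly measurable trajectory, and their mass is at most \<open>vmax\<close>.\<close>

lemma nn_kernel_measurable:
  assumes K: "measurable_field K"
  shows "(\<lambda>(r, \<omega>). \<integral>\<^sup>+y. K r \<omega> y \<partial>v r (X r \<omega>)) \<in> borel_measurable N"
proof -
  have "(\<lambda>p. \<integral>\<^sup>+y. K (fst p) (snd p) y \<partial>v (fst p) (X (fst p) (snd p))) \<in> borel_measurable N"
  proof (rule nn_integral_bounded_kernel_measurable[where E=E and C=vmax])
    show "(\<lambda>(p, y). K (fst p) (snd p) y) \<in> borel_measurable (N \<Otimes>\<^sub>M E)"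
      using K by (simp add: case_prod_beta')
    fix A assume A: "A \<in> sets E"
    have m: "(\<lambda>(s, x). emeasure (v s x) A) \<in> borel_measurable (restrict_space borel {0..T} \<Otimes>\<^sub>M E)"
      using rate A unfolding rate_measure_def by auto
    have f: "fst \<in> measurable N (restrict_space borel {0..T})"
      using measurable_time_N t_nonneg by (intro measurable_restrict_space2) (auto simp: space_N)
    have "(\<lambda>p. X (fst p) (snd p)) \<in> measurable N E"
      using measurable_X_joint by (simp add: case_prod_beta')
    from measurable_compose[OF measurable_Pair[OF f this] m]
    show "(\<lambda>p. emeasure (v (fst p) (X (fst p) (snd p))) A) \<in> borel_measurable N" by simp
  qed (use sets_v v_le_vmax X_space t_nonneg vmax_pos x in \<open>auto simp: space_N\<close>)
  then show ?thesis by (simp add: case_prod_beta')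
qed

section \<open>Predictable fields and their sections\<close>

lemma space_predictable_sigma [simp]: "space (predictable_sigma F t T) = {t..T} \<times> \<Omega>"
  unfolding predictable_sigma_def by (simp add: space_measure_of_conv)

lemma sets_predictable_sigma: "sets (predictable_sigma F t T) = sigma_sets ({t..T} \<times> \<Omega>)
     ({{t} \<times> A |A. A \<in> sets (F t)} \<union>
      {{a<..b} \<times> A |a b A. t \<le> a \<and> a < b \<and> b \<le> T \<and> A \<in> sets (F a)})"
  (is "_ = sigma_sets _ ?G")
proof -
  have "A \<subseteq> \<Omega>" if "A \<in> sets (F s)" for A s using sets.sets_into_space[OF that] by simp
  then have "?G \<subseteq> Pow ({t..T} \<times> \<Omega>)" using t_less_T by fastforce
  then show ?thesis unfolding predictable_sigma_def space_F by (rule sets_measure_of)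
qed

lemma LT_sets: "A \<in> sets borel \<Longrightarrow> A \<subseteq> {t..T} \<Longrightarrow> A \<in> sets LT"
  by (auto simp: sets_restrict_space_iff)

lemma sets_predictable_subset: "sets (predictable_sigma F t T) \<subseteq> sets N"
proof -
  have "A \<in> sets M" if "A \<in> sets (F s)" for A s using that sets_F_subset_M by blast
  then have "{{t} \<times> A |A. A \<in> sets (F t)} \<union>
      {{a<..b} \<times> A |a b A. t \<le> a \<and> a < b \<and> b \<le> T \<and> A \<in> sets (F a)} \<subseteq> sets N"
    using t_less_T by (auto intro!: pair_measureI LT_sets)
  then have "sigma_sets (space N) ({{t} \<times> A |A. A \<in> sets (F t)} \<union>
      {{a<..b} \<times> A |a b A. t \<le> a \<and> a < b \<and> b \<le> T \<and> A \<in> sets (F a)}) \<subseteq> sets N"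
    by (rule sets.sigma_sets_subset)
  then show ?thesis unfolding sets_predictable_sigma space_N .
qed

lemma predictable_field_measurable:
  assumes "predictable_field E F t T Z"
  shows "measurable_field Z"
proof -
  have i: "(\<lambda>p. p) \<in> measurable N (predictable_sigma F t T)"
    using sets_predictable_subset by (auto simp: measurable_def space_N)
  have "(\<lambda>p. (fst p, snd p)) \<in> measurable (N \<Otimes>\<^sub>M E) (predictable_sigma F t T \<Otimes>\<^sub>M E)"
    by (intro measurable_Pair measurable_compose[OF measurable_fst i] measurable_snd)
  from measurable_compose[OF this assms[unfolded predictable_field_def]] show ?thesis by simp
qed

lemma field_section_measurable:
  assumes Z: "measurable_field Z" and \<omega>: "\<omega> \<in> \<Omega>"
  shows "(\<lambda>(r, y). Z r \<omega> y) \<in> borel_measurable (LT \<Otimes>\<^sub>M E)"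
    and "r \<in> {t..T} \<Longrightarrow> Z r \<omega> \<in> borel_measurable E"
proof -
  have "(\<lambda>p. ((fst p, \<omega>), snd p)) \<in> measurable (LT \<Otimes>\<^sub>M E) (N \<Otimes>\<^sub>M E)"
    using \<omega> by (intro measurable_Pair measurable_fst measurable_snd measurable_const) auto
  from measurable_compose[OF this Z] show 1: "(\<lambda>(r, y). Z r \<omega> y) \<in> borel_measurable (LT \<Otimes>\<^sub>M E)"
    by (simp add: case_prod_beta')
  assume "r \<in> {t..T}"
  then have "Pair r \<in> measurable E (LT \<Otimes>\<^sub>M E)" by (intro measurable_Pair1') simp
  from measurable_compose[OF this 1] show "Z r \<omega> \<in> borel_measurable E" by simp
qed

text \<open>Fields are measurable only over \<open>[t, T]\<close>, whereas the jump measure lives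
  over the whole time axis. The strip is where both descriptions can be compared.\<close>

lemma strip_measurable:
  assumes h: "h \<in> measurable (LT \<Otimes>\<^sub>M E) B" and s: "t \<le> s"
  shows "h \<in> measurable (restrict_space (borel \<Otimes>\<^sub>M E) ({s<..T} \<times> space E)) B"
proof -
  let ?R = "restrict_space (borel \<Otimes>\<^sub>M E) ({s<..T} \<times> space E)"
  have sp: "space ?R = {s<..T} \<times> space E" by (auto simp: space_restrict_space space_pair_measure)
  have 1: "fst \<in> measurable ?R LT"
    using s by (intro measurable_restrict_space2 measurable_restrict_space1) (auto simp: sp measurable_lborel1)
  have 2: "snd \<in> measurable ?R E"
    by (intro measurable_restrict_space1 measurable_snd)
  have "(\<lambda>p. (fst p, snd p)) \<in> measurable ?R (LT \<Otimes>\<^sub>M E)"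
    by (rule measurable_Pair[OF 1 2])
  from measurable_compose[OF this h] show ?thesis by simp
qed

lemma strip_sets: "{s<..T} \<times> space E \<inter> space (borel \<Otimes>\<^sub>M E) \<in> sets (borel \<Otimes>\<^sub>M E)"
  by (auto simp: space_pair_measure Int_absorb2 Int_commute intro!: pair_measureI)

section \<open>Integration against the jump measure and the compensator formula\<close>

lemma measurable_jump_map:
  assumes "\<omega> \<in> \<Omega>"
  shows "(\<lambda>r. (r, X r \<omega>)) \<in> measurable (count_space (jump_times X t \<omega>)) (borel \<Otimes>\<^sub>M E)"
  using assms X_space t_nonneg by (auto simp: space_pair_measure jump_times_def)

lemma nn_integral_jump_measure:
  fixes K :: "real \<Rightarrow> 'g \<Rightarrow> ennreal"
  assumes K: "(\<lambda>(r, y). K r y) \<in> borel_measurable (LT \<Otimes>\<^sub>M E)" and \<omega>: "\<omega> \<in> \<Omega>" and s: "t \<le> s"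
  shows "(\<integral>\<^sup>+p\<in>{s<..T} \<times> space E. K (fst p) (snd p) \<partial>jump_measure E X t \<omega>)
    = (\<Sum>r\<in>jump_times X t \<omega> \<inter> {s<..T}. K r (X r \<omega>))"
proof -
  have K': "(\<lambda>p. K (fst p) (snd p)) \<in> borel_measurable (LT \<Otimes>\<^sub>M E)" using K by (simp add: case_prod_beta')
  have m: "(\<lambda>p. K (fst p) (snd p) * indicator ({s<..T} \<times> space E) p) \<in> borel_measurable (borel \<Otimes>\<^sub>M E)"
    by (rule iffD1[OF borel_measurable_restrict_space_iff_ennreal[OF strip_sets] strip_measurable[OF K' s]])
  have "(\<integral>\<^sup>+p\<in>{s<..T} \<times> space E. K (fst p) (snd p) \<partial>jump_measure E X t \<omega>)
    = (\<integral>\<^sup>+r. K r (X r \<omega>) * indicator ({s<..T} \<times> space E) (r, X r \<omega>) \<partial>count_space (jump_times X t \<omega>))"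
    unfolding jump_measure_def using m by (subst nn_integral_distr[OF measurable_jump_map[OF \<omega>]]) auto
  also have "\<dots> = (\<Sum>r\<in>jump_times X t \<omega> \<inter> {s<..T}. K r (X r \<omega>) * indicator ({s<..T} \<times> space E) (r, X r \<omega>))"
    by (rule nn_integral_count_space') (auto simp: finite_jumps[OF \<omega>] indicator_def)
  also have "\<dots> = (\<Sum>r\<in>jump_times X t \<omega> \<inter> {s<..T}. K r (X r \<omega>))"
    using X_space[OF _ \<omega>] s t_nonneg by (intro sum.cong) (auto simp: indicator_def)
  finally show ?thesis .
qed

text \<open>The set of all jump times may be infinite, but the integrand vanishes off the finitely
  many jumps in \<open>{s<..T}\<close>, so the integral over the counting measure is a finite
  sum.\<close>

lemma integral_jump_measure:
  fixes Z :: "real \<Rightarrow> 'g \<Rightarrow> real"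
  assumes Z: "(\<lambda>(r, y). Z r y) \<in> borel_measurable (LT \<Otimes>\<^sub>M E)" and \<omega>: "\<omega> \<in> \<Omega>" and s: "t \<le> s"
  shows "(LINT p:{s<..T} \<times> space E|jump_measure E X t \<omega>. Z (fst p) (snd p))
    = (\<Sum>r\<in>jump_times X t \<omega> \<inter> {s<..T}. Z r (X r \<omega>))"
proof -
  let ?J = "jump_times X t \<omega>" and ?f = "\<lambda>r. indicator ({s<..T} \<times> space E) (r, X r \<omega>) *\<^sub>R Z r (X r \<omega>)"
  have Z': "(\<lambda>p. Z (fst p) (snd p)) \<in> borel_measurable (LT \<Otimes>\<^sub>M E)" using Z by (simp add: case_prod_beta')
  have m: "(\<lambda>p. indicator ({s<..T} \<times> space E) p *\<^sub>R Z (fst p) (snd p)) \<in> borel_measurable (borel \<Otimes>\<^sub>M E)"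
    by (rule iffD1[OF borel_measurable_restrict_space_iff[OF strip_sets] strip_measurable[OF Z' s]])
  have "(LINT p:{s<..T} \<times> space E|jump_measure E X t \<omega>. Z (fst p) (snd p)) = (\<integral>r. ?f r \<partial>count_space ?J)"
    unfolding jump_measure_def set_lebesgue_integral_def
    by (subst integral_distr[OF measurable_jump_map[OF \<omega>] m]) simp
  also have "\<dots> = (\<Sum>r\<in>{r \<in> ?J. ?f r \<noteq> 0}. ?f r)"
    by (rule lebesgue_integral_count_space_finite_support)
       (rule finite_subset[OF _ finite_jumps[OF \<omega>, of s T]], auto simp: indicator_def)
  also have "\<dots> = (\<Sum>r\<in>?J \<inter> {s<..T}. ?f r)"
    by (rule sum.mono_neutral_left) (auto simp: finite_jumps[OF \<omega>] indicator_def)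
  also have "\<dots> = (\<Sum>r\<in>?J \<inter> {s<..T}. Z r (X r \<omega>))"
    using X_space[OF _ \<omega>] s t_nonneg by (intro sum.cong) (auto simp: indicator_def)
  finally show ?thesis .
qed

text \<open>Off the jump times the trajectory is already equal to \<open>X s\<close> just before
  \<open>s\<close>, and the description is unique because \<open>at_left s\<close> is a nontrivial
  filter.\<close>

lemma left_lim_eq:
  assumes "t < s" "s \<notin> jump_times X t \<omega>"
  shows "left_lim X s \<omega> = X s \<omega>"
proof -
  have ev: "\<forall>\<^sub>F r in at_left s. X r \<omega> = X s \<omega>" using assms by (auto simp: jump_times_def)
  show ?thesis unfolding left_lim_def
  proof (rule the_equality[where P="\<lambda>y. \<forall>\<^sub>F r in at_left s. X r \<omega> = y", OF ev])
    fix y assume "\<forall>\<^sub>F r in at_left s. X r \<omega> = y"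
    with ev have "\<forall>\<^sub>F r in at_left s. y = X s \<omega>" by eventually_elim simp
    then show "y = X s \<omega>" by (simp add: eventually_const_iff)
  qed
qed

lemma AE_left_lim:
  assumes "\<omega> \<in> \<Omega>" shows "AE s in lborel. s \<in> {t<..T} \<longrightarrow> left_lim X s \<omega> = X s \<omega>"
proof (rule AE_I')
  show "jump_times X t \<omega> \<inter> {t<..T} \<in> null_sets lborel"
    using finite_jumps[OF assms] by (rule finite_imp_null_set_lborel)
qed (use left_lim_eq in auto)

lemma nn_integral_LT:
  "(\<integral>\<^sup>+r. g r \<partial>LT) = (\<integral>\<^sup>+r\<in>{t..T}. g r \<partial>lborel)"
  by (rule nn_integral_restrict_space) simp

text \<open>The defining property of the rate measure in the form used below: on each path the left
  limit differs from \<open>X\<close> at finitely many times only, the time \<open>t\<close> is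
  null, and the iterated integral becomes one over \<open>N\<close>.\<close>

lemma compensator:
  assumes K: "predictable_field E F t T K"
  shows "(\<integral>\<^sup>+\<omega>. (\<Sum>r\<in>jump_times X t \<omega> \<inter> {t<..T}. K r \<omega> (X r \<omega>)) \<partial>M)
    = (\<integral>\<^sup>+(r, \<omega>). (\<integral>\<^sup>+y. K r \<omega> y \<partial>v r (X r \<omega>)) \<partial>N)"
proof -
  note Km = predictable_field_measurable[OF K]
  have "\<forall>r x. 0 \<le> r \<and> r < T \<and> x \<in> space E \<longrightarrow>
       (\<forall>H :: real \<Rightarrow> 'w \<Rightarrow> 'g \<Rightarrow> ennreal.
         predictable_field E (completed_filtration E X (P r x) r) r T H \<longrightarrow>
         (\<integral>\<^sup>+\<omega>. (\<integral>\<^sup>+p\<in>{r<..T} \<times> space E. H (fst p) \<omega> (snd p) \<partial>jump_measure E X r \<omega>)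
            \<partial>completion (P r x)) =
         (\<integral>\<^sup>+\<omega>. (\<integral>\<^sup>+s\<in>{r<..T}. (\<integral>\<^sup>+y. H s \<omega> y \<partial>v s (left_lim X s \<omega>)) \<partial>lborel)
            \<partial>completion (P r x)))"
    using rate unfolding rate_measure_def by (elim conjE)
  then have eq: "(\<integral>\<^sup>+\<omega>. (\<integral>\<^sup>+p\<in>{t<..T} \<times> space E. K (fst p) \<omega> (snd p) \<partial>jump_measure E X t \<omega>) \<partial>M) =
         (\<integral>\<^sup>+\<omega>. (\<integral>\<^sup>+s\<in>{t<..T}. (\<integral>\<^sup>+y. K s \<omega> y \<partial>v s (left_lim X s \<omega>)) \<partial>lborel) \<partial>M)"
    using t_nonneg t_less_T x K unfolding M_def F_def by blast
  have "(\<integral>\<^sup>+\<omega>. (\<Sum>r\<in>jump_times X t \<omega> \<inter> {t<..T}. K r \<omega> (X r \<omega>)) \<partial>M)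
    = (\<integral>\<^sup>+\<omega>. (\<integral>\<^sup>+p\<in>{t<..T} \<times> space E. K (fst p) \<omega> (snd p) \<partial>jump_measure E X t \<omega>) \<partial>M)"
    by (intro nn_integral_cong nn_integral_jump_measure[symmetric] field_section_measurable[OF Km]) auto
  also have "\<dots> = (\<integral>\<^sup>+\<omega>. (\<integral>\<^sup>+s. (\<integral>\<^sup>+y. K s \<omega> y \<partial>v s (X s \<omega>)) \<partial>LT) \<partial>M)"
    unfolding eq nn_integral_LT
  proof (rule nn_integral_cong, rule nn_integral_cong_AE)
    fix \<omega> assume "\<omega> \<in> space M"
    then have "AE s in lborel. s \<in> {t<..T} \<longrightarrow> left_lim X s \<omega> = X s \<omega>" by (intro AE_left_lim) simp
    with AE_lborel_singleton[of t]
    show "AE s in lborel. (\<integral>\<^sup>+y. K s \<omega> y \<partial>v s (left_lim X s \<omega>)) * indicator {t<..T} s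
      = (\<integral>\<^sup>+y. K s \<omega> y \<partial>v s (X s \<omega>)) * indicator {t..T} s"
      by eventually_elim (auto simp: indicator_def)
  qed
  also have "\<dots> = (\<integral>\<^sup>+(r, \<omega>). (\<integral>\<^sup>+y. K r \<omega> y \<partial>v r (X r \<omega>)) \<partial>N)"
    using N.nn_integral_snd[OF nn_kernel_measurable[OF Km]] by simp
  finally show ?thesis .
qed

end

section \<open>Compensated integrals\<close>

context jump_process
begin

section \<open>Jump sums and rate integrals\<close>

text \<open>Kept in \<open>ennreal\<close> because for a field of finite norm it is finite only
  almost everywhere.\<close>

definition nsq :: "(real \<Rightarrow> 'w \<Rightarrow> 'g \<Rightarrow> real) \<Rightarrow> real \<Rightarrow> 'w \<Rightarrow> ennreal" where
  "nsq Z r \<omega> = (\<integral>\<^sup>+y. ennreal ((Z r \<omega> y)\<^sup>2) \<partial>v r (X r \<omega>))"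

definition L2_field :: "(real \<Rightarrow> 'w \<Rightarrow> 'g \<Rightarrow> real) \<Rightarrow> bool" where
  "L2_field Z \<longleftrightarrow> predictable_field E F t T Z \<and> Z_norm_sq M X v t T Z < \<infinity>"

definition jump_sum :: "(real \<Rightarrow> 'w \<Rightarrow> 'g \<Rightarrow> real) \<Rightarrow> real \<Rightarrow> 'w \<Rightarrow> real" where
  "jump_sum Z s \<omega> = (\<Sum>r\<in>jump_times X t \<omega> \<inter> {s<..T}. Z r \<omega> (X r \<omega>))"

definition rate_int :: "(real \<Rightarrow> 'w \<Rightarrow> 'g \<Rightarrow> real) \<Rightarrow> real \<Rightarrow> 'w \<Rightarrow> real" where
  "rate_int Z r \<omega> = (LINT y|v r (X r \<omega>). Z r \<omega> y)"

definition comp_int :: "(real \<Rightarrow> 'w \<Rightarrow> 'g \<Rightarrow> real) \<Rightarrow> real \<Rightarrow> 'w \<Rightarrow> real" where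
  "comp_int Z s \<omega> = (\<integral>r. indicator {s<..T} r * rate_int Z r \<omega> \<partial>LT)"

lemma v_X:
  assumes "r \<in> {t..T}" "\<omega> \<in> \<Omega>"
  shows "sets (v r (X r \<omega>)) = sets E" "finite_measure (v r (X r \<omega>))"
    "measure (v r (X r \<omega>)) (space (v r (X r \<omega>))) \<le> vmax"
    "emeasure (v r (X r \<omega>)) (space (v r (X r \<omega>))) \<le> ennreal vmax"
  using assms X_space[of r \<omega>] t_nonneg sets_v finite_measure_v measure_v_le v_le_vmax space_v by auto

lemma field_v_measurable:
  assumes "measurable_field Z" "r \<in> {t..T}" "\<omega> \<in> \<Omega>"
  shows "Z r \<omega> \<in> borel_measurable (v r (X r \<omega>))"
  using field_section_measurable(2)[OF assms(1,3,2)] v_X(1)[OF assms(2,3)] by (simp cong: measurable_cong_sets)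

lemma integral_LT:
  fixes g :: "real \<Rightarrow> real"
  assumes "A \<in> sets borel" "A \<subseteq> {t..T}"
  shows "(\<integral>r. indicator A r * g r \<partial>LT) = (LINT r:A|lborel. g r)"
  unfolding set_lebesgue_integral_def
  using assms(2) by (subst integral_restrict_space) (auto intro!: Bochner_Integration.integral_cong simp: indicator_def)

text \<open>Replacing the left limit by \<open>X\<close> affects only the jump times, a countable
  set that does not change the Lebesgue integral.\<close>

lemma q_integral_eq:
  assumes Z: "measurable_field Z" and \<omega>: "\<omega> \<in> \<Omega>" and s: "s \<in> {t..T}"
  shows "q_integral E X v t s T Z \<omega> = jump_sum Z s \<omega> - comp_int Z s \<omega>"
proof -
  have "(LINT p:{s<..T} \<times> space E|jump_measure E X t \<omega>. Z (fst p) \<omega> (snd p)) = jump_sum Z s \<omega>"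
    unfolding jump_sum_def
    by (rule integral_jump_measure) (use field_section_measurable[OF Z \<omega>] \<omega> s in auto)
  moreover have "(LINT r:{s<..T}|lborel. (LINT y|v r (left_lim X r \<omega>). Z r \<omega> y)) = comp_int Z s \<omega>"
  proof -
    have "comp_int Z s \<omega> = (LINT r:{s<..T}|lborel. rate_int Z r \<omega>)"
      unfolding comp_int_def using s by (intro integral_LT) auto
    also have "\<dots> = (LINT r:{s<..T}|lborel. (LINT y|v r (left_lim X r \<omega>). Z r \<omega> y))"
      unfolding set_lebesgue_integral_def
    proof (rule integral_discrete_difference[where X="jump_times X t \<omega> \<inter> {s<..T}"])
      show "countable (jump_times X t \<omega> \<inter> {s<..T})"
        using finite_jumps[OF \<omega>] by (rule countable_finite)
      fix r assume "r \<notin> jump_times X t \<omega> \<inter> {s<..T}"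
      then show "indicat_real {s<..T} r *\<^sub>R rate_int Z r \<omega>
        = indicat_real {s<..T} r *\<^sub>R (LINT y|v r (left_lim X r \<omega>). Z r \<omega> y)"
        using left_lim_eq[of r \<omega>] s by (auto simp: indicator_def rate_int_def)
    qed auto
    finally show ?thesis ..
  qed
  ultimately show ?thesis by (simp add: q_integral_def)
qed

lemma nsq_measurable:
  assumes "measurable_field Z"
  shows "(\<lambda>(r, \<omega>). nsq Z r \<omega>) \<in> borel_measurable N"
  unfolding nsq_def using assms by (intro nn_kernel_measurable) (simp add: case_prod_beta')

text \<open>The integral is written as the difference of its positive and negative parts where the
  absolute integral is finite, and as 0 elsewhere, in accordance with the value of the Bochner
  integral of a nonintegrable function.\<close>

lemma rate_int_measurable:
  assumes Z: "measurable_field Z"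
  shows "(\<lambda>(r, \<omega>). rate_int Z r \<omega>) \<in> borel_measurable N"
proof -
  let ?A = "\<lambda>r \<omega>. \<integral>\<^sup>+y. ennreal \<bar>Z r \<omega> y\<bar> \<partial>v r (X r \<omega>)"
  let ?P = "\<lambda>r \<omega>. \<integral>\<^sup>+y. ennreal (Z r \<omega> y) \<partial>v r (X r \<omega>)"
  let ?Q = "\<lambda>r \<omega>. \<integral>\<^sup>+y. ennreal (- Z r \<omega> y) \<partial>v r (X r \<omega>)"
  have Z': "(\<lambda>p. Z (fst (fst p)) (snd (fst p)) (snd p)) \<in> borel_measurable (N \<Otimes>\<^sub>M E)"
    using Z by (simp add: case_prod_beta')
  have [measurable]: "(\<lambda>p. ?A (fst p) (snd p)) \<in> borel_measurable N"
    "(\<lambda>p. ?P (fst p) (snd p)) \<in> borel_measurable N" "(\<lambda>p. ?Q (fst p) (snd p)) \<in> borel_measurable N"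
    using nn_kernel_measurable[of "\<lambda>r \<omega> y. ennreal \<bar>Z r \<omega> y\<bar>"] nn_kernel_measurable[of "\<lambda>r \<omega> y. ennreal (Z r \<omega> y)"]
      nn_kernel_measurable[of "\<lambda>r \<omega> y. ennreal (- Z r \<omega> y)"] Z' by (simp_all add: case_prod_beta')
  have "(\<lambda>p. if ?A (fst p) (snd p) < \<infinity> then enn2real (?P (fst p) (snd p)) - enn2real (?Q (fst p) (snd p)) else 0)
    \<in> borel_measurable N" by measurable
  moreover have "(case p of (r, \<omega>) \<Rightarrow> rate_int Z r \<omega>)
      = (if ?A (fst p) (snd p) < \<infinity> then enn2real (?P (fst p) (snd p)) - enn2real (?Q (fst p) (snd p)) else 0)"
    if p: "p \<in> space N" for p
  proof -
    obtain r \<omega> where p': "p = (r, \<omega>)" "r \<in> {t..T}" "\<omega> \<in> \<Omega>" using p by (auto simp: space_N)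
    have "integrable (v r (X r \<omega>)) (Z r \<omega>) \<longleftrightarrow> ?A r \<omega> < \<infinity>"
      using field_v_measurable[OF Z p'(2,3)] by (simp add: integrable_iff_bounded)
    then show ?thesis
      unfolding p' rate_int_def by (auto simp: real_lebesgue_integral_def not_integrable_integral_eq)
  qed
  ultimately show ?thesis by (subst measurable_cong) auto
qed

lemma Z_norm_sq_eq:
  assumes Z: "measurable_field Z" and s: "s \<in> {t..T}"
  shows "Z_norm_sq M X v s T Z = (\<integral>\<^sup>+p. indicator {s..T} (fst p) * nsq Z (fst p) (snd p) \<partial>N)"
proof -
  have [measurable]: "(\<lambda>p. nsq Z (fst p) (snd p)) \<in> borel_measurable N"
    using nsq_measurable[OF Z] by (simp add: case_prod_beta')
  have "(\<integral>\<^sup>+p. indicator {s..T} (fst p) * nsq Z (fst p) (snd p) \<partial>N)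
    = (\<integral>\<^sup>+\<omega>. (\<integral>\<^sup>+r. indicator {s..T} r * nsq Z r \<omega> \<partial>LT) \<partial>M)"
    by (subst N.nn_integral_snd[symmetric]) (auto simp: case_prod_beta')
  also have "\<dots> = Z_norm_sq M X v s T Z"
    unfolding Z_norm_sq_def nsq_def[symmetric] nn_integral_LT
    using s by (intro nn_integral_cong) (auto simp: indicator_def)
  finally show ?thesis ..
qed

lemma Y_norm_sq_eq:
  assumes Y: "(\<lambda>p. Y (fst p) (snd p)) \<in> borel_measurable N" and s: "s \<in> {t..T}"
  shows "Y_norm_sq M s T Y = (\<integral>\<^sup>+p. indicator {s..T} (fst p) * ennreal ((Y (fst p) (snd p))\<^sup>2) \<partial>N)"
proof -
  note Y[measurable]
  have "(\<integral>\<^sup>+p. indicator {s..T} (fst p) * ennreal ((Y (fst p) (snd p))\<^sup>2) \<partial>N)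
    = (\<integral>\<^sup>+\<omega>. (\<integral>\<^sup>+r. indicator {s..T} r * ennreal ((Y r \<omega>)\<^sup>2) \<partial>LT) \<partial>M)"
    by (subst N.nn_integral_snd[symmetric]) (auto simp: case_prod_beta')
  also have "\<dots> = Y_norm_sq M s T Y"
    unfolding Y_norm_sq_def nn_integral_LT
    using s by (intro nn_integral_cong) (auto simp: indicator_def)
  finally show ?thesis ..
qed

lemma L2_fieldD:
  assumes "L2_field Z"
  shows "measurable_field Z"
    and "(\<lambda>p. nsq Z (fst p) (snd p)) \<in> borel_measurable N"
    and "(\<integral>\<^sup>+p. nsq Z (fst p) (snd p) \<partial>N) < \<infinity>"
    and "AE p in N. nsq Z (fst p) (snd p) < \<infinity>"
    and "integrable N (\<lambda>p. enn2real (nsq Z (fst p) (snd p)))"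
    and "\<And>A. A \<in> sets borel \<Longrightarrow> (\<integral>\<^sup>+p. indicator A (fst p) * nsq Z (fst p) (snd p) \<partial>N) =
      ennreal (\<integral>p. indicator A (fst p) * enn2real (nsq Z (fst p) (snd p)) \<partial>N)"
proof -
  show Z: "measurable_field Z"
    using assms by (intro predictable_field_measurable) (simp add: L2_field_def)
  show m[measurable]: "(\<lambda>p. nsq Z (fst p) (snd p)) \<in> borel_measurable N"
    using nsq_measurable[OF Z] by (simp add: case_prod_beta')
  have "(\<integral>\<^sup>+p. nsq Z (fst p) (snd p) \<partial>N) = (\<integral>\<^sup>+p. indicator {t..T} (fst p) * nsq Z (fst p) (snd p) \<partial>N)"
    by (intro nn_integral_cong) (auto simp: space_N)
  then show fin: "(\<integral>\<^sup>+p. nsq Z (fst p) (snd p) \<partial>N) < \<infinity>"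
    using assms Z_norm_sq_eq[OF Z, of t] t_less_T by (simp add: L2_field_def)
  show ae: "AE p in N. nsq Z (fst p) (snd p) < \<infinity>"
    using nn_integral_PInf_AE[OF m] fin by (auto simp: less_top)
  have "(\<integral>\<^sup>+p. ennreal (enn2real (nsq Z (fst p) (snd p))) \<partial>N) = (\<integral>\<^sup>+p. nsq Z (fst p) (snd p) \<partial>N)"
    by (intro nn_integral_cong_AE eventually_mono[OF ae]) auto
  then show int: "integrable N (\<lambda>p. enn2real (nsq Z (fst p) (snd p)))"
    using fin by (intro integrableI_nonneg) auto
  fix A :: "real set" assume A[measurable]: "A \<in> sets borel"
  have "(\<integral>\<^sup>+p. indicator A (fst p) * nsq Z (fst p) (snd p) \<partial>N)
    = (\<integral>\<^sup>+p. ennreal (indicator A (fst p) * enn2real (nsq Z (fst p) (snd p))) \<partial>N)"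
    by (intro nn_integral_cong_AE eventually_mono[OF ae]) (auto simp: indicator_def)
  also have "\<dots> = ennreal (\<integral>p. indicator A (fst p) * enn2real (nsq Z (fst p) (snd p)) \<partial>N)"
  proof (intro nn_integral_eq_integral)
    show "integrable N (\<lambda>p. indicator A (fst p) * enn2real (nsq Z (fst p) (snd p)))"
      by (rule Bochner_Integration.integrable_bound[OF int]) (auto simp: indicator_def)
  qed (auto simp: indicator_def)
  finally show "(\<integral>\<^sup>+p. indicator A (fst p) * nsq Z (fst p) (snd p) \<partial>N) =
      ennreal (\<integral>p. indicator A (fst p) * enn2real (nsq Z (fst p) (snd p)) \<partial>N)" .
qed

text \<open>The total rate is at most \<open>vmax\<close>, so square integrability implies
  integrability and Cauchy-Schwarz costs the factor \<open>vmax\<close>.\<close>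

lemma nsq_finite_integrable:
  assumes Z: "measurable_field Z" and r: "r \<in> {t..T}" and \<omega>: "\<omega> \<in> \<Omega>"
    and fin: "nsq Z r \<omega> < \<infinity>"
  shows "integrable (v r (X r \<omega>)) (\<lambda>y. (Z r \<omega> y)\<^sup>2)" "integrable (v r (X r \<omega>)) (Z r \<omega>)"
    "(rate_int Z r \<omega>)\<^sup>2 \<le> vmax * enn2real (nsq Z r \<omega>)"
proof -
  note m[measurable] = field_v_measurable[OF Z r \<omega>]
  interpret V: finite_measure "v r (X r \<omega>)" by (rule v_X[OF r \<omega>])
  show sq: "integrable (v r (X r \<omega>)) (\<lambda>y. (Z r \<omega> y)\<^sup>2)"
    using fin by (intro integrableI_nonneg) (auto simp: nsq_def)
  show "integrable (v r (X r \<omega>)) (Z r \<omega>)" by (rule V.integral_power2_le(1)[OF m sq])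
  have "(rate_int Z r \<omega>)\<^sup>2 \<le> measure (v r (X r \<omega>)) (space (v r (X r \<omega>))) * (\<integral>y. (Z r \<omega> y)\<^sup>2 \<partial>v r (X r \<omega>))"
    unfolding rate_int_def by (rule V.integral_power2_le(2)[OF m sq])
  also have "\<dots> \<le> vmax * (\<integral>y. (Z r \<omega> y)\<^sup>2 \<partial>v r (X r \<omega>))"
    by (intro mult_right_mono v_X r \<omega>) simp
  also have "(\<integral>y. (Z r \<omega> y)\<^sup>2 \<partial>v r (X r \<omega>)) = enn2real (nsq Z r \<omega>)"
    unfolding nsq_def by (rule integral_eq_nn_integral) auto
  finally show "(rate_int Z r \<omega>)\<^sup>2 \<le> vmax * enn2real (nsq Z r \<omega>)" .
qed

lemma rate_int_L2:
  assumes "L2_field Z"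
  shows "(\<lambda>p. rate_int Z (fst p) (snd p)) \<in> borel_measurable N"
    and "integrable N (\<lambda>p. (rate_int Z (fst p) (snd p))\<^sup>2)"
    and "AE p in N. (rate_int Z (fst p) (snd p))\<^sup>2 \<le> vmax * enn2real (nsq Z (fst p) (snd p))"
proof -
  note D = L2_fieldD[OF assms]
  show m[measurable]: "(\<lambda>p. rate_int Z (fst p) (snd p)) \<in> borel_measurable N"
    using rate_int_measurable[OF D(1)] by (simp add: case_prod_beta')
  show ae: "AE p in N. (rate_int Z (fst p) (snd p))\<^sup>2 \<le> vmax * enn2real (nsq Z (fst p) (snd p))"
    using D(4) AE_space
  proof eventually_elim
    case (elim p)
    then show ?case by (intro nsq_finite_integrable D(1)) (auto simp: space_N)
  qed
  show "integrable N (\<lambda>p. (rate_int Z (fst p) (snd p))\<^sup>2)"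
    by (rule Bochner_Integration.integrable_bound[OF integrable_mult_right[OF D(5), of vmax]])
       (use ae vmax_pos in \<open>auto elim!: eventually_mono\<close>)
qed

lemma jump_sum_diff:
  assumes "\<omega> \<in> \<Omega>" "a \<le> b" "b \<le> T"
  shows "jump_sum Z a \<omega> - jump_sum Z b \<omega> = (\<Sum>r\<in>jump_times X t \<omega> \<inter> {a<..b}. Z r \<omega> (X r \<omega>))"
proof -
  have "jump_times X t \<omega> \<inter> {a<..T} = jump_times X t \<omega> \<inter> {a<..b} \<union> jump_times X t \<omega> \<inter> {b<..T}"
    using assms by auto
  then have "jump_sum Z a \<omega> = (\<Sum>r\<in>jump_times X t \<omega> \<inter> {a<..b}. Z r \<omega> (X r \<omega>)) + jump_sum Z b \<omega>"
    unfolding jump_sum_def by (subst sum.union_disjoint[symmetric]) (auto simp: finite_jumps[OF assms(1)])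
  then show ?thesis by simp
qed

text \<open>On a fine grid each cell holds at most one jump, so applying \<open>\<phi>\<close> to
  increments amounts to applying it to jumps. The absolute value is used for measurability, the
  square for the quadratic variation.\<close>

lemma jump_sum_grid:
  assumes \<omega>: "\<omega> \<in> \<Omega>" and s: "s \<in> {t..T}" and \<phi>: "\<phi> 0 = 0"
  shows "\<forall>\<^sub>F n in sequentially.
    (\<Sum>i<n. \<phi> (jump_sum Z (grid s T n i) \<omega> - jump_sum Z (grid s T n (Suc i)) \<omega>))
      = jump_sum (\<lambda>r \<omega> y. \<phi> (Z r \<omega> y)) s \<omega>"
proof -
  let ?S = "jump_times X t \<omega> \<inter> {s<..T}"
  have "\<forall>\<^sub>F n in sequentially. (\<Sum>i<n. \<phi> (\<Sum>r\<in>?S \<inter> {grid s T n i<..grid s T n (Suc i)}. Z r \<omega> (X r \<omega>)))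
      = (\<Sum>r\<in>?S. \<phi> (Z r \<omega> (X r \<omega>)))"
    using s by (intro grid_sum_eventually finite_jumps \<omega> \<phi>) auto
  then show ?thesis
  proof eventually_elim
    case (elim n)
    have "jump_sum Z (grid s T n i) \<omega> - jump_sum Z (grid s T n (Suc i)) \<omega>
      = (\<Sum>r\<in>?S \<inter> {grid s T n i<..grid s T n (Suc i)}. Z r \<omega> (X r \<omega>))" if "i < n" for i
    proof -
      have g: "grid s T n i \<in> {s..T}" "grid s T n (Suc i) \<in> {s..T}" "grid s T n i \<le> grid s T n (Suc i)"
        using grid_mem[of s T i n] grid_mem[of s T "Suc i" n] grid_mono[of s T i "Suc i" n] s that by auto
      then have "?S \<inter> {grid s T n i<..grid s T n (Suc i)} = jump_times X t \<omega> \<inter> {grid s T n i<..grid s T n (Suc i)}"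
        by auto
      then show ?thesis using jump_sum_diff[OF \<omega> g(3), of Z] g by simp
    qed
    then show ?case using elim by (simp add: jump_sum_def)
  qed
qed

text \<open>Measurability of the jump sums of \<open>Z\<close> at all times is inherited, because
  the jump sum of \<open>\<phi>\<close> is a pathwise limit of measurable functions of their
  increments.\<close>

lemma jump_sum_measurable:
  assumes m: "\<And>s. s \<in> {t..T} \<Longrightarrow> jump_sum Z s \<in> borel_measurable M"
    and s: "s \<in> {t..T}" and \<phi>: "\<phi> 0 = 0" "\<phi> \<in> borel_measurable borel"
  shows "jump_sum (\<lambda>r \<omega> y. \<phi> (Z r \<omega> y)) s \<in> borel_measurable M"
proof (rule borel_measurable_LIMSEQ_real)
  fix \<omega> assume "\<omega> \<in> space M"
  then show "(\<lambda>n. \<Sum>i<n. \<phi> (jump_sum Z (grid s T n i) \<omega> - jump_sum Z (grid s T n (Suc i)) \<omega>))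
    \<longlonglongrightarrow> jump_sum (\<lambda>r \<omega> y. \<phi> (Z r \<omega> y)) s \<omega>"
    using jump_sum_grid[of _ s \<phi> Z] s \<phi>(1) by (intro tendsto_eventually) auto
next
  fix n
  have "jump_sum Z (grid s T n i) \<in> borel_measurable M" if "i \<le> n" for i
    using grid_mem[of s T i n] s that by (intro m) auto
  then show "(\<lambda>\<omega>. \<Sum>i<n. \<phi> (jump_sum Z (grid s T n i) \<omega> - jump_sum Z (grid s T n (Suc i)) \<omega>)) \<in> borel_measurable M"
    by (intro borel_measurable_sum measurable_compose[OF _ \<phi>(2)] borel_measurable_diff) auto
qed

section \<open>Orthogonality of compensated integrals to the past\<close>

lemma indicator_adapted_predictable:
  assumes H: "H \<in> borel_measurable (F s)" and s: "s \<in> {t..T}"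
  shows "(\<lambda>p. indicator {s<..T} (fst p) * H (snd p) :: real) \<in> borel_measurable (predictable_sigma F t T)"
proof (rule measurableI)
  fix B :: "real set" assume B: "B \<in> sets borel"
  let ?u = "\<lambda>p. indicator {s<..T} (fst p) * H (snd p) :: real"
  have rect: "{s<..T} \<times> A \<in> sets (predictable_sigma F t T)" if "A \<in> sets (F s)" for A
  proof (cases "s < T")
    case True
    then show ?thesis unfolding sets_predictable_sigma using that s by (intro sigma_sets.Basic) auto
  qed simp
  have "H -` B \<inter> \<Omega> \<in> sets (F s)" using measurable_sets[OF H B] by simp
  moreover have "\<Omega> \<in> sets (F s)" using sets.top[of "F s"] by simp
  moreover have "?u -` B \<inter> space (predictable_sigma F t T)
    = {s<..T} \<times> (H -` B \<inter> \<Omega>) \<union> (if 0 \<in> B then space (predictable_sigma F t T) - {s<..T} \<times> \<Omega> else {})"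
    using s by (auto simp: indicator_def of_bool_def split: if_splits)
  moreover have "{t..T} \<times> \<Omega> \<in> sets (predictable_sigma F t T)"
    using sets.top[of "predictable_sigma F t T"] by simp
  ultimately show "?u -` B \<inter> space (predictable_sigma F t T) \<in> sets (predictable_sigma F t T)"
    using rect by (auto intro!: sets.Un sets.Diff)
qed auto

lemma Bochner_snd:
  fixes g :: "real \<Rightarrow> 'w \<Rightarrow> real"
  assumes "integrable N (\<lambda>p. g (fst p) (snd p))"
  shows "integrable M (\<lambda>\<omega>. \<integral>r. g r \<omega> \<partial>LT)" "(\<integral>\<omega>. (\<integral>r. g r \<omega> \<partial>LT) \<partial>M) = (\<integral>p. g (fst p) (snd p) \<partial>N)"
    "AE \<omega> in M. integrable LT (\<lambda>r. g r \<omega>)"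
    "integrable LT (\<lambda>r. \<integral>\<omega>. g r \<omega> \<partial>M)" "(\<integral>r. (\<integral>\<omega>. g r \<omega> \<partial>M) \<partial>LT) = (\<integral>p. g (fst p) (snd p) \<partial>N)"
    "AE r in LT. integrable M (\<lambda>\<omega>. g r \<omega>)"
proof -
  have g: "integrable N (\<lambda>(r, \<omega>). g r \<omega>)" using assms by (simp add: case_prod_beta')
  show "integrable M (\<lambda>\<omega>. \<integral>r. g r \<omega> \<partial>LT)" by (rule N.integrable_snd[OF g])
  show "(\<integral>\<omega>. (\<integral>r. g r \<omega> \<partial>LT) \<partial>M) = (\<integral>p. g (fst p) (snd p) \<partial>N)"
    using N.integral_snd[OF g] by (simp add: case_prod_beta')
  show "AE \<omega> in M. integrable LT (\<lambda>r. g r \<omega>)" by (rule N.AE_integrable_snd[OF g])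
  show "integrable LT (\<lambda>r. \<integral>\<omega>. g r \<omega> \<partial>M)" using N.integrable_fst[OF g] .
  show "(\<integral>r. (\<integral>\<omega>. g r \<omega> \<partial>M) \<partial>LT) = (\<integral>p. g (fst p) (snd p) \<partial>N)"
    using N.integral_fst[OF g] by (simp add: case_prod_beta')
  show "AE r in LT. integrable M (\<lambda>\<omega>. g r \<omega>)" using N.AE_integrable_fst[OF g] .
qed

text \<open>
  On a general state space the number of jumps need not be measurable, hence the assumption on
  \<open>jump_sum\<close>, without which the compensator formula would only concern lower integrals.
\<close>

lemma compensated_orthogonal:
  assumes Z: "L2_field Z" and js: "\<And>s. s \<in> {t..T} \<Longrightarrow> jump_sum Z s \<in> borel_measurable M"
    and s: "s \<in> {t..T}" and H: "H \<in> borel_measurable (F s)" and H2: "integrable M (\<lambda>\<omega>. (H \<omega>)\<^sup>2)"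
  shows "integrable M (\<lambda>\<omega>. H \<omega> * (jump_sum Z s \<omega> - comp_int Z s \<omega>))"
    and "(\<integral>\<omega>. H \<omega> * (jump_sum Z s \<omega> - comp_int Z s \<omega>) \<partial>M) = 0"
proof -
  note D = L2_fieldD[OF Z]
  note [measurable] = rate_int_L2(1)[OF Z] measurable_F_M[OF H] D(2) js[OF s]
  define u where "u r \<omega> = indicator {s<..T} r * H \<omega>" for r \<omega>
  have upred: "(\<lambda>p. u (fst p) (snd p)) \<in> borel_measurable (predictable_sigma F t T)"
    unfolding u_def by (rule indicator_adapted_predictable[OF H s])
  have uN[measurable]: "(\<lambda>p. u (fst p) (snd p)) \<in> borel_measurable N"
    unfolding u_def by measurable
  \<comment> \<open>For \<open>c = 1\<close> and \<open>c = -1\<close> these are the positive and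
    negative part of \<open>u * Z\<close>, since \<open>ennreal\<close> cuts off at 0. The
    compensator formula, stated for nonnegative fields, is applied to each.\<close>
  define K where "K c r \<omega> y = ennreal (c * (u r \<omega> * Z r \<omega> y))" for c :: real and r \<omega> y
  define \<kappa> where "\<kappa> c p = (\<integral>\<^sup>+y. K c (fst p) (snd p) y \<partial>v (fst p) (X (fst p) (snd p)))" for c p
  define pp where "pp c \<omega> = jump_sum (\<lambda>r \<omega> y. max 0 (c * (H \<omega> * Z r \<omega> y))) s \<omega>" for c \<omega>
  have Kpred: "predictable_field E F t T (K c)" for c
  proof -
    have "(\<lambda>q. Z (fst (fst q)) (snd (fst q)) (snd q)) \<in> borel_measurable (predictable_sigma F t T \<Otimes>\<^sub>M E)"
      using Z by (simp add: L2_field_def predictable_field_def case_prod_beta')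
    moreover have "(\<lambda>q. u (fst (fst q)) (snd (fst q))) \<in> borel_measurable (predictable_sigma F t T \<Otimes>\<^sub>M E)"
      by (rule measurable_compose[OF measurable_fst upred])
    ultimately show ?thesis unfolding predictable_field_def K_def by (simp add: case_prod_beta')
  qed
  have \<kappa>m[measurable]: "\<kappa> c \<in> borel_measurable N" for c
    using nn_kernel_measurable[OF predictable_field_measurable[OF Kpred[of c]]]
    by (simp add: \<kappa>_def[abs_def] case_prod_beta')
  have pp: "ennreal (pp c \<omega>) = (\<Sum>r\<in>jump_times X t \<omega> \<inter> {t<..T}. K c r \<omega> (X r \<omega>))" if "\<omega> \<in> \<Omega>" for c \<omega>
  proof -
    have "ennreal (pp c \<omega>) = (\<Sum>r\<in>jump_times X t \<omega> \<inter> {s<..T}. ennreal (max 0 (c * (H \<omega> * Z r \<omega> (X r \<omega>)))))"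
      unfolding pp_def jump_sum_def by (subst sum_ennreal) auto
    also have "\<dots> = (\<Sum>r\<in>jump_times X t \<omega> \<inter> {s<..T}. K c r \<omega> (X r \<omega>))"
      by (intro sum.cong) (auto simp: K_def u_def max_def ennreal_neg)
    also have "\<dots> = (\<Sum>r\<in>jump_times X t \<omega> \<inter> {t<..T}. K c r \<omega> (X r \<omega>))"
      using s by (intro sum.mono_neutral_left) (auto simp: finite_jumps[OF that] K_def u_def split: split_indicator_asm)
    finally show ?thesis .
  qed
  have ppm: "pp c \<in> borel_measurable M" if "\<bar>c\<bar> = 1" for c
  proof -
    \<comment> \<open>The identity \<open>max 0 (c * w) = (abs w + c * w) / 2\<close> reduces
      measurability to the jump sums of \<open>Z\<close> and of its absolute value.\<close>
    have e: "pp c \<omega> = (\<bar>H \<omega>\<bar> * jump_sum (\<lambda>r \<omega> y. \<bar>Z r \<omega> y\<bar>) s \<omega> + c * H \<omega> * jump_sum Z s \<omega>) / 2" for \<omega>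
    proof -
      have "max 0 (c * (H \<omega> * z)) = (\<bar>H \<omega>\<bar> * \<bar>z\<bar> + c * H \<omega> * z) / 2" for z :: real
      proof -
        have "max 0 (c * w) = (\<bar>w\<bar> + c * w) / 2" for w :: real
          using that by (auto simp: max_def abs_if split: if_splits)
        from this[of "H \<omega> * z"] show ?thesis by (simp add: abs_mult mult.assoc)
      qed
      then show ?thesis
        unfolding pp_def jump_sum_def sum_distrib_left sum.distrib[symmetric] sum_divide_distrib
        by (simp only:)
    qed
    have [measurable]: "jump_sum (\<lambda>r \<omega> y. \<bar>Z r \<omega> y\<bar>) s \<in> borel_measurable M"
      by (rule jump_sum_measurable[OF js s]) auto
    show ?thesis unfolding e by measurable
  qed
  \<comment> \<open>Each part is at most \<open>H^2 + Z^2\<close>, and the total rate is bounded.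
    Finiteness is what allows the two parts to be subtracted.\<close>
  have \<kappa>fin: "(\<integral>\<^sup>+p. \<kappa> c p \<partial>N) < \<infinity>" if "\<bar>c\<bar> = 1" for c
  proof -
    have "(\<integral>\<^sup>+p. \<kappa> c p \<partial>N) \<le> (\<integral>\<^sup>+p. ennreal vmax * ennreal ((H (snd p))\<^sup>2) + nsq Z (fst p) (snd p) \<partial>N)"
    proof (rule nn_integral_mono)
      fix p assume "p \<in> space N"
      then have r: "fst p \<in> {t..T}" and \<omega>: "snd p \<in> \<Omega>" by (auto simp: space_N)
      let ?v = "v (fst p) (X (fst p) (snd p))"
      have "K c (fst p) (snd p) y \<le> ennreal ((H (snd p))\<^sup>2) + ennreal ((Z (fst p) (snd p) y)\<^sup>2)" for y
      proof -
        have ab: "a * b \<le> a\<^sup>2 + b\<^sup>2" for a b :: real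
          using sum_squares_bound[of a b] zero_le_power2[of a] zero_le_power2[of b] by linarith
        have "c * (u (fst p) (snd p) * Z (fst p) (snd p) y) \<le> (H (snd p))\<^sup>2 + (Z (fst p) (snd p) y)\<^sup>2"
          using ab[of "c * H (snd p)" "Z (fst p) (snd p) y"] that
          by (auto simp: u_def indicator_def power_mult_distrib power2_eq_1_iff abs_if split: if_splits)
        then show ?thesis unfolding K_def by (simp add: ennreal_plus[symmetric] ennreal_leI del: ennreal_plus)
      qed
      then have "\<kappa> c p \<le> (\<integral>\<^sup>+y. ennreal ((H (snd p))\<^sup>2) + ennreal ((Z (fst p) (snd p) y)\<^sup>2) \<partial>?v)"
        unfolding \<kappa>_def by (intro nn_integral_mono)
      also have "\<dots> = ennreal ((H (snd p))\<^sup>2) * emeasure ?v (space ?v) + nsq Z (fst p) (snd p)"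
        using field_v_measurable[OF D(1) r \<omega>] by (subst nn_integral_add) (auto simp: nsq_def)
      also have "\<dots> \<le> ennreal ((H (snd p))\<^sup>2) * ennreal vmax + nsq Z (fst p) (snd p)"
        by (intro add_mono mult_left_mono v_X r \<omega>) auto
      finally show "\<kappa> c p \<le> ennreal vmax * ennreal ((H (snd p))\<^sup>2) + nsq Z (fst p) (snd p)"
        by (simp add: mult.commute)
    qed
    also have "\<dots> = ennreal vmax * (\<integral>\<^sup>+p. ennreal ((H (snd p))\<^sup>2) \<partial>N) + (\<integral>\<^sup>+p. nsq Z (fst p) (snd p) \<partial>N)"
      by (subst nn_integral_add) (auto simp: nn_integral_cmult)
    also have "\<dots> < \<infinity>"
    proof -
      have "(\<integral>\<^sup>+p. ennreal ((H (snd p))\<^sup>2) \<partial>N) = (\<integral>\<^sup>+\<omega>. ennreal ((H \<omega>)\<^sup>2) \<partial>M) * emeasure LT (space LT)"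
        by (subst N.nn_integral_snd[symmetric]) (auto simp: case_prod_beta' nn_integral_multc)
      also have "\<dots> < \<infinity>"
        using H2 by (simp add: nn_integral_eq_integral ennreal_mult_less_top emeasure_restrict_space emeasure_lborel_Icc_eq)
      finally show ?thesis using D(3) by (simp add: ennreal_mult_less_top)
    qed
    finally show ?thesis .
  qed
  have nnpp: "(\<integral>\<^sup>+\<omega>. ennreal (pp c \<omega>) \<partial>M) = (\<integral>\<^sup>+p. \<kappa> c p \<partial>N)" for c
  proof -
    have "(\<integral>\<^sup>+\<omega>. ennreal (pp c \<omega>) \<partial>M) = (\<integral>\<^sup>+\<omega>. (\<Sum>r\<in>jump_times X t \<omega> \<inter> {t<..T}. K c r \<omega> (X r \<omega>)) \<partial>M)"
      by (intro nn_integral_cong pp) simp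
    then show ?thesis using compensator[OF Kpred[of c]] by (simp add: \<kappa>_def case_prod_beta')
  qed
  have pp0: "pp c \<omega> \<ge> 0" for c \<omega> unfolding pp_def jump_sum_def by (intro sum_nonneg) simp
  have ppint: "integrable M (pp c)" if "\<bar>c\<bar> = 1" for c
    using ppm[OF that] \<kappa>fin[OF that] nnpp[of c] pp0 by (intro integrableI_nonneg) auto
  have \<kappa>ae: "AE p in N. \<kappa> c p < \<infinity>" if "\<bar>c\<bar> = 1" for c
    using nn_integral_PInf_AE[OF \<kappa>m] \<kappa>fin[OF that] by (auto simp: less_top)
  have nn\<kappa>: "(\<integral>\<^sup>+p. ennreal (enn2real (\<kappa> c p)) \<partial>N) = (\<integral>\<^sup>+p. \<kappa> c p \<partial>N)" if "\<bar>c\<bar> = 1" for c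
    by (intro nn_integral_cong_AE eventually_mono[OF \<kappa>ae[OF that]]) auto
  have \<kappa>int: "integrable N (\<lambda>p. enn2real (\<kappa> c p))" if "\<bar>c\<bar> = 1" for c
    using \<kappa>fin[OF that] nn\<kappa>[OF that] by (intro integrableI_nonneg) auto
  have eq: "(\<integral>\<omega>. pp c \<omega> \<partial>M) = (\<integral>p. enn2real (\<kappa> c p) \<partial>N)" if "\<bar>c\<bar> = 1" for c
    using ppm[OF that] pp0 nnpp[of c] nn\<kappa>[OF that] by (simp add: integral_eq_nn_integral)
  have Hjs: "H \<omega> * jump_sum Z s \<omega> = pp 1 \<omega> - pp (-1) \<omega>" for \<omega>
    unfolding pp_def jump_sum_def sum_subtractf[symmetric] sum_distrib_left by (intro sum.cong) auto
  have ae: "AE p in N. enn2real (\<kappa> 1 p) - enn2real (\<kappa> (-1) p) = u (fst p) (snd p) * rate_int Z (fst p) (snd p)"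
    using D(4) AE_space
  proof eventually_elim
    case (elim p)
    then have r: "fst p \<in> {t..T}" and \<omega>: "snd p \<in> \<Omega>" by (auto simp: space_N)
    let ?v = "v (fst p) (X (fst p) (snd p))"
    have "integrable ?v (Z (fst p) (snd p))"
      by (rule nsq_finite_integrable[OF D(1) r \<omega>]) (use elim in simp)
    then have "integrable ?v (\<lambda>y. u (fst p) (snd p) * Z (fst p) (snd p) y)" by simp
    then have "(\<integral>y. u (fst p) (snd p) * Z (fst p) (snd p) y \<partial>?v) = enn2real (\<kappa> 1 p) - enn2real (\<kappa> (-1) p)"
      unfolding \<kappa>_def K_def by (subst real_lebesgue_integral_def) auto
    then show ?case by (simp add: rate_int_def)
  qed
  have uint: "integrable N (\<lambda>p. u (fst p) (snd p) * rate_int Z (fst p) (snd p))"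
    by (rule integrable_cong_AE_imp[OF Bochner_Integration.integrable_diff[OF \<kappa>int[of 1] \<kappa>int[of "-1"]]])
       (use ae in \<open>auto elim: eventually_mono\<close>)
  have uint_eq: "(\<integral>p. u (fst p) (snd p) * rate_int Z (fst p) (snd p) \<partial>N) = (\<integral>\<omega>. H \<omega> * jump_sum Z s \<omega> \<partial>M)"
  proof -
    have "(\<integral>p. u (fst p) (snd p) * rate_int Z (fst p) (snd p) \<partial>N) = (\<integral>p. enn2real (\<kappa> 1 p) - enn2real (\<kappa> (-1) p) \<partial>N)"
      by (intro integral_cong_AE) (use ae in \<open>auto elim: eventually_mono\<close>)
    also have "\<dots> = (\<integral>\<omega>. H \<omega> * jump_sum Z s \<omega> \<partial>M)"
      unfolding Hjs using \<kappa>int[of 1] \<kappa>int[of "-1"] ppint[of 1] ppint[of "-1"] eq[of 1] eq[of "-1"] by simp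
    finally show ?thesis .
  qed
  have Hc: "H \<omega> * comp_int Z s \<omega> = (\<integral>r. u r \<omega> * rate_int Z r \<omega> \<partial>LT)" for \<omega>
    unfolding comp_int_def u_def integral_mult_right_zero[symmetric]
    by (intro Bochner_Integration.integral_cong) (auto simp: algebra_simps)
  note B = Bochner_snd[OF uint]
  have i1: "integrable M (\<lambda>\<omega>. H \<omega> * jump_sum Z s \<omega>)"
    unfolding Hjs using ppint[of 1] ppint[of "-1"] by simp
  have i2: "integrable M (\<lambda>\<omega>. H \<omega> * comp_int Z s \<omega>)" unfolding Hc by (rule B(1))
  show "integrable M (\<lambda>\<omega>. H \<omega> * (jump_sum Z s \<omega> - comp_int Z s \<omega>))"
    using i1 i2 by (simp add: right_diff_distrib)
  have "(\<integral>\<omega>. H \<omega> * comp_int Z s \<omega> \<partial>M) = (\<integral>\<omega>. H \<omega> * jump_sum Z s \<omega> \<partial>M)"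
    unfolding Hc B(2) uint_eq ..
  then show "(\<integral>\<omega>. H \<omega> * (jump_sum Z s \<omega> - comp_int Z s \<omega>) \<partial>M) = 0"
    using i1 i2 by (simp add: right_diff_distrib)
qed

section \<open>Passage between the product space, its sections and the filtration\<close>

lemma AE_snd_N:
  assumes "AE \<omega> in M. Q \<omega>" shows "AE p in N. Q (snd p)"
proof -
  from AE_E[OF assms] obtain A where A': "{\<omega>\<in>space M. \<not> Q \<omega>} \<subseteq> A" "emeasure M A = 0" "A \<in> sets M" .
  then have A: "{\<omega>\<in>space M. \<not> Q \<omega>} \<subseteq> A" "A \<in> null_sets M" by (auto intro: null_setsI)
  have sets: "{t..T} \<in> sets LT" "A \<in> sets M" using null_setsD2[OF A(2)] by (auto intro: LT_sets)
  have "{t..T} \<times> A \<in> null_sets N"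
    using M.emeasure_pair_measure_Times[OF sets] A(2) sets by (intro null_setsI) auto
  then show ?thesis by (rule AE_I') (use A(1) in \<open>auto simp: space_N\<close>)
qed

lemma integral_LT_measurable:
  fixes f :: "real \<Rightarrow> 'w \<Rightarrow> real"
  assumes "(\<lambda>p. f (fst p) (snd p)) \<in> borel_measurable N"
  shows "(\<lambda>\<omega>. \<integral>r. f r \<omega> \<partial>LT) \<in> borel_measurable M"
proof -
  have "(\<lambda>(\<omega>, r). f r \<omega>) \<in> borel_measurable (M \<Otimes>\<^sub>M LT)"
    using measurable_compose[OF measurable_pair_swap' assms] by (simp add: case_prod_beta')
  then show ?thesis by (rule LT.borel_measurable_lebesgue_integral)
qed

lemma progressive_N:
  assumes "progressive F t T Y" shows "(\<lambda>p. Y (fst p) (snd p)) \<in> borel_measurable N"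
proof -
  have 1: "(\<lambda>(r, \<omega>). Y r \<omega>) \<in> borel_measurable (restrict_space borel {t..T} \<Otimes>\<^sub>M F T)"
    using assms t_less_T by (auto simp: progressive_def)
  have "fst \<in> measurable N (restrict_space borel {t..T})"
    using measurable_time_N by (intro measurable_restrict_space2) (auto simp: space_N)
  moreover have "snd \<in> measurable N (F T)"
    by (rule measurable_compose[OF measurable_snd]) (rule measurable_F_M[where s=T], simp)
  ultimately have "(\<lambda>p. (fst p, snd p)) \<in> measurable N (restrict_space borel {t..T} \<Otimes>\<^sub>M F T)"
    by (rule measurable_Pair)
  from measurable_compose[OF this 1] show ?thesis by simp
qed

lemma progressive_section:
  assumes "progressive F t T Y" "s \<in> {t..T}" shows "Y s \<in> borel_measurable (F s)"
proof -
  have 1: "(\<lambda>(r, \<omega>). Y r \<omega>) \<in> borel_measurable (restrict_space borel {t..s} \<Otimes>\<^sub>M F s)"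
    using assms by (auto simp: progressive_def)
  have "Pair s \<in> measurable (F s) (restrict_space borel {t..s} \<Otimes>\<^sub>M F s)"
    using assms by (intro measurable_Pair1') (auto simp: space_restrict_space)
  from measurable_compose[OF this 1] show ?thesis by simp
qed

text \<open>Fubini is applied over \<open>[t, b]\<close> only, where progressive measurability
  refers to \<open>F b\<close>; joint measurability up to \<open>T\<close> would lose the
  information that the integral is known at time \<open>b\<close>.\<close>

lemma progressive_integral:
  assumes g: "progressive F t T g" and ab: "t \<le> a" "a \<le> b" "b \<le> T"
  shows "(\<lambda>\<omega>. \<integral>r. indicator {a..b} r * g r \<omega> \<partial>LT) \<in> borel_measurable (F b)"
proof -
  let ?B = "restrict_space lborel {t..b}"
  interpret B: finite_measure ?B
    by (rule finite_measureI) (simp add: emeasure_restrict_space emeasure_lborel_Icc_eq)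
  have 1: "(\<lambda>(r, \<omega>). g r \<omega>) \<in> borel_measurable (restrict_space borel {t..b} \<Otimes>\<^sub>M F b)"
    using g ab by (auto simp: progressive_def)
  have "(\<lambda>p. (snd p, fst p)) \<in> measurable (F b \<Otimes>\<^sub>M ?B) (restrict_space borel {t..b} \<Otimes>\<^sub>M F b)"
    by (intro measurable_Pair measurable_fst measurable_compose[OF measurable_snd]
        measurable_restrict_space2 measurable_restrict_space1) (auto simp: space_restrict_space)
  from measurable_compose[OF this 1]
  have 2: "(\<lambda>p. g (snd p) (fst p)) \<in> borel_measurable (F b \<Otimes>\<^sub>M ?B)" by simp
  have "(\<lambda>r. indicator {a..b} r :: real) \<in> borel_measurable ?B"
    by (rule measurable_restrict_space1) simp
  then have "(\<lambda>p. indicator {a..b} (snd p) :: real) \<in> borel_measurable (F b \<Otimes>\<^sub>M ?B)"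
    by (rule measurable_compose[OF measurable_snd])
  with 2 have "(\<lambda>(\<omega>, r). indicator {a..b} r * g r \<omega>) \<in> borel_measurable (F b \<Otimes>\<^sub>M ?B)"
    by (simp add: case_prod_beta')
  then have "(\<lambda>\<omega>. \<integral>r. indicator {a..b} r * g r \<omega> \<partial>?B) \<in> borel_measurable (F b)"
    by (rule B.borel_measurable_lebesgue_integral)
  moreover have "(\<integral>r. indicator {a..b} r * g r \<omega> \<partial>?B) = (\<integral>r. indicator {a..b} r * g r \<omega> \<partial>LT)" for \<omega>
    using ab by (simp add: integral_restrict_space)
      (intro Bochner_Integration.integral_cong, auto simp: indicator_def)
  ultimately show ?thesis by simp
qed

lemma indicator_integrable:
  fixes f :: "real \<times> 'w \<Rightarrow> real"
  assumes f: "integrable N f" and A[measurable]: "A \<in> sets borel"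
  shows "integrable N (\<lambda>p. indicator A (fst p) * f p)"
  by (rule Bochner_Integration.integrable_bound[OF f]) (use f in \<open>auto simp: indicator_def\<close>)

lemma integral_indicator_le:
  fixes f :: "real \<times> 'w \<Rightarrow> real"
  assumes f: "integrable N f" "AE p in N. 0 \<le> f p" and A[measurable]: "A \<in> sets borel"
  shows "(\<integral>p. indicator A (fst p) * f p \<partial>N) \<le> (\<integral>p. f p \<partial>N)"
  by (rule integral_mono_AE[OF indicator_integrable[OF f(1) A] f(1)])
     (use f(2) in \<open>auto simp: indicator_def elim: eventually_mono\<close>)

end

section \<open>The energy inequality\<close>

text \<open>The driver is frozen as a process \<open>g\<close>, without reference to its dependence
  on \<open>Y\<close> and \<open>Z\<close>; this is what lets the difference of two solutions be an
  instance.\<close>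

locale linear_bsde = jump_process +
  fixes Y :: "real \<Rightarrow> 'a \<Rightarrow> real" and Z :: "real \<Rightarrow> 'a \<Rightarrow> 'b \<Rightarrow> real"
    and g :: "real \<Rightarrow> 'a \<Rightarrow> real" and \<eta> :: "'a \<Rightarrow> real"
  assumes Y_prog: "progressive F t T Y" and Y_L2: "integrable N (\<lambda>p. (Y (fst p) (snd p))\<^sup>2)"
    and Z_L2: "L2_field Z"
    and g_prog: "progressive F t T g" and g_L2: "integrable N (\<lambda>p. (g (fst p) (snd p))\<^sup>2)"
    and \<eta>_meas: "\<eta> \<in> borel_measurable M" and \<eta>_L2: "integrable M (\<lambda>\<omega>. (\<eta> \<omega>)\<^sup>2)"
    and equation: "\<And>s. s \<in> {t..T} \<Longrightarrow> AE \<omega> in M. Y s \<omega> = \<eta> \<omega> + (LINT r:{s..T}|lborel. g r \<omega>)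
                    - q_integral E X v t s T Z \<omega>"
begin

section \<open>Second moments of the terms of the equation\<close>

lemmas YN [measurable] = progressive_N[OF Y_prog]
lemmas gN [measurable] = progressive_N[OF g_prog]
lemmas Ys = progressive_section[OF Y_prog]
lemmas YsM = measurable_F_M[OF Ys]
lemmas gs = progressive_section[OF g_prog]

definition G :: "real \<Rightarrow> 'a \<Rightarrow> real" where
  "G s \<omega> = (\<integral>r. indicator {s..T} r * g r \<omega> \<partial>LT)"

text \<open>Defined through the other terms of the equation, hence measurable by construction; only
  almost surely is it the compensated integral of \<open>Z\<close>.\<close>

definition R :: "real \<Rightarrow> 'a \<Rightarrow> real" where
  "R s \<omega> = \<eta> \<omega> + G s \<omega> - Y s \<omega>"

definition gsq :: "'a \<Rightarrow> real" where
  "gsq \<omega> = (\<integral>r. (g r \<omega>)\<^sup>2 \<partial>LT)"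

lemma gsq_facts: "integrable M gsq" "AE \<omega> in M. integrable LT (\<lambda>r. (g r \<omega>)\<^sup>2)" "gsq \<omega> \<ge> 0"
  using Bochner_snd[OF g_L2] by (auto simp: gsq_def[abs_def])

lemma g_section: "\<omega> \<in> \<Omega> \<Longrightarrow> (\<lambda>r. g r \<omega>) \<in> borel_measurable LT"
  using measurable_compose[OF measurable_Pair2'[of \<omega> M LT] gN] by simp

lemma AE_good: "AE \<omega> in M. \<omega> \<in> \<Omega> \<and> integrable LT (\<lambda>r. (g r \<omega>)\<^sup>2) \<and> integrable LT (\<lambda>r. g r \<omega>)"
  using gsq_facts(2) AE_space
proof eventually_elim
  case (elim \<omega>)
  then show ?case using LT.integral_power2_le(1)[OF g_section, of \<omega>] by simp
qed

lemma G_bound: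
  assumes "\<omega> \<in> \<Omega>" "integrable LT (\<lambda>r. (g r \<omega>)\<^sup>2)" "s \<in> {t..T}"
  shows "(G s \<omega>)\<^sup>2 \<le> (T - t) * gsq \<omega>"
proof -
  have A: "{s..T} \<in> sets LT" using assms by (intro LT_sets) auto
  have "(G s \<omega>)\<^sup>2 \<le> measure LT {s..T} * (\<integral>r. indicator {s..T} r * (g r \<omega>)\<^sup>2 \<partial>LT)"
    unfolding G_def using assms A by (intro LT.integral_indicator_power2_le g_section)
  also have "\<dots> \<le> (T - t) * gsq \<omega>"
  proof (rule mult_mono)
    show "measure LT {s..T} \<le> T - t"
      using assms(3) by (simp add: measure_restrict_space Int_absorb2)
    show "(\<integral>r. indicator {s..T} r * (g r \<omega>)\<^sup>2 \<partial>LT) \<le> gsq \<omega>"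
      unfolding gsq_def using assms(2) A
      by (intro integral_mono integrable_mult_indicator[where 'b=real, simplified]) (auto simp: indicator_def)
  qed (use assms t_less_T in \<open>auto intro!: integral_nonneg_AE\<close>)
  finally show ?thesis .
qed

lemma G_meas: "s \<in> {t..T} \<Longrightarrow> G s \<in> borel_measurable M"
  unfolding G_def[abs_def] by (rule integral_LT_measurable) measurable

lemma G_L2:
  assumes s: "s \<in> {t..T}" shows "integrable M (\<lambda>\<omega>. (G s \<omega>)\<^sup>2)"
proof (rule Bochner_Integration.integrable_bound)
  show "integrable M (\<lambda>\<omega>. (T - t) * gsq \<omega>)" using gsq_facts(1) by simp
  show "AE \<omega> in M. norm ((G s \<omega>)\<^sup>2) \<le> norm ((T - t) * gsq \<omega>)"
    using AE_good
  proof eventually_elim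
    case (elim \<omega>)
    then show ?case using G_bound[of \<omega> s] s t_less_T gsq_facts(3)[of \<omega>] by simp
  qed
qed (use G_meas[OF s] in auto)

lemma R_meas: "s \<in> {t..T} \<Longrightarrow> R s \<in> borel_measurable M"
  unfolding R_def[abs_def] using \<eta>_meas G_meas YsM by (intro borel_measurable_diff borel_measurable_add)

lemma R_eq:
  assumes s: "s \<in> {t..T}"
  shows "AE \<omega> in M. R s \<omega> = jump_sum Z s \<omega> - comp_int Z s \<omega>"
  using equation[OF s] AE_space
proof eventually_elim
  case (elim \<omega>)
  have "G s \<omega> = (LINT r:{s..T}|lborel. g r \<omega>)"
    unfolding G_def using s by (intro integral_LT) auto
  moreover have "q_integral E X v t s T Z \<omega> = jump_sum Z s \<omega> - comp_int Z s \<omega>"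
    using q_integral_eq[OF L2_fieldD(1)[OF Z_L2] _ s] elim by simp
  ultimately show ?case using elim by (simp add: R_def)
qed

lemma comp_int_meas: "s \<in> {t..T} \<Longrightarrow> comp_int Z s \<in> borel_measurable M"
proof -
  note [measurable] = rate_int_L2(1)[OF Z_L2]
  show ?thesis unfolding comp_int_def[abs_def] by (rule integral_LT_measurable) measurable
qed

text \<open>The measurability required for the compensator formula is taken from the equation:
  almost surely the jump sum is \<open>R s + comp_int Z s\<close>, which is measurable, and
  \<open>M\<close> is complete.\<close>

lemma jump_sum_meas:
  assumes s: "s \<in> {t..T}" shows "jump_sum Z s \<in> borel_measurable M"
proof (rule M.borel_measurable_AE_cong)
  show "(\<lambda>\<omega>. R s \<omega> + comp_int Z s \<omega>) \<in> borel_measurable M"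
    using R_meas[OF s] comp_int_meas[OF s] by simp
  show "AE \<omega> in M. R s \<omega> + comp_int Z s \<omega> = jump_sum Z s \<omega>"
    using R_eq[OF s] by eventually_elim simp
qed

lemma orthogonal:
  assumes s: "s \<in> {t..T}" and H: "H \<in> borel_measurable (F s)" and H2: "integrable M (\<lambda>\<omega>. (H \<omega>)\<^sup>2)"
  shows "integrable M (\<lambda>\<omega>. H \<omega> * R s \<omega>)" "(\<integral>\<omega>. H \<omega> * R s \<omega> \<partial>M) = 0"
proof -
  note O = compensated_orthogonal[OF Z_L2 jump_sum_meas s H H2]
  note [measurable] = R_meas[OF s] measurable_F_M[OF H] jump_sum_meas[OF s] comp_int_meas[OF s]
  have ae: "AE \<omega> in M. H \<omega> * (jump_sum Z s \<omega> - comp_int Z s \<omega>) = H \<omega> * R s \<omega>"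
    using R_eq[OF s] by eventually_elim simp
  show "integrable M (\<lambda>\<omega>. H \<omega> * R s \<omega>)"
    by (rule integrable_cong_AE_imp[OF O(1)]) (use ae in \<open>auto elim: eventually_mono\<close>)
  have "(\<integral>\<omega>. H \<omega> * R s \<omega> \<partial>M) = (\<integral>\<omega>. H \<omega> * (jump_sum Z s \<omega> - comp_int Z s \<omega>) \<partial>M)"
    by (rule integral_cong_AE) (use ae in \<open>auto elim: eventually_mono\<close>)
  then show "(\<integral>\<omega>. H \<omega> * R s \<omega> \<partial>M) = 0" using O(2) by simp
qed

text \<open>\<open>Y s\<close> is a conditional expectation of \<open>\<eta> + G s\<close>; testing with its truncations bounds it in \<open>L\<^sup>2\<close>.\<close>

lemma Ys_L2:
  assumes s: "s \<in> {t..T}" shows "integrable M (\<lambda>\<omega>. (Y s \<omega>)\<^sup>2)"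
proof -
  \<comment> \<open>Square integrability over \<open>N\<close> says nothing about a given time
    \<open>s\<close>; the truncations of \<open>Y s\<close> are bounded and hence admissible as test
    variables.\<close>
  define H where "H k \<omega> = max (- real k) (min (real k) (Y s \<omega>))" for k :: nat and \<omega>
  note [measurable] = YsM[OF s] \<eta>_meas G_meas[OF s] R_meas[OF s]
  have Hm: "H k \<in> borel_measurable (F s)" for k
    unfolding H_def[abs_def] using Ys[OF s] by measurable
  note HM[measurable] = measurable_F_M[OF Hm]
  have Hb: "\<bar>H k \<omega>\<bar> \<le> real k" for k \<omega> by (auto simp: H_def)
  have H2: "integrable M (\<lambda>\<omega>. (H k \<omega>)\<^sup>2)" for k
    by (rule M.integrable_const_bound[of _ "(real k)\<^sup>2"]) (use Hb in \<open>auto simp: abs_le_square_iff[symmetric]\<close>)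
  have eG: "integrable M (\<lambda>\<omega>. (\<eta> \<omega> + G s \<omega>)\<^sup>2)" by (rule integrable_square_sum(2)) (use \<eta>_L2 G_L2[OF s] in auto)
  let ?C = "\<integral>\<omega>. (\<eta> \<omega> + G s \<omega>)\<^sup>2 \<partial>M"
  have bound: "(\<integral>\<omega>. (H k \<omega>)\<^sup>2 \<partial>M) \<le> ?C" for k
  proof -
    have i: "integrable M (\<lambda>\<omega>. H k \<omega> * (\<eta> \<omega> + G s \<omega>))" by (rule integrable_square_sum(1)) (use H2 eG in auto)
    have "(\<integral>\<omega>. (H k \<omega>)\<^sup>2 \<partial>M) \<le> (\<integral>\<omega>. H k \<omega> * (\<eta> \<omega> + G s \<omega>) - H k \<omega> * R s \<omega> \<partial>M)"
    proof (rule integral_mono)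
      fix \<omega>
      have "(H k \<omega>)\<^sup>2 \<le> H k \<omega> * Y s \<omega>"
        using mult_left_mono[of "real k" "Y s \<omega>" "real k"] mult_left_mono[of "real k" "- Y s \<omega>" "real k"]
        by (auto simp: H_def power2_eq_square max_def min_def)
      then show "(H k \<omega>)\<^sup>2 \<le> H k \<omega> * (\<eta> \<omega> + G s \<omega>) - H k \<omega> * R s \<omega>"
        by (simp add: R_def algebra_simps)
    qed (use H2 i orthogonal[OF s Hm H2] in auto)
    also have "\<dots> = (\<integral>\<omega>. H k \<omega> * (\<eta> \<omega> + G s \<omega>) \<partial>M)" using i orthogonal[OF s Hm H2] by simp
    \<comment> \<open>Half of the second moment of \<open>H k\<close> reappears on the right. It is
      finite because \<open>H k\<close> is bounded, so it can be absorbed, and the resulting bound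
      does not depend on \<open>k\<close>.\<close>
    also have "\<dots> \<le> (\<integral>\<omega>. ((H k \<omega>)\<^sup>2 + (\<eta> \<omega> + G s \<omega>)\<^sup>2) / 2 \<partial>M)"
    proof (rule integral_mono)
      fix \<omega> show "H k \<omega> * (\<eta> \<omega> + G s \<omega>) \<le> ((H k \<omega>)\<^sup>2 + (\<eta> \<omega> + G s \<omega>)\<^sup>2) / 2"
        using sum_squares_bound[of "H k \<omega>" "\<eta> \<omega> + G s \<omega>"] by simp
    qed (use i H2 eG in auto)
    also have "\<dots> = ((\<integral>\<omega>. (H k \<omega>)\<^sup>2 \<partial>M) + ?C) / 2" using H2 eG by simp
    finally show ?thesis by simp
  qed
  have lim: "(\<lambda>k. ennreal ((H k \<omega>)\<^sup>2)) \<longlonglongrightarrow> ennreal ((Y s \<omega>)\<^sup>2)" for \<omega>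
  proof (rule tendsto_eventually)
    obtain k0 :: nat where k0: "\<bar>Y s \<omega>\<bar> \<le> real k0" using real_arch_simple by blast
    then have "H k \<omega> = Y s \<omega>" if "k0 \<le> k" for k
      using that by (auto simp: H_def max_def min_def)
    then show "\<forall>\<^sub>F k in sequentially. ennreal ((H k \<omega>)\<^sup>2) = ennreal ((Y s \<omega>)\<^sup>2)"
      unfolding eventually_sequentially by (intro exI[of _ k0]) auto
  qed
  have "(\<integral>\<^sup>+\<omega>. ennreal ((Y s \<omega>)\<^sup>2) \<partial>M) = (\<integral>\<^sup>+\<omega>. liminf (\<lambda>k. ennreal ((H k \<omega>)\<^sup>2)) \<partial>M)"
    by (intro nn_integral_cong lim_imp_Liminf[symmetric] lim) simp
  also have "\<dots> \<le> liminf (\<lambda>k. \<integral>\<^sup>+\<omega>. ennreal ((H k \<omega>)\<^sup>2) \<partial>M)"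
    by (rule nn_integral_liminf) measurable
  also have "\<dots> \<le> liminf (\<lambda>k::nat. ennreal ?C)"
    by (intro Liminf_mono always_eventually allI) (simp add: nn_integral_eq_integral H2 ennreal_leI bound)
  also have "\<dots> < \<infinity>" by (simp add: Liminf_const)
  finally show ?thesis by (intro integrableI_nonneg) auto
qed

lemma R_L2: "s \<in> {t..T} \<Longrightarrow> integrable M (\<lambda>\<omega>. (R s \<omega>)\<^sup>2)"
  unfolding R_def[abs_def]
  by (intro integrable_square_sum \<eta>_L2 G_L2 Ys_L2 borel_measurable_add \<eta>_meas G_meas YsM)

section \<open>Orthogonal increments of the compensated integral\<close>

lemma pythagoras:
  assumes s: "s \<in> {t..T}"
  shows "(\<integral>\<omega>. (\<eta> \<omega> + G s \<omega>)\<^sup>2 \<partial>M) = (\<integral>\<omega>. (Y s \<omega>)\<^sup>2 \<partial>M) + (\<integral>\<omega>. (R s \<omega>)\<^sup>2 \<partial>M)"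
proof -
  note O = orthogonal[OF s Ys[OF s] Ys_L2[OF s]]
  have "(\<integral>\<omega>. (\<eta> \<omega> + G s \<omega>)\<^sup>2 \<partial>M) = (\<integral>\<omega>. (Y s \<omega>)\<^sup>2 + (R s \<omega>)\<^sup>2 + 2 * (Y s \<omega> * R s \<omega>) \<partial>M)"
    by (intro Bochner_Integration.integral_cong) (auto simp: R_def power2_eq_square algebra_simps)
  then show ?thesis using O Ys_L2[OF s] R_L2[OF s] by simp
qed

text \<open>Separately, \<open>R a\<close> and \<open>R b\<close> involve the terminal value and the
  driver after \<open>b\<close>. Both cancel in the difference, which leaves a version that is
  measurable for \<open>F b\<close>.\<close>

lemma increment:
  assumes ab: "t \<le> a" "a \<le> b" "b \<le> T"
  defines "D \<equiv> \<lambda>\<omega>. Y b \<omega> - Y a \<omega> + (\<integral>r. indicator {a..b} r * g r \<omega> \<partial>LT)"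
  shows "D \<in> borel_measurable (F b)" "AE \<omega> in M. D \<omega> = R a \<omega> - R b \<omega>"
proof -
  show "D \<in> borel_measurable (F b)"
    unfolding D_def using ab by (intro borel_measurable_add borel_measurable_diff progressive_integral g_prog
        Ys measurable_F_mono[OF Ys, of a b]) auto
  show "AE \<omega> in M. D \<omega> = R a \<omega> - R b \<omega>"
    using AE_good
  proof eventually_elim
    case (elim \<omega>)
    have i: "integrable LT (\<lambda>r. indicator {c..T} r * g r \<omega>)" if "c \<in> {t..T}" for c
      using elim that by (intro integrable_mult_indicator[where 'b=real, simplified] LT_sets) auto
    have "G a \<omega> - G b \<omega> = (\<integral>r. indicator {a..T} r * g r \<omega> - indicator {b..T} r * g r \<omega> \<partial>LT)"
      unfolding G_def using i[of a] i[of b] ab by simp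
    also have "\<dots> = (\<integral>r. indicator {a..<b} r * g r \<omega> \<partial>LT)"
      using ab by (intro Bochner_Integration.integral_cong) (auto simp: indicator_def)
    also have "\<dots> = (LINT r:{a..<b}|lborel. g r \<omega>)"
      using ab by (intro integral_LT) auto
    also have "\<dots> = (LINT r:{a..b}|lborel. g r \<omega>)"
      unfolding set_lebesgue_integral_def
      by (rule integral_discrete_difference[where X="{b}"]) (auto simp: indicator_def)
    also have "\<dots> = (\<integral>r. indicator {a..b} r * g r \<omega> \<partial>LT)"
      using ab by (intro integral_LT[symmetric]) auto
    finally show ?case by (simp add: D_def R_def)
  qed
qed

text \<open>Pythagoras for \<open>R a = (R a - R b) + R b\<close>: the first summand has a version
  measurable for \<open>F b\<close>, so it is orthogonal to \<open>R b\<close>.\<close>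

lemma R_increment:
  assumes ab: "t \<le> a" "a \<le> b" "b \<le> T"
  shows "(\<integral>\<omega>. (R a \<omega>)\<^sup>2 \<partial>M) = (\<integral>\<omega>. (R a \<omega> - R b \<omega>)\<^sup>2 \<partial>M) + (\<integral>\<omega>. (R b \<omega>)\<^sup>2 \<partial>M)"
    "integrable M (\<lambda>\<omega>. (R a \<omega> - R b \<omega>)\<^sup>2)"
proof -
  define D where "D \<omega> = Y b \<omega> - Y a \<omega> + (\<integral>r. indicator {a..b} r * g r \<omega> \<partial>LT)" for \<omega>
  have D: "D \<in> borel_measurable (F b)" "AE \<omega> in M. D \<omega> = R a \<omega> - R b \<omega>"
    using increment[OF ab] by (simp_all add: D_def[abs_def])
  note [measurable] = R_meas[of a] R_meas[of b] measurable_F_M[OF D(1)]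
  have "a \<in> {t..T}" and b: "b \<in> {t..T}" using ab by auto
  then show i: "integrable M (\<lambda>\<omega>. (R a \<omega> - R b \<omega>)\<^sup>2)" by (intro integrable_square_sum R_L2 R_meas)
  have D2: "integrable M (\<lambda>\<omega>. (D \<omega>)\<^sup>2)"
    by (rule integrable_cong_AE_imp[OF i]) (use D(2) ab in \<open>auto elim: eventually_mono\<close>)
  note O = orthogonal[OF b D(1) D2]
  have ae: "AE \<omega> in M. (R a \<omega>)\<^sup>2 = (R a \<omega> - R b \<omega>)\<^sup>2 + (R b \<omega>)\<^sup>2 + 2 * (D \<omega> * R b \<omega>)"
    using D(2)
  proof eventually_elim
    case (elim \<omega>)
    then have "R a \<omega> = D \<omega> + R b \<omega>" by simp
    then show ?case by (simp add: power2_eq_square algebra_simps)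
  qed
  have "(\<integral>\<omega>. (R a \<omega>)\<^sup>2 \<partial>M) = (\<integral>\<omega>. (R a \<omega> - R b \<omega>)\<^sup>2 + (R b \<omega>)\<^sup>2 + 2 * (D \<omega> * R b \<omega>) \<partial>M)"
    by (rule integral_cong_AE[OF _ _ ae]) (use ab in auto)
  then show "(\<integral>\<omega>. (R a \<omega>)\<^sup>2 \<partial>M) = (\<integral>\<omega>. (R a \<omega> - R b \<omega>)\<^sup>2 \<partial>M) + (\<integral>\<omega>. (R b \<omega>)\<^sup>2 \<partial>M)"
    using O i R_L2[OF b] by simp
qed

lemma R_T: "AE \<omega> in M. R T \<omega> = 0"
proof -
  have "T \<in> {t..T}" using t_less_T by simp
  from R_eq[OF this] show ?thesis by eventually_elim (simp add: jump_sum_def comp_int_def)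
qed

text \<open>Orthogonality of increments makes this an exact identity for every mesh; the last term
  drops out because \<open>R T\<close> vanishes almost surely.\<close>

lemma R_telescope:
  assumes s: "s \<in> {t..T}" and n: "n > 0"
  shows "(\<integral>\<omega>. (R s \<omega>)\<^sup>2 \<partial>M) = (\<Sum>i<n. \<integral>\<omega>. (R (grid s T n i) \<omega> - R (grid s T n (Suc i)) \<omega>)\<^sup>2 \<partial>M)"
proof -
  have g: "t \<le> grid s T n i" "grid s T n i \<le> grid s T n (Suc i)" "grid s T n (Suc i) \<le> T" if "i < n" for i
    using grid_mem[of s T i n] grid_mem[of s T "Suc i" n] grid_mono[of s T i "Suc i" n] s that by auto
  have "k \<le> n \<Longrightarrow> (\<integral>\<omega>. (R s \<omega>)\<^sup>2 \<partial>M) = (\<Sum>i<k. \<integral>\<omega>. (R (grid s T n i) \<omega> - R (grid s T n (Suc i)) \<omega>)\<^sup>2 \<partial>M)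
      + (\<integral>\<omega>. (R (grid s T n k) \<omega>)\<^sup>2 \<partial>M)" for k
  proof (induction k)
    case (Suc k)
    then show ?case using R_increment(1)[OF g[of k]] by simp
  qed simp
  from this[of n] have "(\<integral>\<omega>. (R s \<omega>)\<^sup>2 \<partial>M) =
    (\<Sum>i<n. \<integral>\<omega>. (R (grid s T n i) \<omega> - R (grid s T n (Suc i)) \<omega>)\<^sup>2 \<partial>M) + (\<integral>\<omega>. (R T \<omega>)\<^sup>2 \<partial>M)"
    using n by simp
  moreover have "(\<integral>\<omega>. (R T \<omega>)\<^sup>2 \<partial>M) = 0"
    using R_T by (intro integral_eq_zero_AE) (auto elim: eventually_mono)
  ultimately show ?thesis by simp
qed

section \<open>One half of the isometry\<close>

definition asq :: "'a \<Rightarrow> real" where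
  "asq \<omega> = (\<integral>r. (rate_int Z r \<omega>)\<^sup>2 \<partial>LT)"

lemma asq_facts: "integrable M asq" "AE \<omega> in M. integrable LT (\<lambda>r. (rate_int Z r \<omega>)\<^sup>2)"
  using Bochner_snd[OF rate_int_L2(2)[OF Z_L2]] by (auto simp: asq_def[abs_def])

text \<open>By Cauchy-Schwarz each squared increment is at most the cell length times the share of
  \<open>asq\<close> in that cell. The sum is thus of order \<open>1 / n\<close>: the compensator
  has no quadratic variation.\<close>

lemma comp_increments:
  assumes \<omega>: "\<omega> \<in> \<Omega>" and i: "integrable LT (\<lambda>r. (rate_int Z r \<omega>)\<^sup>2)" and s: "s \<in> {t..T}" and n: "n > 0"
  shows "(\<Sum>i<n. (comp_int Z (grid s T n i) \<omega> - comp_int Z (grid s T n (Suc i)) \<omega>)\<^sup>2) \<le> (T - s) / real n * asq \<omega>"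
proof -
  have m: "(\<lambda>r. rate_int Z r \<omega>) \<in> borel_measurable LT"
    using measurable_compose[OF measurable_Pair2'[of \<omega> M LT] rate_int_L2(1)[OF Z_L2]] \<omega> by simp
  have i1: "integrable LT (\<lambda>r. rate_int Z r \<omega>)" by (rule LT.integral_power2_le(1)[OF m i])
  have g: "t \<le> grid s T n i" "grid s T n i \<le> grid s T n (Suc i)" "grid s T n (Suc i) \<le> T" if "i < n" for i
    using grid_mem[of s T i n] grid_mem[of s T "Suc i" n] grid_mono[of s T i "Suc i" n] s that by auto
  let ?C = "\<lambda>i. {grid s T n i<..grid s T n (Suc i)}"
  have C: "?C i \<in> sets LT" if "i < n" for i using g[OF that] by (intro LT_sets) auto
  have ii: "integrable LT (\<lambda>r. indicator A r * f r)" if "integrable LT f" "A \<in> sets LT" for A and f :: "real \<Rightarrow> real"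
    using that by (intro integrable_mult_indicator[where 'b=real, simplified])
  have cell: "(comp_int Z (grid s T n i) \<omega> - comp_int Z (grid s T n (Suc i)) \<omega>)\<^sup>2
    \<le> (T - s) / real n * (\<integral>r. indicator (?C i) r * (rate_int Z r \<omega>)\<^sup>2 \<partial>LT)" if i_n: "i < n" for i
  proof -
    have "comp_int Z (grid s T n i) \<omega> - comp_int Z (grid s T n (Suc i)) \<omega>
      = (\<integral>r. indicator {grid s T n i<..T} r * rate_int Z r \<omega> - indicator {grid s T n (Suc i)<..T} r * rate_int Z r \<omega> \<partial>LT)"
      unfolding comp_int_def using g[OF i_n]
      by (subst Bochner_Integration.integral_diff) (auto intro!: ii i1 LT_sets)
    also have "\<dots> = (\<integral>r. indicator (?C i) r * rate_int Z r \<omega> \<partial>LT)"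
      using g[OF i_n] by (intro Bochner_Integration.integral_cong) (auto simp: indicator_def)
    finally have "(comp_int Z (grid s T n i) \<omega> - comp_int Z (grid s T n (Suc i)) \<omega>)\<^sup>2
      \<le> measure LT (?C i) * (\<integral>r. indicator (?C i) r * (rate_int Z r \<omega>)\<^sup>2 \<partial>LT)"
      using LT.integral_indicator_power2_le[OF m i C[OF i_n]] by simp
    also have "measure LT (?C i) = (T - s) / real n"
    proof -
      have "measure LT (?C i) = measure lborel (?C i)"
        using g[OF i_n] by (intro measure_restrict_space) auto
      then show ?thesis using g[OF i_n] grid_Suc[of s T n i] by simp
    qed
    finally show ?thesis .
  qed
  have "(\<Sum>i<n. \<integral>r. indicator (?C i) r * (rate_int Z r \<omega>)\<^sup>2 \<partial>LT)
    = (\<integral>r. (\<Sum>i<n. indicator (?C i) r * (rate_int Z r \<omega>)\<^sup>2) \<partial>LT)"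
    by (rule Bochner_Integration.integral_sum[symmetric]) (intro ii i C, simp)
  also have "\<dots> \<le> asq \<omega>"
    unfolding asq_def
  proof (rule integral_mono)
    show "integrable LT (\<lambda>r. \<Sum>i<n. indicator (?C i) r * (rate_int Z r \<omega>)\<^sup>2)"
      by (intro Bochner_Integration.integrable_sum ii i C) simp
    fix r
    \<comment> \<open>At most one cell contains \<open>r\<close>; the sum is put into the form of
      \<open>sum_over_cells\<close> with the singleton \<open>{r}\<close>.\<close>
    have "(\<Sum>i<n. indicator (?C i) r * (rate_int Z r \<omega>)\<^sup>2) = (\<Sum>i<n. \<Sum>u\<in>{r} \<inter> ?C i. (rate_int Z u \<omega>)\<^sup>2)"
      by (intro sum.cong) (auto simp: indicator_def)
    also have "\<dots> = (\<Sum>u\<in>{r} \<inter> {grid s T n 0<..grid s T n n}. (rate_int Z u \<omega>)\<^sup>2)"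
      using s by (intro sum_over_cells grid_mono) auto
    also have "\<dots> \<le> (rate_int Z r \<omega>)\<^sup>2" by (cases "r \<in> {grid s T n 0<..grid s T n n}") auto
    finally show "(\<Sum>i<n. indicator (?C i) r * (rate_int Z r \<omega>)\<^sup>2) \<le> (rate_int Z r \<omega>)\<^sup>2" .
  qed (rule i)
  finally have le: "(\<Sum>i<n. \<integral>r. indicator (?C i) r * (rate_int Z r \<omega>)\<^sup>2 \<partial>LT) \<le> asq \<omega>" .
  have "(\<Sum>i<n. (comp_int Z (grid s T n i) \<omega> - comp_int Z (grid s T n (Suc i)) \<omega>)\<^sup>2)
    \<le> (\<Sum>i<n. (T - s) / real n * (\<integral>r. indicator (?C i) r * (rate_int Z r \<omega>)\<^sup>2 \<partial>LT))"
    by (intro sum_mono cell) simp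
  also have "\<dots> = (T - s) / real n * (\<Sum>i<n. \<integral>r. indicator (?C i) r * (rate_int Z r \<omega>)\<^sup>2 \<partial>LT)"
    by (simp add: sum_distrib_left)
  also have "\<dots> \<le> (T - s) / real n * asq \<omega>"
    using s le by (intro mult_left_mono) auto
  finally show ?thesis .
qed

lemma jump_sum_sq_nn:
  assumes s: "s \<in> {t..T}"
  shows "(\<integral>\<^sup>+\<omega>. ennreal (jump_sum (\<lambda>r \<omega> y. (Z r \<omega> y)\<^sup>2) s \<omega>) \<partial>M)
    = (\<integral>\<^sup>+p. indicator {s<..T} (fst p) * nsq Z (fst p) (snd p) \<partial>N)"
proof -
  define K where "K r \<omega> y = ennreal (indicator {s<..T} r * (Z r \<omega> y)\<^sup>2)" for r \<omega> y
  have "predictable_field E F t T K"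
  proof -
    have "(\<lambda>q. Z (fst (fst q)) (snd (fst q)) (snd q)) \<in> borel_measurable (predictable_sigma F t T \<Otimes>\<^sub>M E)"
      using Z_L2 by (simp add: L2_field_def predictable_field_def case_prod_beta')
    \<comment> \<open>The factor 1 plays the adapted variable \<open>H\<close> of
      \<open>indicator_adapted_predictable\<close>.\<close>
    moreover have "(\<lambda>q. indicator {s<..T} (fst (fst q)) * 1 :: real) \<in> borel_measurable (predictable_sigma F t T \<Otimes>\<^sub>M E)"
      by (rule measurable_compose[OF measurable_fst indicator_adapted_predictable[OF _ s]]) simp
    ultimately show ?thesis unfolding predictable_field_def K_def by (simp add: case_prod_beta')
  qed
  note c = compensator[OF this]
  have "(\<integral>\<^sup>+\<omega>. ennreal (jump_sum (\<lambda>r \<omega> y. (Z r \<omega> y)\<^sup>2) s \<omega>) \<partial>M)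
    = (\<integral>\<^sup>+\<omega>. (\<Sum>r\<in>jump_times X t \<omega> \<inter> {t<..T}. K r \<omega> (X r \<omega>)) \<partial>M)"
  proof (rule nn_integral_cong)
    fix \<omega> assume "\<omega> \<in> space M"
    then have f: "finite (jump_times X t \<omega> \<inter> {t<..T})" by (intro finite_jumps) simp
    have "ennreal (jump_sum (\<lambda>r \<omega> y. (Z r \<omega> y)\<^sup>2) s \<omega>) = (\<Sum>r\<in>jump_times X t \<omega> \<inter> {s<..T}. K r \<omega> (X r \<omega>))"
      unfolding jump_sum_def by (subst sum_ennreal[symmetric]) (auto simp: K_def)
    also have "\<dots> = (\<Sum>r\<in>jump_times X t \<omega> \<inter> {t<..T}. K r \<omega> (X r \<omega>))"
      using s by (intro sum.mono_neutral_left f) (auto simp: K_def split: split_indicator_asm)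
    finally show "ennreal (jump_sum (\<lambda>r \<omega> y. (Z r \<omega> y)\<^sup>2) s \<omega>) = \<dots>" .
  qed
  also have "\<dots> = (\<integral>\<^sup>+p. indicator {s<..T} (fst p) * nsq Z (fst p) (snd p) \<partial>N)"
    unfolding c
  proof (rule nn_integral_cong)
    fix p assume "p \<in> space N"
    then have p: "fst p \<in> {t..T}" "snd p \<in> \<Omega>" by (auto simp: space_N)
    show "(case p of (r, \<omega>) \<Rightarrow> \<integral>\<^sup>+y. K r \<omega> y \<partial>v r (X r \<omega>)) = indicator {s<..T} (fst p) * nsq Z (fst p) (snd p)"
      using field_v_measurable[OF L2_fieldD(1)[OF Z_L2] p]
      by (cases "fst p \<in> {s<..T}") (auto simp: K_def nsq_def case_prod_beta')
  qed
  finally show ?thesis .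
qed

text \<open>
  The squared increments of the jump sums converge pathwise to the sum of the squared jumps. Passing to
  the limit by Fatou's lemma yields only one half of the isometry, but that half suffices and needs no
  integrability of the number of jumps.
\<close>

lemma isometry_le:
  assumes s: "s \<in> {t..T}"
  shows "(\<integral>\<^sup>+p. indicator {s<..T} (fst p) * nsq Z (fst p) (snd p) \<partial>N) \<le> ennreal (\<integral>\<omega>. (R s \<omega>)\<^sup>2 \<partial>M)"
proof -
  let ?A = "\<integral>\<omega>. (R s \<omega>)\<^sup>2 \<partial>M" and ?C = "(T - s) * (\<integral>\<omega>. asq \<omega> \<partial>M)"
  \<comment> \<open>Increments of the jump sum, of \<open>R\<close> and of the compensator. Since
    \<open>R\<close> is jump sum minus compensator, \<open>p = d + c\<close> almost surely,
    simultaneously for all grids.\<close>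
  define p where "p n i \<omega> = jump_sum Z (grid s T n i) \<omega> - jump_sum Z (grid s T n (Suc i)) \<omega>" for n i \<omega>
  define d where "d n i \<omega> = R (grid s T n i) \<omega> - R (grid s T n (Suc i)) \<omega>" for n i \<omega>
  define c where "c n i \<omega> = comp_int Z (grid s T n i) \<omega> - comp_int Z (grid s T n (Suc i)) \<omega>" for n i \<omega>
  have gm: "grid s T n i \<in> {t..T}" if "i \<le> n" for n i
    using grid_mem[of s T i n] s that by auto
  have pm: "p n i \<in> borel_measurable M" if "i < n" for n i
    unfolding p_def[abs_def] using that by (intro borel_measurable_diff jump_sum_meas gm) auto
  have di: "integrable M (\<lambda>\<omega>. (d n i \<omega>)\<^sup>2)" if "i < n" for n i
    unfolding d_def using that gm[of i n] gm[of "Suc i" n] grid_mono[of s T i "Suc i" n] s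
    by (intro R_increment) auto
  have ae: "AE \<omega> in M. \<forall>n. \<forall>i<n. p n i \<omega> = d n i \<omega> + c n i \<omega>"
  proof -
    have "AE \<omega> in M. i < n \<longrightarrow> p n i \<omega> = d n i \<omega> + c n i \<omega>" for n i
    proof (cases "i < n")
      case True
      then show ?thesis
        using R_eq[OF gm[of i n]] R_eq[OF gm[of "Suc i" n]]
        by (auto simp: p_def d_def c_def elim: eventually_elim2)
    qed simp
    then show ?thesis by (simp add: AE_all_countable)
  qed
  have bound: "(\<integral>\<^sup>+\<omega>. ennreal (\<Sum>i<n. (p n i \<omega>)\<^sup>2) \<partial>M) \<le> ennreal ((1 + 1 / sqrt n) * ?A + (1 + sqrt n) * (?C / real n))"
    if n: "n > 0" for n :: nat
  proof -
    \<comment> \<open>This weight in Young's inequality lets both errors vanish: the coefficient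
      \<open>1 + 1 / sqrt n\<close> of the \<open>d\<close> part tends to 1, while
      \<open>1 + sqrt n\<close> times the order \<open>1 / n\<close> of the \<open>c\<close> part
      tends to 0.\<close>
    let ?e = "1 / sqrt (real n)"
    have e: "?e > 0" "1 / ?e = sqrt n" using n by auto
    let ?h = "\<lambda>\<omega>. (1 + ?e) * (\<Sum>i<n. (d n i \<omega>)\<^sup>2) + (1 + sqrt n) * ((T - s) / real n * asq \<omega>)"
    have hi: "integrable M ?h"
      using di asq_facts(1) by (intro Bochner_Integration.integrable_add integrable_mult_right Bochner_Integration.integrable_sum) auto
    have "AE \<omega> in M. (\<Sum>i<n. (p n i \<omega>)\<^sup>2) \<le> ?h \<omega>"
      using ae asq_facts(2) AE_space
    proof eventually_elim
      case (elim \<omega>)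
      have young: "(a + b)\<^sup>2 \<le> (1 + ?e) * a\<^sup>2 + (1 + sqrt n) * b\<^sup>2" for a b :: real
      proof -
        have "0 \<le> ?e * (a - sqrt n * b)\<^sup>2" using e by simp
        also have "\<dots> = ?e * a\<^sup>2 - 2 * a * b + sqrt n * b\<^sup>2"
          using n by (simp add: power2_diff field_simps power2_eq_square)
        finally show ?thesis by (simp add: power2_sum algebra_simps)
      qed
      have "(\<Sum>i<n. (p n i \<omega>)\<^sup>2) \<le> (\<Sum>i<n. (1 + ?e) * (d n i \<omega>)\<^sup>2 + (1 + sqrt n) * (c n i \<omega>)\<^sup>2)"
        using elim(1) young by (intro sum_mono) auto
      also have "\<dots> = (1 + ?e) * (\<Sum>i<n. (d n i \<omega>)\<^sup>2) + (1 + sqrt n) * (\<Sum>i<n. (c n i \<omega>)\<^sup>2)"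
        by (simp only: sum.distrib sum_distrib_left)
      also have "\<dots> \<le> ?h \<omega>"
        using comp_increments[OF _ elim(2) s n] elim(3)
        by (intro add_left_mono mult_left_mono) (auto simp: c_def)
      finally show ?case .
    qed
    then have "(\<integral>\<^sup>+\<omega>. ennreal (\<Sum>i<n. (p n i \<omega>)\<^sup>2) \<partial>M) \<le> (\<integral>\<^sup>+\<omega>. ennreal (?h \<omega>) \<partial>M)"
      by (intro nn_integral_mono_AE) (auto elim!: eventually_mono intro: ennreal_leI)
    also have "\<dots> = ennreal (\<integral>\<omega>. ?h \<omega> \<partial>M)"
    proof (rule nn_integral_eq_integral[OF hi])
      have "0 \<le> asq \<omega>" for \<omega> by (simp add: asq_def)
      then show "AE \<omega> in M. 0 \<le> ?h \<omega>" using s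
        by (intro AE_I2 add_nonneg_nonneg mult_nonneg_nonneg sum_nonneg) auto
    qed
    also have "(\<integral>\<omega>. ?h \<omega> \<partial>M) = (1 + ?e) * (\<Sum>i<n. \<integral>\<omega>. (d n i \<omega>)\<^sup>2 \<partial>M) + (1 + sqrt n) * ((T - s) / real n * (\<integral>\<omega>. asq \<omega> \<partial>M))"
      using di asq_facts(1) by (subst Bochner_Integration.integral_add)
        (auto intro!: integrable_mult_right Bochner_Integration.integrable_sum simp: Bochner_Integration.integral_sum)
    also have "(\<Sum>i<n. \<integral>\<omega>. (d n i \<omega>)\<^sup>2 \<partial>M) = ?A" unfolding d_def using R_telescope[OF s n] by simp
    finally show ?thesis by simp
  qed
  have "(\<integral>\<^sup>+p. indicator {s<..T} (fst p) * nsq Z (fst p) (snd p) \<partial>N)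
    = (\<integral>\<^sup>+\<omega>. ennreal (jump_sum (\<lambda>r \<omega> y. (Z r \<omega> y)\<^sup>2) s \<omega>) \<partial>M)" by (rule jump_sum_sq_nn[OF s, symmetric])
  also have "\<dots> = (\<integral>\<^sup>+\<omega>. liminf (\<lambda>n. ennreal (\<Sum>i<n. (p n i \<omega>)\<^sup>2)) \<partial>M)"
  proof (rule nn_integral_cong)
    fix \<omega> assume "\<omega> \<in> space M"
    then have "\<forall>\<^sub>F n in sequentially. (\<Sum>i<n. (p n i \<omega>)\<^sup>2) = jump_sum (\<lambda>r \<omega> y. (Z r \<omega> y)\<^sup>2) s \<omega>"
      unfolding p_def using jump_sum_grid[of \<omega> s "\<lambda>z. z\<^sup>2" Z] s by simp
    then have "\<forall>\<^sub>F n in sequentially. ennreal (\<Sum>i<n. (p n i \<omega>)\<^sup>2) = ennreal (jump_sum (\<lambda>r \<omega> y. (Z r \<omega> y)\<^sup>2) s \<omega>)"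
      by eventually_elim simp
    then have "(\<lambda>n. ennreal (\<Sum>i<n. (p n i \<omega>)\<^sup>2)) \<longlonglongrightarrow> ennreal (jump_sum (\<lambda>r \<omega> y. (Z r \<omega> y)\<^sup>2) s \<omega>)"
      by (rule tendsto_eventually)
    then show "ennreal (jump_sum (\<lambda>r \<omega> y. (Z r \<omega> y)\<^sup>2) s \<omega>) = liminf (\<lambda>n. ennreal (\<Sum>i<n. (p n i \<omega>)\<^sup>2))"
      by (simp add: lim_imp_Liminf)
  qed
  also have "\<dots> \<le> liminf (\<lambda>n. \<integral>\<^sup>+\<omega>. ennreal (\<Sum>i<n. (p n i \<omega>)\<^sup>2) \<partial>M)"
    using pm by (intro nn_integral_liminf) auto
  also have "\<dots> \<le> liminf (\<lambda>n. ennreal ((1 + 1 / sqrt (real n)) * ?A + (1 + sqrt (real n)) * (?C / real n)))"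
    by (intro Liminf_mono eventually_mono[OF eventually_gt_at_top[of 0]] bound)
  also have "\<dots> = ennreal ?A"
  proof (rule lim_imp_Liminf)
    have "(\<lambda>n. (1 + 1 / sqrt (real n)) * A + (1 + sqrt (real n)) * (C / real n)) \<longlonglongrightarrow> A" for A C :: real
    proof -
      have "(\<lambda>n. 1 + 1 / sqrt (real n)) \<longlonglongrightarrow> 1" "(\<lambda>n. (1 + sqrt (real n)) / real n) \<longlonglongrightarrow> 0"
        by real_asymp+
      from tendsto_add[OF tendsto_mult_right[OF this(1), of A] tendsto_mult_right[OF this(2), of C]]
      show ?thesis by simp
    qed
    then show "(\<lambda>n. ennreal ((1 + 1 / sqrt (real n)) * ?A + (1 + sqrt (real n)) * (?C / real n))) \<longlonglongrightarrow> ennreal ?A"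
      by (intro tendsto_ennrealI)
  qed simp
  finally show ?thesis .
qed

section \<open>Expansion of the square and the energy inequality\<close>

lemma G_N: "(\<lambda>p. G (fst p) (snd p)) \<in> borel_measurable N"
proof -
  have "(\<lambda>q. (snd q, snd (fst q))) \<in> measurable (N \<Otimes>\<^sub>M LT) N"
    by (intro measurable_Pair measurable_compose[OF measurable_fst measurable_snd] measurable_snd)
  from measurable_compose[OF this gN]
  have g: "(\<lambda>q. g (snd q) (snd (fst q))) \<in> borel_measurable (N \<Otimes>\<^sub>M LT)" by simp
  have t1[measurable]: "(\<lambda>q. fst (fst q)) \<in> borel_measurable (N \<Otimes>\<^sub>M LT)"
    by (rule measurable_compose[OF measurable_fst measurable_time_N])
  have t2[measurable]: "(\<lambda>q. snd q) \<in> borel_measurable (N \<Otimes>\<^sub>M LT)"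
    by (rule measurable_compose[OF measurable_snd measurable_id_LT])
  have "(\<lambda>q. (if fst (fst q) \<le> snd q \<and> snd q \<le> T then 1 else 0) * g (snd q) (snd (fst q))) \<in> borel_measurable (N \<Otimes>\<^sub>M LT)"
    using g by measurable
  then have "(\<lambda>(p, r). indicator {fst p..T} r * g r (snd p)) \<in> borel_measurable (N \<Otimes>\<^sub>M LT)"
    by (rule measurable_cong[THEN iffD1, rotated]) (auto simp: indicator_def)
  from LT.borel_measurable_lebesgue_integral[OF this] show ?thesis by (simp add: G_def)
qed

lemma \<eta>_N: "(\<lambda>p. \<eta> (snd p)) \<in> borel_measurable N"
  by (rule measurable_compose[OF measurable_snd \<eta>_meas])

lemma integrable_snd_N:
  fixes f :: "'a \<Rightarrow> real"
  assumes "integrable M f" shows "integrable N (\<lambda>p. f (snd p))"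
proof (rule integrableI_bounded)
  show [measurable]: "(\<lambda>p. f (snd p)) \<in> borel_measurable N"
    by (rule measurable_compose[OF measurable_snd]) (use assms in auto)
  have "(\<integral>\<^sup>+p. ennreal (norm (f (snd p))) \<partial>N) = (\<integral>\<^sup>+\<omega>. ennreal (norm (f \<omega>)) \<partial>M) * emeasure LT (space LT)"
    using assms by (subst N.nn_integral_snd[symmetric]) (auto simp: case_prod_beta' nn_integral_multc)
  then show "(\<integral>\<^sup>+p. ennreal (norm (f (snd p))) \<partial>N) < \<infinity>"
    using assms by (simp add: integrable_iff_bounded ennreal_mult_less_top emeasure_restrict_space emeasure_lborel_Icc_eq)
qed

lemma G_N_L2: "integrable N (\<lambda>p. (G (fst p) (snd p))\<^sup>2)"
proof (rule Bochner_Integration.integrable_bound)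
  show "integrable N (\<lambda>p. (T - t) * gsq (snd p))"
    using integrable_snd_N[OF gsq_facts(1)] by simp
  show "AE p in N. norm ((G (fst p) (snd p))\<^sup>2) \<le> norm ((T - t) * gsq (snd p))"
    using AE_snd_N[OF AE_good] AE_space
  proof eventually_elim
    case (elim p)
    then show ?case using G_bound[of "snd p" "fst p"] t_less_T gsq_facts(3)[of "snd p"] by (auto simp: space_N)
  qed
qed (use G_N in measurable)

lemma \<eta>G_N_L2: "integrable N (\<lambda>p. (\<eta> (snd p) + G (fst p) (snd p))\<^sup>2)"
  by (rule integrable_square_sum) (use integrable_snd_N[OF \<eta>_L2] G_N_L2 \<eta>_N G_N in auto)

lemma R_N_L2: "integrable N (\<lambda>p. (R (fst p) (snd p))\<^sup>2)" "(\<lambda>p. R (fst p) (snd p)) \<in> borel_measurable N"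
  unfolding R_def by (rule integrable_square_sum, use \<eta>G_N_L2 Y_L2 \<eta>_N G_N YN in auto)+

text \<open>For almost every \<open>r\<close> the variable \<open>g r\<close> is square integrable
  and measurable for \<open>F r\<close>, hence orthogonal to \<open>R r\<close>; Fubini collects
  these identities. This is how \<open>\<eta> + G\<close> gets replaced by \<open>Y\<close> in the
  mixed term.\<close>

lemma gR_zero:
  assumes s: "s \<in> {t..T}"
  shows "(\<integral>p. indicator {s..T} (fst p) * (g (fst p) (snd p) * R (fst p) (snd p)) \<partial>N) = 0"
proof -
  have i: "integrable N (\<lambda>p. indicator {s..T} (fst p) * (g (fst p) (snd p) * R (fst p) (snd p)))"
    by (intro indicator_integrable integrable_square_sum g_L2 R_N_L2 gN) simp
  have "AE r in LT. (\<integral>\<omega>. indicator {s..T} r * (g r \<omega> * R r \<omega>) \<partial>M) = 0"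
    using Bochner_snd(6)[OF g_L2] AE_space
  proof eventually_elim
    case (elim r)
    then have r: "r \<in> {t..T}" by simp
    show ?case using orthogonal(2)[OF r gs[OF r] elim(1)] by simp
  qed
  then have "(\<integral>r. (\<integral>\<omega>. indicator {s..T} r * (g r \<omega> * R r \<omega>) \<partial>M) \<partial>LT) = 0"
    by (rule integral_eq_zero_AE)
  then show ?thesis using Bochner_snd(5)[OF i] by simp
qed

text \<open>Pathwise, the square of \<open>\<eta> + G s\<close> is \<open>\<eta>^2\<close> plus
  twice the integral of \<open>g r * (\<eta> + G r)\<close>. There
  \<open>\<eta> + G r = Y r + R r\<close>, and the contribution of \<open>R\<close> has mean
  zero.\<close>

lemma square_expansion:
  assumes s: "s \<in> {t..T}"
  shows "(\<integral>\<omega>. (\<eta> \<omega> + G s \<omega>)\<^sup>2 \<partial>M) = (\<integral>\<omega>. (\<eta> \<omega>)\<^sup>2 \<partial>M)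
    + 2 * (\<integral>p. indicator {s..T} (fst p) * (g (fst p) (snd p) * Y (fst p) (snd p)) \<partial>N)"
proof -
  have i: "integrable N (\<lambda>p. indicator {s..T} (fst p) * (g (fst p) (snd p) * (\<eta> (snd p) + G (fst p) (snd p))))"
    by (intro indicator_integrable integrable_square_sum g_L2 \<eta>G_N_L2 gN borel_measurable_add \<eta>_N G_N) simp
  have ae: "AE \<omega> in M. (\<eta> \<omega> + G s \<omega>)\<^sup>2 = (\<eta> \<omega>)\<^sup>2 + 2 * (\<integral>r. indicator {s..T} r * (g r \<omega> * (\<eta> \<omega> + G r \<omega>)) \<partial>LT)"
    using AE_good
  proof eventually_elim
    case (elim \<omega>)
    \<comment> \<open>The driver of one path, extended by 0 outside \<open>[s, T]\<close>, so that
      the identity on the whole line applies.\<close>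
    define f where "f r = indicator {s..T} r * g r \<omega>" for r
    have L: "(\<integral>r. h r \<partial>LT) = (\<integral>r. indicator {t..T} r * h r \<partial>lborel)" for h :: "real \<Rightarrow> real"
      by (subst integral_restrict_space) auto
    have fi: "integrable lborel f"
    proof -
      have "integrable LT f" unfolding f_def using elim s
        by (intro integrable_mult_indicator[where 'b=real, simplified] LT_sets) auto
      then have "integrable lborel (\<lambda>r. indicator {t..T} r * f r)"
        by (subst (asm) integrable_restrict_space) auto
      moreover have "(\<lambda>r. indicator {t..T} r * f r) = f" using s by (auto simp: f_def indicator_def)
      ultimately show ?thesis by simp
    qed
    have Gs: "G s \<omega> = (\<integral>r. f r \<partial>lborel)"
      unfolding G_def L f_def using s by (intro Bochner_Integration.integral_cong) (auto simp: indicator_def)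
    have Gr: "f r * G r \<omega> = f r * (\<integral>u. indicator {r..} u * f u \<partial>lborel)" for r
    proof (cases "r \<in> {s..T}")
      case True
      have "G r \<omega> = (\<integral>u. indicator {r..} u * f u \<partial>lborel)"
        unfolding G_def L f_def using s True by (intro Bochner_Integration.integral_cong) (auto simp: indicator_def)
      then show ?thesis by simp
    qed (simp add: f_def)
    note sq = integral_square_eq_iterated[OF fi, folded Gr Gs]
    have "(\<integral>r. indicator {s..T} r * (g r \<omega> * (\<eta> \<omega> + G r \<omega>)) \<partial>LT) = (\<integral>r. \<eta> \<omega> * f r + f r * G r \<omega> \<partial>lborel)"
      unfolding L f_def using s by (intro Bochner_Integration.integral_cong) (auto simp: indicator_def algebra_simps)
    also have "\<dots> = \<eta> \<omega> * G s \<omega> + (\<integral>r. f r * G r \<omega> \<partial>lborel)"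
      using fi sq(1) by (simp add: Gs)
    finally show ?case using sq(2) by (simp add: power2_sum)
  qed
  have "(\<integral>\<omega>. (\<eta> \<omega> + G s \<omega>)\<^sup>2 \<partial>M) = (\<integral>\<omega>. (\<eta> \<omega>)\<^sup>2 + 2 * (\<integral>r. indicator {s..T} r * (g r \<omega> * (\<eta> \<omega> + G r \<omega>)) \<partial>LT) \<partial>M)"
    using \<eta>_meas G_meas[OF s] borel_measurable_integrable[OF Bochner_snd(1)[OF i]]
    by (intro integral_cong_AE ae) auto
  also have "\<dots> = (\<integral>\<omega>. (\<eta> \<omega>)\<^sup>2 \<partial>M) + 2 * (\<integral>p. indicator {s..T} (fst p) * (g (fst p) (snd p) * (\<eta> (snd p) + G (fst p) (snd p))) \<partial>N)"
    using \<eta>_L2 Bochner_snd(1,2)[OF i] by simp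
  also have "(\<integral>p. indicator {s..T} (fst p) * (g (fst p) (snd p) * (\<eta> (snd p) + G (fst p) (snd p))) \<partial>N)
    = (\<integral>p. indicator {s..T} (fst p) * (g (fst p) (snd p) * Y (fst p) (snd p))
        + indicator {s..T} (fst p) * (g (fst p) (snd p) * R (fst p) (snd p)) \<partial>N)"
    by (intro Bochner_Integration.integral_cong) (auto simp: R_def algebra_simps)
  also have "\<dots> = (\<integral>p. indicator {s..T} (fst p) * (g (fst p) (snd p) * Y (fst p) (snd p)) \<partial>N)"
  proof (subst Bochner_Integration.integral_add)
    show "integrable N (\<lambda>p. indicator {s..T} (fst p) * (g (fst p) (snd p) * Y (fst p) (snd p)))"
      by (intro indicator_integrable integrable_square_sum g_L2 Y_L2 gN YN) simp
    show "integrable N (\<lambda>p. indicator {s..T} (fst p) * (g (fst p) (snd p) * R (fst p) (snd p)))"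
      by (intro indicator_integrable integrable_square_sum g_L2 R_N_L2 gN) simp
  qed (simp add: gR_zero[OF s])
  finally show ?thesis .
qed

theorem energy_inequality:
  assumes s: "s \<in> {t..T}"
  shows "(\<integral>\<omega>. (Y s \<omega>)\<^sup>2 \<partial>M) + (\<integral>p. indicator {s..T} (fst p) * enn2real (nsq Z (fst p) (snd p)) \<partial>N)
    \<le> (\<integral>\<omega>. (\<eta> \<omega>)\<^sup>2 \<partial>M) + 2 * (\<integral>p. indicator {s..T} (fst p) * (g (fst p) (snd p) * Y (fst p) (snd p)) \<partial>N)"
proof -
  note D = L2_fieldD[OF Z_L2]
  \<comment> \<open>The isometry concerns \<open>{s<..T}\<close>, the claim \<open>{s..T}\<close>;
    the time slice at \<open>s\<close> is null.\<close>
  have "AE r in lborel. r \<noteq> s" by (rule AE_lborel_singleton)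
  then have "AE r in LT. r \<noteq> s" by (subst AE_restrict_space_iff) auto
  then have aeN: "AE p in N. fst p \<noteq> s"
  proof -
    have "{s} \<in> sets LT" using s by (intro LT_sets) auto
    then have "{s} \<times> \<Omega> \<in> null_sets N"
      using M.emeasure_pair_measure_Times[of "{s}" LT \<Omega>] s sets.top[of M]
      by (intro null_setsI) (auto simp: emeasure_restrict_space)
    then show ?thesis by (rule AE_I') (auto simp: space_N)
  qed
  have "ennreal (\<integral>p. indicator {s..T} (fst p) * enn2real (nsq Z (fst p) (snd p)) \<partial>N)
    = (\<integral>\<^sup>+p. indicator {s..T} (fst p) * nsq Z (fst p) (snd p) \<partial>N)"
    by (rule D(6)[symmetric]) simp
  also have "\<dots> = (\<integral>\<^sup>+p. indicator {s<..T} (fst p) * nsq Z (fst p) (snd p) \<partial>N)"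
    by (intro nn_integral_cong_AE eventually_mono[OF aeN]) (auto simp: indicator_def)
  also have "\<dots> \<le> ennreal (\<integral>\<omega>. (R s \<omega>)\<^sup>2 \<partial>M)" by (rule isometry_le[OF s])
  finally have "(\<integral>p. indicator {s..T} (fst p) * enn2real (nsq Z (fst p) (snd p)) \<partial>N) \<le> (\<integral>\<omega>. (R s \<omega>)\<^sup>2 \<partial>M)"
    by (subst (asm) ennreal_le_iff) auto
  then show ?thesis using pythagoras[OF s] square_expansion[OF s] by simp
qed

end

section \<open>Localisation and Gronwall estimates\<close>

text \<open>
  Here \<open>a\<close>, \<open>b\<close> stand for \<open>\<bar>Y\<^sup>n - Y\<bar>\<close> and \<open>\<parallel>Z\<^sup>n - Z\<parallel>\<close>, \<open>g\<close> for
  the difference of the drivers, \<open>S\<close> for a bound of the limit solution and \<open>w\<close> for the local distance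
  of the generators.
\<close>

locale stability = jump_process +
  fixes a b g :: "nat \<Rightarrow> real \<times> 'a \<Rightarrow> real" and S :: "real \<times> 'a \<Rightarrow> real"
    and w :: "nat \<Rightarrow> nat \<Rightarrow> real \<times> 'a \<Rightarrow> real"
    and e :: "nat \<Rightarrow> real" and C L \<alpha> :: real and Lip :: "nat \<Rightarrow> real"
  assumes a_meas [measurable]: "\<And>n. a n \<in> borel_measurable N" and a_nonneg: "\<And>n p. 0 \<le> a n p"
    and a_L2: "\<And>n. integrable N (\<lambda>p. (a n p)\<^sup>2)"
    and b_meas [measurable]: "\<And>n. b n \<in> borel_measurable N" and b_nonneg: "\<And>n p. 0 \<le> b n p"
    and b_L2: "\<And>n. integrable N (\<lambda>p. (b n p)\<^sup>2)"
    and g_meas [measurable]: "\<And>n. g n \<in> borel_measurable N"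
    and S_meas [measurable]: "S \<in> borel_measurable N" and S_nonneg: "\<And>p. 0 \<le> S p"
    and S_L2: "integrable N (\<lambda>p. (S p)\<^sup>2)"
    and C_pos: "0 < C" and \<alpha>: "0 < \<alpha>" "\<alpha> < 1"
    and growth: "\<And>n. AE p in N. \<bar>g n p\<bar> \<le> C * (1 + (S p + a n p + 2 * b n p) powr \<alpha>)"
    and Lip_pos: "\<And>m. m \<ge> 1 \<Longrightarrow> 0 < Lip m" and L_pos: "0 < L"
    and Lip_le: "\<And>m. m \<ge> 1 \<Longrightarrow> Lip m \<le> L + sqrt (ln (real m))"
    and w_int: "\<And>m n. integrable N (w m n)" and w_nonneg: "\<And>m n p. 0 \<le> w m n p"
    and w_lim: "\<And>m. m \<ge> 1 \<Longrightarrow> (\<lambda>n. \<integral>p. w m n p \<partial>N) \<longlonglongrightarrow> 0"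
    and local: "\<And>m n. m \<ge> 1 \<Longrightarrow> AE p in N. S p + a n p + 2 * b n p < real m \<longrightarrow>
        \<bar>g n p\<bar> \<le> sqrt (w m n p) + Lip m * (a n p + b n p)"
    and e_lim: "e \<longlonglongrightarrow> 0"
    and energy: "\<And>n s. s \<in> {t..T} \<Longrightarrow> (\<integral>\<omega>. (a n (s, \<omega>))\<^sup>2 \<partial>M) + (\<integral>p. indicator {s..T} (fst p) * (b n p)\<^sup>2 \<partial>N)
        \<le> e n + 2 * (\<integral>p. indicator {s..T} (fst p) * (\<bar>g n p\<bar> * a n p) \<partial>N)"
begin

section \<open>From the energy inequality to Gronwall\<close>

abbreviation A2 :: "nat \<Rightarrow> real \<Rightarrow> real \<Rightarrow> real" where
  "A2 n s u \<equiv> \<integral>p. indicator {s..u} (fst p) * (a n p)\<^sup>2 \<partial>N"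

abbreviation GA :: "nat \<Rightarrow> real \<Rightarrow> real" where
  "GA n s \<equiv> \<integral>p. indicator {s..T} (fst p) * (\<bar>g n p\<bar> * a n p) \<partial>N"

text \<open>The single variable along which the localisation cuts: both the growth bound and the
  local Lipschitz bound are stated in terms of it.\<close>

definition Q :: "nat \<Rightarrow> real \<times> 'a \<Rightarrow> real" where "Q n p = S p + a n p + 2 * b n p"

text \<open>Cut off outside \<open>[t, T]\<close> to be a Borel function on the whole line, as
  \<open>backward_gronwall\<close> expects.\<close>

definition y :: "nat \<Rightarrow> real \<Rightarrow> real" where
  "y n r = indicator {t..T} r * (\<integral>\<omega>. (a n (r, \<omega>))\<^sup>2 \<partial>M)"

definition B :: "nat \<Rightarrow> real \<Rightarrow> real" where
  "B n s = (\<integral>p. indicator {s..T} (fst p) * (b n p)\<^sup>2 \<partial>N)"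

lemma y_eq: "s \<in> {t..T} \<Longrightarrow> y n s = (\<integral>\<omega>. (a n (s, \<omega>))\<^sup>2 \<partial>M)"
  by (simp add: y_def)

lemma y_nonneg: "0 \<le> y n r" by (simp add: y_def)

lemma B_nonneg: "0 \<le> B n s" unfolding B_def by (intro integral_nonneg_AE) auto

lemma Q_nonneg: "0 \<le> Q n p" using S_nonneg a_nonneg b_nonneg by (simp add: Q_def)

lemma Q_meas [measurable]: "Q n \<in> borel_measurable N"
  unfolding Q_def[abs_def] by measurable

lemma Q_L2: "integrable N (\<lambda>p. (Q n p)\<^sup>2)"
  "(\<integral>p. (Q n p)\<^sup>2 \<partial>N) \<le> 3 * (\<integral>p. (S p)\<^sup>2 \<partial>N) + 3 * (\<integral>p. (a n p)\<^sup>2 \<partial>N) + 12 * (\<integral>p. (b n p)\<^sup>2 \<partial>N)"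
  unfolding Q_def by (intro integrable_square_sum3 S_L2 a_L2 b_L2; measurable)+

lemma g_L2: "integrable N (\<lambda>p. (g n p)\<^sup>2)" "(\<integral>p. (g n p)\<^sup>2 \<partial>N) \<le> (\<integral>p. C\<^sup>2 * (8 + 2 * (Q n p)\<^sup>2) \<partial>N)"
  and g_bound: "AE p in N. \<bar>g n p\<bar> \<le> C * (2 + Q n p)"
proof -
  have "AE p in N. \<bar>g n p\<bar> \<le> C * (1 + Q n p powr \<alpha>)" using growth[of n] by (simp add: Q_def)
  note s = N.sublinear_growth[OF this C_pos \<alpha> Q_nonneg Q_L2(1) g_meas]
  show "integrable N (\<lambda>p. (g n p)\<^sup>2)" "(\<integral>p. (g n p)\<^sup>2 \<partial>N) \<le> (\<integral>p. C\<^sup>2 * (8 + 2 * (Q n p)\<^sup>2) \<partial>N)"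
    "AE p in N. \<bar>g n p\<bar> \<le> C * (2 + Q n p)" by (rule s)+
qed

lemma ga_int: "integrable N (\<lambda>p. \<bar>g n p\<bar> * a n p)"
proof (rule Bochner_Integration.integrable_bound)
  show "integrable N (\<lambda>p. (g n p)\<^sup>2 + (a n p)\<^sup>2)" using g_L2(1) a_L2 by simp
  have "x * z \<le> x\<^sup>2 + z\<^sup>2" if "x \<ge> 0" "z \<ge> 0" for x z :: real
    using sum_squares_bound[of x z] mult_nonneg_nonneg[OF that] by linarith
  from this[of "\<bar>g n p\<bar>" "a n p" for p] show "AE p in N. norm (\<bar>g n p\<bar> * a n p) \<le> norm ((g n p)\<^sup>2 + (a n p)\<^sup>2)"
    using a_nonneg by (simp add: abs_mult)
qed measurable

lemma y_meas: "y n \<in> borel_measurable borel"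
proof -
  have i: "integrable N (\<lambda>p. (a n (fst p, snd p))\<^sup>2)" using a_L2[of n] by simp
  have "(\<lambda>r. \<integral>\<omega>. (a n (r, \<omega>))\<^sup>2 \<partial>M) \<in> borel_measurable LT"
    using borel_measurable_integrable[OF Bochner_snd(4)[OF i]] .
  then have "(\<lambda>r. indicator {t..T} r *\<^sub>R (\<integral>\<omega>. (a n (r, \<omega>))\<^sup>2 \<partial>M)) \<in> borel_measurable lborel"
    by (subst (asm) borel_measurable_restrict_space_iff) auto
  then show ?thesis by (simp add: y_def[abs_def])
qed

lemma y_integral:
  assumes "t \<le> s" "u \<le> T"
  shows "A2 n s u = (LINT r:{s..u}|lborel. y n r)"
proof -
  have i: "integrable N (\<lambda>p. indicator {s..u} (fst p) * (a n (fst p, snd p))\<^sup>2)"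
    using indicator_integrable[OF a_L2[of n], of "{s..u}"] by simp
  have "A2 n s u
    = (\<integral>r. (\<integral>\<omega>. indicator {s..u} r * (a n (r, \<omega>))\<^sup>2 \<partial>M) \<partial>LT)"
    using Bochner_snd(5)[OF i] by simp
  also have "\<dots> = (\<integral>r. indicator {s..u} r * y n r \<partial>LT)"
    by (intro Bochner_Integration.integral_cong) (auto simp: y_def)
  also have "\<dots> = (LINT r:{s..u}|lborel. y n r)" using assms by (intro integral_LT) auto
  finally show ?thesis .
qed

text \<open>A crude bound that may depend on \<open>n\<close>; it provides the finite constant which
  \<open>backward_gronwall\<close> needs to start.\<close>

lemma y_bound:
  assumes "s \<in> {t..T}" shows "y n s \<le> e n + 2 * (\<integral>p. \<bar>g n p\<bar> * a n p \<partial>N)"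
proof -
  have "GA n s \<le> (\<integral>p. \<bar>g n p\<bar> * a n p \<partial>N)"
    by (rule integral_indicator_le[OF ga_int]) (use a_nonneg in auto)
  then show ?thesis
    using energy[OF assms, of n] B_nonneg[of n s, unfolded B_def] unfolding y_eq[OF assms] by linarith
qed

lemma y_integral_le:
  assumes "\<And>s. s \<in> {\<sigma>..\<tau>} \<Longrightarrow> y n s \<le> r" "\<sigma> \<le> \<tau>"
  shows "(LINT s:{\<sigma>..\<tau>}|lborel. y n s) \<le> r * (\<tau> - \<sigma>)"
proof -
  have c: "set_integrable lborel {\<sigma>..\<tau>} (\<lambda>_. r)" by (intro borel_integrable_atLeastAtMost' continuous_intros)
  have "(LINT s:{\<sigma>..\<tau>}|lborel. y n s) \<le> (LINT s:{\<sigma>..\<tau>}|lborel. r)"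
  proof (rule set_integral_mono[OF _ c])
    show "set_integrable lborel {\<sigma>..\<tau>} (y n)"
      by (rule set_integrable_bound[OF c])
         (use y_meas assms(1) y_nonneg in \<open>auto intro!: AE_I2 order_trans[OF _ abs_ge_self] simp: set_borel_measurable_def\<close>)
  qed (use assms(1) in auto)
  then show ?thesis using assms(2) by (simp add: set_lebesgue_integral_def mult.commute)
qed

text \<open>The term \<open>B n s / 2\<close> on the right is absorbed by the full
  \<open>B n s\<close> in the energy inequality, which leaves one half on the left. The quadratic
  term reaches only to \<open>\<tau>\<close>; whatever happens after \<open>\<tau>\<close> has to be
  put into \<open>A\<close>.\<close>

lemma gronwall_step:
  assumes \<sigma>: "t \<le> \<sigma>" "\<tau> \<le> T" and k: "k > 0" and A: "A \<ge> 0"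
    and le: "\<And>s. s \<in> {\<sigma>..\<tau>} \<Longrightarrow> 2 * GA n s + e n
       \<le> A + k * A2 n s \<tau> + B n s / 2"
    and s: "s \<in> {\<sigma>..\<tau>}"
  shows "y n s + B n s / 2 \<le> 2 * A * exp (2 * k * (\<tau> - s))"
proof -
  have main: "y n s + B n s / 2 \<le> A + k * (LINT r:{s..\<tau>}|lborel. y n r)" if "s \<in> {\<sigma>..\<tau>}" for s
  proof -
    have st: "s \<in> {t..T}" using that \<sigma> by auto
    show ?thesis
      using le[OF that] energy[OF st, of n] y_eq[OF st, of n] y_integral[of s \<tau> n] st \<sigma> by (simp add: B_def)
  qed
  also have "A + k * (LINT r:{s..\<tau>}|lborel. y n r) \<le> 2 * A * exp (2 * k * (\<tau> - s))"
  proof (rule backward_gronwall[OF k A y_meas _ _ _ s])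
    fix s assume s: "s \<in> {\<sigma>..\<tau>}"
    show "0 \<le> y n s" by (rule y_nonneg)
    show "y n s \<le> e n + 2 * (\<integral>p. \<bar>g n p\<bar> * a n p \<partial>N)" using s \<sigma> by (intro y_bound) auto
    show "y n s \<le> A + k * (LINT r:{s..\<tau>}|lborel. y n r)" using main[OF s] B_nonneg[of n s] by simp
  qed
  finally show ?thesis using s by blast
qed

section \<open>Bounds uniform in the index\<close>

text \<open>Only linear growth of the drivers is used, so one Gronwall argument over all of
  \<open>[t, T]\<close> works with constants independent of \<open>n\<close>. The outcome controls
  the complement of the localisation.\<close>

lemma uniform_bound: "\<exists>D. \<forall>n. (\<integral>p. (a n p)\<^sup>2 \<partial>N) \<le> D \<and> (\<integral>p. (b n p)\<^sup>2 \<partial>N) \<le> D"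
proof -
  obtain e0 where e0: "\<And>n. \<bar>e n\<bar> \<le> e0"
    using convergent_imp_Bseq[OF convergentI[OF e_lim]] by (auto simp: Bseq_def)
  \<comment> \<open>In the bound for \<open>2 * abs g * a\<close>, the term with \<open>a^2\<close>
    gives \<open>2 * C\<close>, Young for \<open>(2 + S) * a\<close> adds \<open>C\<close>, and
    Young for \<open>4 * C * b * a\<close> against \<open>b^2 / 2\<close> adds
    \<open>8 * C^2\<close>.\<close>
  define k where "k = 3 * C + 8 * C\<^sup>2"
  define A where "A = e0 + C * (\<integral>p. (2 + S p)\<^sup>2 \<partial>N)"
  have k0: "k > 0" using C_pos by (simp add: k_def add_pos_pos)
  have A0: "A \<ge> 0" using C_pos e0[of 0] by (simp add: A_def)
  have S2: "integrable N (\<lambda>p. (2 + S p)\<^sup>2)"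
  proof (rule Bochner_Integration.integrable_bound[of _ "\<lambda>p. 8 + 2 * (S p)\<^sup>2"])
    have "(2 + x)\<^sup>2 \<le> 8 + 2 * x\<^sup>2" for x :: real
      using sum_squares_bound[of 2 x] by (simp add: power2_sum)
    then show "AE p in N. norm ((2 + S p)\<^sup>2) \<le> norm (8 + 2 * (S p)\<^sup>2)" by simp
  qed (use S_L2 in auto)
  have est: "y n s + B n s / 2 \<le> 2 * A * exp (2 * k * (T - t))" if s: "s \<in> {t..T}" for n s
  proof -
    have "y n s + B n s / 2 \<le> 2 * A * exp (2 * k * (T - s))"
    proof (rule gronwall_step[OF _ _ k0 A0 _ s])
      fix s assume s: "s \<in> {t..T}"
      have ae: "AE p in N. 2 * (indicator {s..T} (fst p) * (\<bar>g n p\<bar> * a n p))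
        \<le> C * (2 + S p)\<^sup>2 + k * (indicator {s..T} (fst p) * (a n p)\<^sup>2) + (indicator {s..T} (fst p) * (b n p)\<^sup>2) / 2"
        using g_bound[of n]
      proof eventually_elim
        case (elim p)
        let ?a = "a n p" and ?b = "b n p" and ?S = "S p"
        have "\<bar>g n p\<bar> * ?a \<le> C * (2 + Q n p) * ?a" using elim a_nonneg by (intro mult_right_mono)
        also have "\<dots> = C * ((2 + ?S) * ?a) + C * ?a\<^sup>2 + 2 * C * ?b * ?a"
          by (simp add: Q_def power2_eq_square algebra_simps)
        finally have 1: "\<bar>g n p\<bar> * ?a \<le> C * ((2 + ?S) * ?a) + C * ?a\<^sup>2 + 2 * C * ?b * ?a" .
        have 2: "2 * (C * ((2 + ?S) * ?a)) \<le> C * (2 + ?S)\<^sup>2 + C * ?a\<^sup>2"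
          using mult_left_mono[OF sum_squares_bound[of "2 + ?S" ?a], of C] C_pos by (simp add: algebra_simps)
        have 3: "2 * (2 * C * ?b * ?a) \<le> ?b\<^sup>2 / 2 + 8 * C\<^sup>2 * ?a\<^sup>2"
          using sum_squares_bound[of ?b "4 * C * ?a"] by (simp add: power_mult_distrib algebra_simps)
        have "2 * (\<bar>g n p\<bar> * ?a) \<le> C * (2 + ?S)\<^sup>2 + k * ?a\<^sup>2 + ?b\<^sup>2 / 2"
          using 1 2 3 by (simp add: k_def algebra_simps)
        moreover have "0 \<le> C * (2 + ?S)\<^sup>2" using C_pos by simp
        ultimately show ?case by (auto simp: indicator_def)
      qed
      have "2 * GA n s
        = (\<integral>p. 2 * (indicator {s..T} (fst p) * (\<bar>g n p\<bar> * a n p)) \<partial>N)" by simp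
      also have "\<dots> \<le> (\<integral>p. C * (2 + S p)\<^sup>2 + k * (indicator {s..T} (fst p) * (a n p)\<^sup>2) + (indicator {s..T} (fst p) * (b n p)\<^sup>2) / 2 \<partial>N)"
        by (rule integral_mono_AE[OF _ _ ae])
           (auto intro!: indicator_integrable ga_int S2 a_L2 b_L2 Bochner_Integration.integrable_add integrable_mult_right integrable_divide)
      also have "\<dots> = C * (\<integral>p. (2 + S p)\<^sup>2 \<partial>N) + k * A2 n s T + B n s / 2"
        using indicator_integrable[OF a_L2[of n], of "{s..T}"] indicator_integrable[OF b_L2[of n], of "{s..T}"] S2
        by (simp add: B_def)
      finally show "2 * GA n s + e n
         \<le> A + k * A2 n s T + B n s / 2"
        using e0[of n] by (simp add: A_def)
    qed auto
    also have "\<dots> \<le> 2 * A * exp (2 * k * (T - t))"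
      using s k0 A0 by (intro mult_left_mono) auto
    finally show ?thesis .
  qed
  define D where "D = 2 * A * exp (2 * k * (T - t))"
  have tT: "t \<in> {t..T}" using t_less_T by simp
  have ind: "(\<integral>p. f p \<partial>N) = (\<integral>p. indicator {t..T} (fst p) * f p \<partial>N)" for f :: "_ \<Rightarrow> real"
    by (intro Bochner_Integration.integral_cong) (auto simp: space_N)
  have "(\<integral>p. (a n p)\<^sup>2 \<partial>N) \<le> (T - t) * D" for n
  proof -
    have yD: "y n s \<le> D" if "s \<in> {t..T}" for s using est[OF that, of n] B_nonneg[of n s] by (simp add: D_def)
    have "(\<integral>p. (a n p)\<^sup>2 \<partial>N) = (LINT r:{t..T}|lborel. y n r)"
      by (subst ind) (rule y_integral, auto)
    also have "\<dots> \<le> D * (T - t)" using yD t_less_T by (intro y_integral_le) auto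
    also have "\<dots> = (T - t) * D" by simp
    finally show ?thesis .
  qed
  moreover have "(\<integral>p. (b n p)\<^sup>2 \<partial>N) \<le> 2 * D" for n
    using est[OF tT, of n] y_nonneg[of n t] by (subst ind) (simp add: B_def D_def)
  ultimately have "(\<integral>p. (a n p)\<^sup>2 \<partial>N) \<le> max ((T - t) * D) (2 * D) \<and> (\<integral>p. (b n p)\<^sup>2 \<partial>N) \<le> max ((T - t) * D) (2 * D)" for n
    by (simp add: le_max_iff_disj)
  then show ?thesis by blast
qed

lemma Q_bounded: obtains V where "0 \<le> V" "\<And>n. (\<integral>p. (Q n p)\<^sup>2 \<partial>N) \<le> V"
proof -
  obtain D where D: "\<And>n. (\<integral>p. (a n p)\<^sup>2 \<partial>N) \<le> D" "\<And>n. (\<integral>p. (b n p)\<^sup>2 \<partial>N) \<le> D"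
    using uniform_bound by blast
  have le: "(\<integral>p. (Q n p)\<^sup>2 \<partial>N) \<le> 3 * (\<integral>p. (S p)\<^sup>2 \<partial>N) + 15 * D" for n
    using Q_L2(2)[of n] D(1)[of n] D(2)[of n] by linarith
  have "0 \<le> (\<integral>p. (Q 0 p)\<^sup>2 \<partial>N)" by simp
  from that[OF order_trans[OF this le] le] show thesis .
qed

text \<open>The drivers are bounded in second moment uniformly in \<open>n\<close> while
  \<open>a\<close> tends to 0, so a weighted Young inequality makes the mixed term vanish. It
  controls the stretch \<open>[\<tau>, T]\<close> already treated.\<close>

lemma tail_lim:
  assumes conv: "(\<lambda>n. \<integral>p. indicator {\<tau>..T} (fst p) * (a n p)\<^sup>2 \<partial>N) \<longlonglongrightarrow> 0"
  shows "(\<lambda>n. \<integral>p. indicator {\<tau>..T} (fst p) * (\<bar>g n p\<bar> * a n p) \<partial>N) \<longlonglongrightarrow> 0"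
proof -
  obtain W where W: "0 \<le> W" "\<And>n. (\<integral>p. (Q n p)\<^sup>2 \<partial>N) \<le> W" using Q_bounded by blast
  define V where "V = C\<^sup>2 * (8 * measure N (space N) + 2 * W) + 1"
  have V0: "V > 0" using W(1) by (simp add: V_def add_nonneg_pos)
  have gV: "(\<integral>p. (g n p)\<^sup>2 \<partial>N) \<le> V" for n
  proof -
    have "(\<integral>p. (g n p)\<^sup>2 \<partial>N) \<le> C\<^sup>2 * (8 * measure N (space N) + 2 * (\<integral>p. (Q n p)\<^sup>2 \<partial>N))"
      using g_L2(2)[of n] Q_L2(1)[of n] by (simp add: mult.commute)
    also have "\<dots> \<le> C\<^sup>2 * (8 * measure N (space N) + 2 * W)"
      using W(2)[of n] by (intro mult_left_mono) auto
    finally show ?thesis by (simp add: V_def)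
  qed
  let ?I = "\<lambda>n. \<integral>p. indicator {\<tau>..T} (fst p) * (\<bar>g n p\<bar> * a n p) \<partial>N"
  show ?thesis
  proof (rule LIMSEQ_I)
    fix r :: real assume r: "0 < r"
    \<comment> \<open>Then \<open>\<theta> * V = r\<close>, and once the other term is below
      \<open>r / 2\<close> the doubled integral stays below \<open>3 * r / 2\<close>.\<close>
    define \<theta> where "\<theta> = r / V"
    have \<theta>: "\<theta> > 0" using r V0 by (simp add: \<theta>_def)
    have le: "2 * ?I n \<le> \<theta> * V + A2 n \<tau> T / \<theta>" for n
    proof -
      have pt: "2 * (indicator {\<tau>..T} (fst p) * (\<bar>g n p\<bar> * a n p))
        \<le> \<theta> * (g n p)\<^sup>2 + (indicator {\<tau>..T} (fst p) * (a n p)\<^sup>2) / \<theta>" for p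
      proof -
        have "0 \<le> (\<theta> * \<bar>g n p\<bar> - a n p)\<^sup>2 / \<theta>" using \<theta> by simp
        also have "\<dots> = \<theta> * (g n p)\<^sup>2 - 2 * (\<bar>g n p\<bar> * a n p) + (a n p)\<^sup>2 / \<theta>"
          using \<theta> by (simp add: power2_diff power_mult_distrib field_simps power2_eq_square)
        finally have "2 * (\<bar>g n p\<bar> * a n p) \<le> \<theta> * (g n p)\<^sup>2 + (a n p)\<^sup>2 / \<theta>" by simp
        then show ?thesis using \<theta> by (auto simp: indicator_def)
      qed
      have "2 * ?I n = (\<integral>p. 2 * (indicator {\<tau>..T} (fst p) * (\<bar>g n p\<bar> * a n p)) \<partial>N)" by simp
      also have "\<dots> \<le> (\<integral>p. \<theta> * (g n p)\<^sup>2 + (indicator {\<tau>..T} (fst p) * (a n p)\<^sup>2) / \<theta> \<partial>N)"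
        by (rule integral_mono[OF _ _ pt])
           (auto intro!: indicator_integrable ga_int g_L2 a_L2 Bochner_Integration.integrable_add integrable_mult_right integrable_divide)
      also have "\<dots> = \<theta> * (\<integral>p. (g n p)\<^sup>2 \<partial>N) + A2 n \<tau> T / \<theta>"
        using indicator_integrable[OF a_L2[of n], of "{\<tau>..T}"] g_L2(1)[of n] by simp
      also have "\<dots> \<le> \<theta> * V + A2 n \<tau> T / \<theta>"
        using gV[of n] \<theta> by (intro add_right_mono mult_left_mono) auto
      finally show ?thesis .
    qed
    have "\<forall>\<^sub>F n in sequentially. A2 n \<tau> T < \<theta> * r / 2"
      using conv \<theta> r by (intro order_tendstoD) auto
    then obtain n0 where n0: "\<And>n. n \<ge> n0 \<Longrightarrow> A2 n \<tau> T < \<theta> * r / 2"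
      by (auto simp: eventually_sequentially)
    have "norm (?I n - 0) < r" if "n \<ge> n0" for n
    proof -
      have "A2 n \<tau> T / \<theta> < r / 2"
        using n0[OF that] \<theta> by (simp add: divide_less_eq mult.commute)
      moreover have "\<theta> * V = r" using V0 by (simp add: \<theta>_def)
      ultimately have "?I n < r" using le[of n] r by linarith
      moreover have "0 \<le> ?I n" using a_nonneg by (intro integral_nonneg_AE) auto
      ultimately show ?thesis by simp
    qed
    then show "\<exists>n0. \<forall>n\<ge>n0. norm (?I n - 0) < r" by blast
  qed
qed

section \<open>Localisation and one backward time step\<close>

text \<open>The Gronwall exponent over one step is \<open>2 * k * \<delta>\<close> with
  \<open>k\<close> at most a constant plus \<open>6 * ln m\<close>. Hence the exponential is of
  order \<open>m powr (12 * \<delta>)\<close>, and 24 makes this exponent half of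
  \<open>1 - \<alpha>\<close>.\<close>

definition \<delta> :: real where "\<delta> = (1 - \<alpha>) / 24"

lemma \<delta>_pos: "\<delta> > 0" using \<alpha> by (simp add: \<delta>_def)

text \<open>
  Where \<open>Q \<ge> m\<close> the sublinear growth gains the factor \<open>m powr (\<alpha> - 1)\<close>; where \<open>Q < m\<close> the local
  Lipschitz bound applies.
\<close>

lemma pointwise_split:
  assumes m: "m \<ge> 1"
  shows "AE p in N. 2 * (\<bar>g n p\<bar> * a n p) \<le> w m n p + (1 + 2 * Lip m + 2 * (Lip m)\<^sup>2) * (a n p)\<^sup>2 + (b n p)\<^sup>2 / 2
    + 4 * C * real m powr (\<alpha> - 1) * (Q n p)\<^sup>2"
  using growth[of n] local[OF m, of n]
proof eventually_elim
  case (elim p)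
  let ?a = "a n p" and ?b = "b n p" and ?l = "Lip m"
  have l: "?l > 0" by (rule Lip_pos[OF m])
  have a0: "0 \<le> ?a" and b0: "0 \<le> ?b" by (rule a_nonneg, rule b_nonneg)
  show ?case
  proof (cases "Q n p < real m")
    case True
    then have "\<bar>g n p\<bar> \<le> sqrt (w m n p) + ?l * (?a + ?b)" using elim by (simp add: Q_def)
    then have "2 * (\<bar>g n p\<bar> * ?a) \<le> 2 * ((sqrt (w m n p) + ?l * (?a + ?b)) * ?a)"
      using a0 by (intro mult_left_mono mult_right_mono) auto
    also have "\<dots> = 2 * sqrt (w m n p) * ?a + 2 * ?l * ?a\<^sup>2 + 2 * ?l * ?a * ?b"
      by (simp add: power2_eq_square algebra_simps)
    \<comment> \<open>Young twice: \<open>2 * sqrt w * a \<le> w + a^2\<close>, and the product of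
      \<open>a\<close> and \<open>b\<close> is weighted to leave exactly the \<open>b^2 / 2\<close>
      that the energy inequality can absorb.\<close>
    also have "\<dots> \<le> (w m n p + ?a\<^sup>2) + 2 * ?l * ?a\<^sup>2 + (2 * ?l\<^sup>2 * ?a\<^sup>2 + ?b\<^sup>2 / 2)"
      using sum_squares_bound[of "sqrt (w m n p)" ?a] sum_squares_bound[of "2 * ?l * ?a" ?b] w_nonneg[of m n p]
      by (simp add: power_mult_distrib)
    also have "\<dots> = w m n p + (1 + 2 * ?l + 2 * ?l\<^sup>2) * ?a\<^sup>2 + ?b\<^sup>2 / 2" by (simp add: algebra_simps)
    finally show ?thesis using C_pos by (smt (verit) mult_nonneg_nonneg powr_ge_zero zero_le_power2)
  next
    case False
    let ?q = "Q n p"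
    have q: "?q \<ge> 1" "?q > 0" using False m by auto
    have aq: "?a \<le> ?q" using S_nonneg[of p] b0 by (simp add: Q_def)
    have "1 \<le> ?q powr \<alpha>" using q \<alpha> by (intro ge_one_powr_ge_zero) auto
    then have "C * (1 + ?q powr \<alpha>) \<le> C * (2 * ?q powr \<alpha>)" using C_pos by (intro mult_left_mono) auto
    then have gq: "\<bar>g n p\<bar> \<le> C * (2 * ?q powr \<alpha>)" using elim(1) by (simp add: Q_def)
    have "\<bar>g n p\<bar> * ?a \<le> C * (2 * ?q powr \<alpha>) * ?q"
      using gq aq a0 C_pos by (intro mult_mono) auto
    also have "\<dots> = 2 * C * (?q powr \<alpha> * ?q)" by simp
    also have "?q powr \<alpha> * ?q = ?q powr (\<alpha> - 1) * ?q\<^sup>2"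
    proof -
      have "?q powr \<alpha> * ?q = ?q powr (\<alpha> + 1)"         by (subst powr_add) (use q in simp)
      also have "\<dots> = ?q powr ((\<alpha> - 1) + 2)" by (simp add: add.commute)
      also have "\<dots> = ?q powr (\<alpha> - 1) * ?q\<^sup>2" using q by (simp only: powr_add powr_numeral)
      finally show ?thesis .
    qed
    also have "2 * C * (?q powr (\<alpha> - 1) * ?q\<^sup>2) \<le> 2 * C * (real m powr (\<alpha> - 1) * ?q\<^sup>2)"
    proof -
      have "?q powr (\<alpha> - 1) \<le> real m powr (\<alpha> - 1)"
        using False m \<alpha> by (intro powr_mono2') auto
      then show ?thesis using C_pos by (intro mult_left_mono mult_right_mono) auto
    qed
    finally have "\<bar>g n p\<bar> * ?a \<le> 2 * C * (real m powr (\<alpha> - 1) * ?q\<^sup>2)" .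
    then have "2 * (\<bar>g n p\<bar> * ?a) \<le> 2 * (2 * C * (real m powr (\<alpha> - 1) * ?q\<^sup>2))"
      by (rule mult_left_mono) simp
    also have "\<dots> = 4 * C * real m powr (\<alpha> - 1) * ?q\<^sup>2" by simp
    finally have "2 * (\<bar>g n p\<bar> * ?a) \<le> 4 * C * real m powr (\<alpha> - 1) * ?q\<^sup>2" .
    moreover have "0 \<le> w m n p + (1 + 2 * ?l + 2 * ?l\<^sup>2) * ?a\<^sup>2 + ?b\<^sup>2 / 2"
      using w_nonneg[of m n p] l by (intro add_nonneg_nonneg mult_nonneg_nonneg) auto
    ultimately show ?thesis by linarith
  qed
qed

lemma Lip_exp_bound:
  assumes m: "m \<ge> 1"
  shows "exp (2 * (1 + 2 * Lip m + 2 * (Lip m)\<^sup>2) * \<delta>) \<le> exp (2 * (2 + 6 * L\<^sup>2) * \<delta>) * real m powr ((1 - \<alpha>) / 2)"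
proof -
  let ?l = "Lip m" and ?r = "sqrt (ln (real m))"
  have r2: "?r\<^sup>2 = ln (real m)" "?r \<ge> 0" using m by auto
  have "?l\<^sup>2 \<le> (L + ?r)\<^sup>2" using Lip_le[OF m] Lip_pos[OF m] by (intro power_mono) auto
  also have "\<dots> \<le> 2 * L\<^sup>2 + 2 * ?r\<^sup>2" using sum_squares_bound[of L ?r] by (simp add: power2_sum)
  finally have l2: "?l\<^sup>2 \<le> 2 * L\<^sup>2 + 2 * ln (real m)" using r2 by simp
  \<comment> \<open>From \<open>2 * l \<le> 1 + l^2\<close> the left side is at most
    \<open>2 + 3 * l^2\<close>; inserting the bound for \<open>l^2\<close> gives the constants
    6.\<close>
  have "1 + 2 * ?l + 2 * ?l\<^sup>2 \<le> (2 + 6 * L\<^sup>2) + 6 * ln (real m)"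
    using sum_squares_bound[of 1 ?l] l2 by simp
  then have "2 * (1 + 2 * ?l + 2 * ?l\<^sup>2) * \<delta> \<le> 2 * ((2 + 6 * L\<^sup>2) + 6 * ln (real m)) * \<delta>"
    using \<delta>_pos by (intro mult_right_mono mult_left_mono) auto
  also have "\<dots> = 2 * (2 + 6 * L\<^sup>2) * \<delta> + ((1 - \<alpha>) / 2) * ln (real m)"
    by (simp add: \<delta>_def field_simps)
  finally have "exp (2 * (1 + 2 * ?l + 2 * ?l\<^sup>2) * \<delta>) \<le> exp (2 * (2 + 6 * L\<^sup>2) * \<delta> + ((1 - \<alpha>) / 2) * ln (real m))"
    by simp
  also have "\<dots> = exp (2 * (2 + 6 * L\<^sup>2) * \<delta>) * real m powr ((1 - \<alpha>) / 2)"
    using m by (simp add: exp_add powr_def)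
  finally show ?thesis .
qed

text \<open>The order of choices matters: \<open>m\<close> makes the complement, amplified by the
  Gronwall factor, smaller than \<open>r / 2\<close>; with \<open>m\<close> fixed, the terminal
  values, the tail and the generator distance vanish as \<open>n\<close> grows.\<close>

lemma step_bound:
  assumes \<sigma>: "t \<le> \<sigma>" "\<sigma> \<le> \<tau>" "\<tau> \<le> T" "\<tau> - \<sigma> \<le> \<delta>"
    and conv: "(\<lambda>n. \<integral>p. indicator {\<tau>..T} (fst p) * (a n p)\<^sup>2 \<partial>N) \<longlonglongrightarrow> 0"
    and r: "0 < r"
  shows "\<forall>\<^sub>F n in sequentially. \<forall>s\<in>{\<sigma>..\<tau>}. y n s + B n s / 2 \<le> r"
proof -
  obtain V where V0: "0 \<le> V" and QV: "\<And>n. (\<integral>p. (Q n p)\<^sup>2 \<partial>N) \<le> V" using Q_bounded by blast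
  define c1 where "c1 = exp (2 * (2 + 6 * L\<^sup>2) * \<delta>)"
  define tail where "tail n = 2 * GA n \<tau>" for n
  \<comment> \<open>Everything that the Gronwall factor multiplies: three quantities vanishing in
    \<open>n\<close> for fixed \<open>m\<close>, and the complement, controlled by the uniform bound
    \<open>V\<close>.\<close>
  define A where "A m n = \<bar>e n\<bar> + tail n + (\<integral>p. w m n p \<partial>N) + 4 * C * real m powr (\<alpha> - 1) * V" for m n
  have tail0: "0 \<le> tail n" for n
    unfolding tail_def using a_nonneg by (intro mult_nonneg_nonneg integral_nonneg_AE) auto
  have A0: "0 \<le> A m n" for m n
    using tail0[of n] V0 C_pos w_nonneg by (simp add: A_def)
  have est: "y n s + B n s / 2 \<le> 2 * A m n * (c1 * real m powr ((1 - \<alpha>) / 2))"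
    if m: "m \<ge> 1" and s: "s \<in> {\<sigma>..\<tau>}" for m n s
  proof -
    let ?k = "1 + 2 * Lip m + 2 * (Lip m)\<^sup>2"
    have k0: "?k > 0" using Lip_pos[OF m] by (intro add_pos_nonneg) auto
    have "y n s + B n s / 2 \<le> 2 * A m n * exp (2 * ?k * (\<tau> - s))"
    proof (rule gronwall_step[OF \<sigma>(1,3) k0 A0 _ s])
      fix s assume s: "s \<in> {\<sigma>..\<tau>}"
      \<comment> \<open>The local estimate is applied up to \<open>\<tau>\<close> only. Beyond
        \<open>\<tau>\<close> the mixed term is kept as it is and counted in the tail, so no
        Gronwall factor accumulates from earlier steps.\<close>
      have split: "AE p in N. 2 * (indicator {s..T} (fst p) * (\<bar>g n p\<bar> * a n p))
        \<le> 2 * (indicator {\<tau>..T} (fst p) * (\<bar>g n p\<bar> * a n p)) + w m n p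
          + ?k * (indicator {s..\<tau>} (fst p) * (a n p)\<^sup>2) + (indicator {s..T} (fst p) * (b n p)\<^sup>2) / 2
          + 4 * C * real m powr (\<alpha> - 1) * (Q n p)\<^sup>2"
        using pointwise_split[OF m, of n]
      proof eventually_elim
        case (elim p)
        have nn: "0 \<le> w m n p" "0 \<le> 4 * C * real m powr (\<alpha> - 1) * (Q n p)\<^sup>2" "0 \<le> ?k * (a n p)\<^sup>2" "0 \<le> \<bar>g n p\<bar> * a n p"
          using w_nonneg C_pos k0 a_nonneg by auto
        consider "fst p \<in> {s..\<tau>}" | "fst p \<in> {s..T}" "fst p \<in> {\<tau>..T}" "fst p \<notin> {s..\<tau>}" | "fst p \<notin> {s..T}"
          using s \<sigma> by fastforce
        then show ?case
        proof cases
          case 1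
          moreover have "fst p \<in> {s..T}" using 1 \<sigma> by auto
          ultimately have i: "indicator {s..\<tau>} (fst p) = (1::real)" "indicator {s..T} (fst p) = (1::real)" by auto
          have "0 \<le> indicator {\<tau>..T} (fst p) * (\<bar>g n p\<bar> * a n p)" using nn by simp
          then show ?thesis using elim unfolding i by linarith
        next
          case 2
          then have i: "indicator {s..\<tau>} (fst p) = (0::real)" "indicator {s..T} (fst p) = (1::real)" "indicator {\<tau>..T} (fst p) = (1::real)" by auto
          show ?thesis using nn zero_le_power2[of "b n p"] unfolding i by linarith
        next
          case 3
          then have i: "indicator {s..T} (fst p) = (0::real)" by auto
          have "0 \<le> indicator {\<tau>..T} (fst p) * (\<bar>g n p\<bar> * a n p)" using nn by simp
          moreover have "0 \<le> ?k * (indicator {s..\<tau>} (fst p) * (a n p)\<^sup>2)" using k0 by simp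
          ultimately show ?thesis using nn unfolding i by linarith
        qed
      qed
      have ints: "integrable N (\<lambda>p. indicator {u..u'} (fst p) * (\<bar>g n p\<bar> * a n p))"
        "integrable N (\<lambda>p. indicator {u..u'} (fst p) * (a n p)\<^sup>2)"
        "integrable N (\<lambda>p. indicator {u..u'} (fst p) * (b n p)\<^sup>2)" for u u' :: real
        by (intro indicator_integrable ga_int a_L2 b_L2, simp)+
      have "2 * GA n s
        = (\<integral>p. 2 * (indicator {s..T} (fst p) * (\<bar>g n p\<bar> * a n p)) \<partial>N)" by simp
      also have "\<dots> \<le> (\<integral>p. 2 * (indicator {\<tau>..T} (fst p) * (\<bar>g n p\<bar> * a n p)) + w m n p
          + ?k * (indicator {s..\<tau>} (fst p) * (a n p)\<^sup>2) + (indicator {s..T} (fst p) * (b n p)\<^sup>2) / 2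
          + 4 * C * real m powr (\<alpha> - 1) * (Q n p)\<^sup>2 \<partial>N)"
        by (rule integral_mono_AE[OF _ _ split])
           (auto intro!: ints w_int Q_L2(1) Bochner_Integration.integrable_add integrable_mult_right integrable_divide)
      also have "\<dots> = tail n + (\<integral>p. w m n p \<partial>N) + ?k * A2 n s \<tau> + B n s / 2
          + 4 * C * real m powr (\<alpha> - 1) * (\<integral>p. (Q n p)\<^sup>2 \<partial>N)"
        using ints w_int[of m n] Q_L2(1)[of n] by (simp add: tail_def B_def)
      also have "\<dots> \<le> tail n + (\<integral>p. w m n p \<partial>N) + ?k * A2 n s \<tau> + B n s / 2
          + 4 * C * real m powr (\<alpha> - 1) * V"
        using QV[of n] C_pos by (intro add_left_mono mult_left_mono) auto
      finally show "2 * GA n s + e n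
         \<le> A m n + ?k * A2 n s \<tau> + B n s / 2"
        unfolding A_def using abs_ge_self[of "e n"] by linarith
    qed
    also have "\<dots> \<le> 2 * A m n * exp (2 * ?k * \<delta>)"
      using s \<sigma> k0 A0[of m n] by (intro mult_left_mono) auto
    also have "\<dots> \<le> 2 * A m n * (c1 * real m powr ((1 - \<alpha>) / 2))"
      unfolding c1_def using A0[of m n] by (intro mult_left_mono Lip_exp_bound m) auto
    finally show ?thesis .
  qed
  have "(\<lambda>m. real m powr (- ((1 - \<alpha>) / 2))) \<longlonglongrightarrow> 0"
    using \<alpha> by (intro tendsto_neg_powr filterlim_real_sequentially) auto
  then have "(\<lambda>m. 8 * c1 * C * V * real m powr (- ((1 - \<alpha>) / 2))) \<longlonglongrightarrow> 0"
    by (rule tendsto_mult_right_zero)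
  then have "\<forall>\<^sub>F m in sequentially. 8 * c1 * C * V * real m powr (- ((1 - \<alpha>) / 2)) < r / 2"
    using r by (intro order_tendstoD) auto
  with eventually_ge_at_top[of 1]
  have "\<forall>\<^sub>F m in sequentially. m \<ge> 1 \<and> 8 * c1 * C * V * real m powr (- ((1 - \<alpha>) / 2)) < r / 2"
    by eventually_elim simp
  then obtain m :: nat where m: "m \<ge> 1" "8 * c1 * C * V * real m powr (- ((1 - \<alpha>) / 2)) < r / 2"
    using eventually_happens'[OF sequentially_bot] by blast
  \<comment> \<open>With \<open>m\<close> fixed this is a constant, so it can be multiplied into the
    limits in \<open>n\<close>.\<close>
  define c2 where "c2 = 2 * c1 * real m powr ((1 - \<alpha>) / 2)"
  have "(\<lambda>n. c2 * (\<bar>e n\<bar> + tail n + (\<integral>p. w m n p \<partial>N))) \<longlonglongrightarrow> c2 * (0 + 2 * 0 + 0)"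
    unfolding tail_def using tail_lim[OF conv] w_lim[OF m(1)] e_lim
    by (intro tendsto_intros) (auto simp: tendsto_rabs_zero_iff)
  then have "\<forall>\<^sub>F n in sequentially. c2 * (\<bar>e n\<bar> + tail n + (\<integral>p. w m n p \<partial>N)) < r / 2"
    using r by (intro order_tendstoD) auto
  then show ?thesis
  proof eventually_elim
    case (elim n)
    have "real m powr (\<alpha> - 1) * real m powr ((1 - \<alpha>) / 2) = real m powr (- ((1 - \<alpha>) / 2))"
    proof -
      have "(\<alpha> - 1) + (1 - \<alpha>) / 2 = - ((1 - \<alpha>) / 2)" by (simp add: field_simps)
      then show ?thesis unfolding powr_add[symmetric] by (rule arg_cong)
    qed
    then have "2 * A m n * (c1 * real m powr ((1 - \<alpha>) / 2))
      = c2 * (\<bar>e n\<bar> + tail n + (\<integral>p. w m n p \<partial>N)) + 8 * c1 * C * V * real m powr (- ((1 - \<alpha>) / 2))"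
      unfolding A_def c2_def by (simp add: algebra_simps)
    also have "\<dots> \<le> r" using elim m(2) by simp
    finally show ?case using est[OF m(1)] by (meson order_trans)
  qed
qed

text \<open>The estimates at the times of \<open>[\<sigma>, \<tau>]\<close> are integrated and added
  to the known limit on \<open>[\<tau>, T]\<close>. For \<open>b\<close> no addition is necessary,
  because \<open>B n \<sigma>\<close> already reaches up to \<open>T\<close>.\<close>

lemma step:
  assumes \<sigma>: "t \<le> \<sigma>" "\<sigma> \<le> \<tau>" "\<tau> \<le> T" "\<tau> - \<sigma> \<le> \<delta>"
    and conv: "(\<lambda>n. \<integral>p. indicator {\<tau>..T} (fst p) * (a n p)\<^sup>2 \<partial>N) \<longlonglongrightarrow> 0"
  shows "(\<lambda>n. \<integral>p. indicator {\<sigma>..T} (fst p) * (a n p)\<^sup>2 \<partial>N) \<longlonglongrightarrow> 0" "(\<lambda>n. B n \<sigma>) \<longlonglongrightarrow> 0"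
proof -
  let ?a = "\<lambda>u n. \<integral>p. indicator {u..T} (fst p) * (a n p)\<^sup>2 \<partial>N"
  have a0: "0 \<le> ?a u n" for u n by (intro integral_nonneg_AE) auto
  have yi: "?a \<sigma> n \<le> r * \<delta> + ?a \<tau> n" if "\<forall>s\<in>{\<sigma>..\<tau>}. y n s + B n s / 2 \<le> r" and r: "r > 0" for n r
  proof -
    have yr: "y n s \<le> r" if "s \<in> {\<sigma>..\<tau>}" for s
      using \<open>\<forall>s\<in>{\<sigma>..\<tau>}. y n s + B n s / 2 \<le> r\<close> that B_nonneg[of n s] by fastforce
    have "?a \<sigma> n \<le> (\<integral>p. indicator {\<sigma>..\<tau>} (fst p) * (a n p)\<^sup>2 + indicator {\<tau>..T} (fst p) * (a n p)\<^sup>2 \<partial>N)"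
      by (intro integral_mono Bochner_Integration.integrable_add indicator_integrable a_L2) (auto simp: indicator_def)
    also have "\<dots> = (LINT r:{\<sigma>..\<tau>}|lborel. y n r) + ?a \<tau> n"
      using y_integral[OF \<sigma>(1,3), of n]
      by (subst Bochner_Integration.integral_add) (auto intro!: indicator_integrable a_L2)
    also have "(LINT r:{\<sigma>..\<tau>}|lborel. y n r) \<le> r * (\<tau> - \<sigma>)" using yr \<sigma> by (intro y_integral_le)
    also have "r * (\<tau> - \<sigma>) \<le> r * \<delta>" using r \<sigma> by (intro mult_left_mono) auto
    finally show ?thesis by simp
  qed
  show "(\<lambda>n. ?a \<sigma> n) \<longlonglongrightarrow> 0"
  proof (rule tendsto_0_le_eps)
    fix r :: real assume r: "r > 0"
    have "\<forall>\<^sub>F n in sequentially. ?a \<tau> n < r / 2" using conv r by (intro order_tendstoD) auto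
    \<comment> \<open>Dividing by \<open>\<delta>\<close> compensates the integration over an
      interval of length at most \<open>\<delta>\<close>.\<close>
    moreover have "\<forall>\<^sub>F n in sequentially. \<forall>s\<in>{\<sigma>..\<tau>}. y n s + B n s / 2 \<le> r / 2 / \<delta>"
      using r \<delta>_pos by (intro step_bound[OF \<sigma> conv]) auto
    ultimately show "\<forall>\<^sub>F n in sequentially. ?a \<sigma> n \<le> r"
    proof eventually_elim
      case (elim n)
      have "?a \<sigma> n \<le> r / 2 / \<delta> * \<delta> + ?a \<tau> n" using elim r \<delta>_pos by (intro yi) auto
      then show ?case using elim \<delta>_pos by simp
    qed
  qed (rule a0)
  show "(\<lambda>n. B n \<sigma>) \<longlonglongrightarrow> 0"
  proof (rule tendsto_0_le_eps)
    fix r :: real assume r: "r > 0"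
    have "\<forall>\<^sub>F n in sequentially. \<forall>s\<in>{\<sigma>..\<tau>}. y n s + B n s / 2 \<le> r / 2"
      using r by (intro step_bound[OF \<sigma> conv]) auto
    then show "\<forall>\<^sub>F n in sequentially. B n \<sigma> \<le> r"
    proof eventually_elim
      case (elim n)
      then have "y n \<sigma> + B n \<sigma> / 2 \<le> r / 2" using \<sigma> by simp
      then show ?case using y_nonneg[of n \<sigma>] by simp
    qed
  qed (rule B_nonneg)
qed

theorem convergence: "(\<lambda>n. \<integral>p. (a n p)\<^sup>2 \<partial>N) \<longlonglongrightarrow> 0" "(\<lambda>n. \<integral>p. (b n p)\<^sup>2 \<partial>N) \<longlonglongrightarrow> 0"
proof -
  \<comment> \<open>Backward time points with spacing at most \<open>\<delta>\<close>, clipped at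
    \<open>t\<close> and therefore equal to \<open>t\<close> after finitely many steps.\<close>
  define u where "u k = max t (T - real k * \<delta>)" for k :: nat
  have u: "t \<le> u k" "u k \<le> T" "u (Suc k) \<le> u k" "u k - u (Suc k) \<le> \<delta>" for k
    using t_less_T \<delta>_pos by (auto simp: u_def algebra_simps max_def)
  have A: "(\<lambda>n. \<integral>p. indicator {u k..T} (fst p) * (a n p)\<^sup>2 \<partial>N) \<longlonglongrightarrow> 0" for k
  proof (induction k)
    case 0
    have "A2 n T T = 0" for n
      using t_less_T by (subst y_integral) (auto simp: set_lebesgue_integral_def intro!: integral_eq_zero_AE eventually_mono[OF AE_lborel_singleton[of T]])
    moreover have "u 0 = T" using t_less_T by (simp add: u_def)
    ultimately show ?case by simp
  next
    case (Suc k)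
    show ?case by (rule step(1)[OF u(1) u(3) u(2) u(4) Suc])
  qed
  obtain k :: nat where "(T - t) / \<delta> \<le> real k" using real_arch_simple by blast
  then have "T - t \<le> real k * \<delta>" using \<delta>_pos by (simp add: divide_le_eq)
  then have k: "u k = t" by (simp add: u_def max_def)
  have ind: "(\<integral>p. f p \<partial>N) = (\<integral>p. indicator {t..T} (fst p) * f p \<partial>N)" for f :: "_ \<Rightarrow> real"
    by (intro Bochner_Integration.integral_cong) (auto simp: space_N)
  show "(\<lambda>n. \<integral>p. (a n p)\<^sup>2 \<partial>N) \<longlonglongrightarrow> 0" using A[of k] unfolding k ind[of "\<lambda>p. (a _ p)\<^sup>2"] .
  \<comment> \<open>A degenerate step from \<open>t\<close> to \<open>t\<close> extracts the limit
    of the \<open>b\<close> part from that of the \<open>a\<close> part.\<close>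
  have "(\<lambda>n. B n t) \<longlonglongrightarrow> 0"
    using t_less_T \<delta>_pos A[of k] by (intro step(2)[of t t]) (auto simp: k)
  then show "(\<lambda>n. \<integral>p. (b n p)\<^sup>2 \<partial>N) \<longlonglongrightarrow> 0" unfolding B_def ind[of "\<lambda>p. (b _ p)\<^sup>2"] .
qed

end

section \<open>Perturbed backward equations\<close>

context jump_process
begin

section \<open>Differences of fields, integrals and solutions\<close>

lemma AE_N_section:
  assumes "AE p in N. Q p" shows "AE \<omega> in M. AE r in LT. Q (r, \<omega>)"
proof -
  from AE_E[OF assms] obtain A where A': "{p\<in>space N. \<not> Q p} \<subseteq> A" "emeasure N A = 0" "A \<in> sets N" .
  then have A: "{p\<in>space N. \<not> Q p} \<subseteq> A" "A \<in> null_sets N" by (auto intro: null_setsI)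
  have m: "(indicator A :: _ \<Rightarrow> ennreal) \<in> borel_measurable N" using A(2) by auto
  have "(\<integral>\<^sup>+\<omega>. (\<integral>\<^sup>+r. indicator A (r, \<omega>) \<partial>LT) \<partial>M) = 0"
    using N.nn_integral_snd[OF m] A(2) null_setsD2[OF A(2)] by (simp add: nn_integral_indicator null_setsD1)
  moreover have "(\<lambda>\<omega>. \<integral>\<^sup>+r. indicator A (r, \<omega>) \<partial>LT) \<in> borel_measurable M"
  proof -
    have "(\<lambda>(\<omega>, r). indicator A (r, \<omega>) :: ennreal) \<in> borel_measurable (M \<Otimes>\<^sub>M LT)"
      using measurable_compose[OF measurable_pair_swap' m] by (simp add: case_prod_beta')
    then show ?thesis by (rule LT.borel_measurable_nn_integral)
  qed
  ultimately have "AE \<omega> in M. (\<integral>\<^sup>+r. indicator A (r, \<omega>) \<partial>LT) = 0"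
    by (simp add: nn_integral_0_iff_AE)
  with AE_space show ?thesis
  proof eventually_elim
    case (elim \<omega>)
    have "(\<lambda>r. indicator A (r, \<omega>) :: ennreal) \<in> borel_measurable LT"
      using measurable_compose[OF measurable_Pair2'[of \<omega> M LT] m] elim by simp
    then have "AE r in LT. (indicator A (r, \<omega>) :: ennreal) = 0"
      using elim by (simp add: nn_integral_0_iff_AE)
    with AE_space show ?case
    proof eventually_elim
      case (elim r)
      then have "(r, \<omega>) \<in> space N" "(r, \<omega>) \<notin> A"
        using \<open>\<omega> \<in> space M\<close> by (auto simp: space_N indicator_def split: if_splits)
      then show ?case using A(1) by blast
    qed
  qed
qed

lemma L2_norm_eq:
  assumes Z: "measurable_field Z" and r: "r \<in> {t..T}" and \<omega>: "\<omega> \<in> \<Omega>"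
  shows "L2_norm (v r (X r \<omega>)) (Z r \<omega>) = sqrt (enn2real (nsq Z r \<omega>))"
    and "Z r \<omega> \<in> L2 (v r (X r \<omega>)) \<longleftrightarrow> nsq Z r \<omega> < \<infinity>"
proof -
  note [measurable] = field_v_measurable[OF Z r \<omega>]
  show "L2_norm (v r (X r \<omega>)) (Z r \<omega>) = sqrt (enn2real (nsq Z r \<omega>))"
    unfolding L2_norm_def nsq_def by (subst integral_eq_nn_integral) auto
  show "Z r \<omega> \<in> L2 (v r (X r \<omega>)) \<longleftrightarrow> nsq Z r \<omega> < \<infinity>"
    by (auto simp: L2_def nsq_def integrable_iff_bounded)
qed

lemma nsq_diff_le:
  assumes Z: "measurable_field Z"
    and Z': "measurable_field Z'"
    and r: "r \<in> {t..T}" and \<omega>: "\<omega> \<in> \<Omega>"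
  shows "nsq (\<lambda>r \<omega> y. Z r \<omega> y - Z' r \<omega> y) r \<omega> \<le> 2 * nsq Z r \<omega> + 2 * nsq Z' r \<omega>"
proof -
  note [measurable] = field_v_measurable[OF Z r \<omega>] field_v_measurable[OF Z' r \<omega>]
  have "nsq (\<lambda>r \<omega> y. Z r \<omega> y - Z' r \<omega> y) r \<omega>
    \<le> (\<integral>\<^sup>+y. 2 * ennreal ((Z r \<omega> y)\<^sup>2) + 2 * ennreal ((Z' r \<omega> y)\<^sup>2) \<partial>v r (X r \<omega>))"
    unfolding nsq_def
  proof (rule nn_integral_mono)
    fix y
    have "ennreal ((Z r \<omega> y - Z' r \<omega> y)\<^sup>2) \<le> ennreal (2 * (Z r \<omega> y)\<^sup>2 + 2 * (Z' r \<omega> y)\<^sup>2)"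
      by (rule ennreal_leI[OF square_diff_le])
    then show "ennreal ((Z r \<omega> y - Z' r \<omega> y)\<^sup>2) \<le> 2 * ennreal ((Z r \<omega> y)\<^sup>2) + 2 * ennreal ((Z' r \<omega> y)\<^sup>2)"
      by (simp add: ennreal_mult)
  qed
  also have "\<dots> = 2 * nsq Z r \<omega> + 2 * nsq Z' r \<omega>"
    unfolding nsq_def by (subst nn_integral_add) (auto simp: nn_integral_cmult)
  finally show ?thesis .
qed

lemma field_diff_measurable:
  assumes "(\<lambda>((r, \<omega>), y). Z r \<omega> y) \<in> borel_measurable B" "(\<lambda>((r, \<omega>), y). Z' r \<omega> y) \<in> borel_measurable B"
  shows "(\<lambda>((r, \<omega>), y). Z r \<omega> y - Z' r \<omega> y :: real) \<in> borel_measurable B"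
  using borel_measurable_diff[OF assms] by (simp add: case_prod_beta')

lemma L2_field_diff:
  assumes Z: "L2_field Z" and Z': "L2_field Z'"
  shows "L2_field (\<lambda>r \<omega> y. Z r \<omega> y - Z' r \<omega> y)"
proof -
  note D = L2_fieldD[OF Z] and D' = L2_fieldD[OF Z']
  let ?d = "\<lambda>r \<omega> y. Z r \<omega> y - Z' r \<omega> y"
  have m: "measurable_field ?d"
    by (rule field_diff_measurable[OF D(1) D'(1)])
  have p: "predictable_field E F t T ?d"
    using Z Z' unfolding L2_field_def predictable_field_def by (intro field_diff_measurable) auto
  have "Z_norm_sq M X v t T ?d = (\<integral>\<^sup>+p. indicator {t..T} (fst p) * nsq ?d (fst p) (snd p) \<partial>N)"
    using t_less_T by (intro Z_norm_sq_eq m) auto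
  also have "\<dots> \<le> (\<integral>\<^sup>+p. 2 * nsq Z (fst p) (snd p) + 2 * nsq Z' (fst p) (snd p) \<partial>N)"
    by (intro nn_integral_mono) (auto simp: space_N intro!: nsq_diff_le D(1) D'(1))
  also have "\<dots> = 2 * (\<integral>\<^sup>+p. nsq Z (fst p) (snd p) \<partial>N) + 2 * (\<integral>\<^sup>+p. nsq Z' (fst p) (snd p) \<partial>N)"
    using D(2) D'(2) by (simp add: nn_integral_add nn_integral_cmult)
  also have "\<dots> < \<infinity>" using D(3) D'(3) by (simp add: ennreal_mult_less_top)
  finally show ?thesis using p by (simp add: L2_field_def)
qed

text \<open>Jump sums are finite and thus linear on every path. Linearity of the compensator part
  needs integrable rates, which holds off a null set; hence the identity is only almost
  sure.\<close>

lemma q_integral_diff: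
  assumes Z: "L2_field Z" and Z': "L2_field Z'" and s: "s \<in> {t..T}"
  shows "AE \<omega> in M. q_integral E X v t s T (\<lambda>r \<omega> y. Z r \<omega> y - Z' r \<omega> y) \<omega>
    = q_integral E X v t s T Z \<omega> - q_integral E X v t s T Z' \<omega>"
proof -
  note D = L2_fieldD[OF Z] and D' = L2_fieldD[OF Z']
  let ?d = "\<lambda>r \<omega> y. Z r \<omega> y - Z' r \<omega> y"
  note Dd = L2_fieldD[OF L2_field_diff[OF Z Z']]
  have "AE p in N. rate_int ?d (fst p) (snd p) = rate_int Z (fst p) (snd p) - rate_int Z' (fst p) (snd p)"
    using D(4) D'(4) AE_space
  proof eventually_elim
    case (elim p)
    then have "fst p \<in> {t..T}" "snd p \<in> \<Omega>" by (auto simp: space_N)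
    then show ?case
      unfolding rate_int_def
      using nsq_finite_integrable(2)[OF D(1) _ _ elim(1)] nsq_finite_integrable(2)[OF D'(1) _ _ elim(2)] by simp
  qed
  then have ae: "AE \<omega> in M. AE r in LT. rate_int ?d r \<omega> = rate_int Z r \<omega> - rate_int Z' r \<omega>"
    using AE_N_section by fastforce
  have i: "AE \<omega> in M. integrable LT (\<lambda>r. rate_int U r \<omega>)" if "L2_field U" for U
    by (rule Bochner_snd(3)[OF N.integral_power2_le(1)[OF rate_int_L2(1,2)[OF that]]])
  show ?thesis
    using ae i[OF Z] i[OF Z'] AE_space
  proof eventually_elim
    case (elim \<omega>)
    then have \<omega>: "\<omega> \<in> \<Omega>" by simp
    have ii: "integrable LT (\<lambda>r. indicator {s<..T} r * h r)" if "integrable LT h" for h :: "real \<Rightarrow> real"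
      using that s by (intro integrable_mult_indicator[where 'b=real, simplified] LT_sets) auto
    have mm: "(\<lambda>r. rate_int ?d r \<omega>) \<in> borel_measurable LT"
      using measurable_compose[OF measurable_Pair2'[of \<omega> M LT] rate_int_L2(1)[OF L2_field_diff[OF Z Z']]] \<omega> by simp
    have ind: "(\<lambda>r. indicator {s<..T} r :: real) \<in> borel_measurable LT"
      by (rule measurable_restrict_space1) simp
    have "comp_int ?d s \<omega> = (\<integral>r. indicator {s<..T} r * rate_int Z r \<omega> - indicator {s<..T} r * rate_int Z' r \<omega> \<partial>LT)"
      unfolding comp_int_def
      by (intro integral_cong_AE borel_measurable_times mm ind borel_measurable_diff
          borel_measurable_integrable[OF elim(2)] borel_measurable_integrable[OF elim(3)])
         (use elim(1) in \<open>auto simp: right_diff_distrib elim!: eventually_mono\<close>)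
    also have "\<dots> = comp_int Z s \<omega> - comp_int Z' s \<omega>"
      unfolding comp_int_def using ii[OF elim(2)] ii[OF elim(3)] by simp
    finally have "comp_int ?d s \<omega> = comp_int Z s \<omega> - comp_int Z' s \<omega>" .
    moreover have "jump_sum ?d s \<omega> = jump_sum Z s \<omega> - jump_sum Z' s \<omega>"
      by (simp add: jump_sum_def sum_subtractf)
    ultimately show ?case
      using q_integral_eq[OF D(1) \<omega> s] q_integral_eq[OF D'(1) \<omega> s] q_integral_eq[OF Dd(1) \<omega> s] by simp
  qed
qed

lemma progressive_diff:
  assumes "progressive F t T Y" "progressive F t T Y'"
  shows "progressive F t T (\<lambda>s \<omega>. Y s \<omega> - Y' s \<omega>)"
  unfolding progressive_def
proof
  fix s assume "s \<in> {t..T}"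
  then have "(\<lambda>(r, \<omega>). Y r \<omega>) \<in> borel_measurable (restrict_space borel {t..s} \<Otimes>\<^sub>M F s)"
    "(\<lambda>(r, \<omega>). Y' r \<omega>) \<in> borel_measurable (restrict_space borel {t..s} \<Otimes>\<^sub>M F s)"
    using assms by (auto simp: progressive_def)
  from borel_measurable_diff[OF this]
  show "(\<lambda>(r, \<omega>). Y r \<omega> - Y' r \<omega>) \<in> borel_measurable (restrict_space borel {t..s} \<Otimes>\<^sub>M F s)"
    by (simp add: case_prod_beta')
qed

lemma in_B_D:
  assumes "in_B M F E X v t T Y Z"
  shows "progressive F t T Y" "L2_field Z" "integrable N (\<lambda>p. (Y (fst p) (snd p))\<^sup>2)" "Y_norm_sq M t T Y < \<infinity>"
proof -
  show p: "progressive F t T Y" and "L2_field Z" and n: "Y_norm_sq M t T Y < \<infinity>"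
    using assms by (auto simp: in_B_def L2_field_def)
  note YN = progressive_N[OF p]
  have "(\<integral>\<^sup>+p. ennreal ((Y (fst p) (snd p))\<^sup>2) \<partial>N) = Y_norm_sq M t T Y"
    using t_less_T by (subst Y_norm_sq_eq[OF YN]) (auto intro!: nn_integral_cong simp: space_N)
  then show "integrable N (\<lambda>p. (Y (fst p) (snd p))\<^sup>2)" using n YN by (intro integrableI_nonneg) auto
qed

end

section \<open>Reduction of the perturbed equations to the abstract estimate\<close>

locale bsde_perturbation = jump_process +
  fixes f :: "'b gen" and \<xi> :: "'a \<Rightarrow> real" and fn :: "nat \<Rightarrow> 'b gen" and \<xi>n :: "nat \<Rightarrow> 'a \<Rightarrow> real"
    and lam lam' \<alpha> L :: real and Lip :: "nat \<Rightarrow> real"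
    and Y :: "real \<Rightarrow> 'a \<Rightarrow> real" and Z :: "real \<Rightarrow> 'a \<Rightarrow> 'b \<Rightarrow> real"
    and Yn :: "nat \<Rightarrow> real \<Rightarrow> 'a \<Rightarrow> real" and Zn :: "nat \<Rightarrow> real \<Rightarrow> 'a \<Rightarrow> 'b \<Rightarrow> real"
  assumes gen_f: "generator M F E X v t T f" and gen_fn: "\<And>n. generator M F E X v t T (fn n)"
    and \<xi>: "\<xi> \<in> borel_measurable M" "integrable M (\<lambda>\<omega>. (\<xi> \<omega>)\<^sup>2)"
    and \<xi>n: "\<And>n. \<xi>n n \<in> borel_measurable M" "\<And>n. integrable M (\<lambda>\<omega>. (\<xi>n n \<omega>)\<^sup>2)"
    and growth_f: "0 < lam" "0 < \<alpha>" "\<alpha> < 1"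
        "\<forall>s\<in>{0..T}. \<forall>u\<in>space E. \<forall>y. \<forall>z\<in>L2 (v s u).
           \<bar>f s u y z\<bar> \<le> lam * (1 + \<bar>y\<bar> powr \<alpha> + L2_norm (v s u) z powr \<alpha>)"
    and lipschitz_f: "\<forall>m\<ge>1. 0 < Lip m"
        "\<forall>m\<ge>1. AE \<omega> in M. \<forall>s\<in>{t..T}. \<forall>y y'. \<forall>z\<in>L2 (v s (X s \<omega>)). \<forall>z'\<in>L2 (v s (X s \<omega>)).
           \<bar>y\<bar> < real m \<and> \<bar>y'\<bar> < real m \<and>
           L2_norm (v s (X s \<omega>)) z < real m \<and> L2_norm (v s (X s \<omega>)) z' < real m \<longrightarrow>
           \<bar>f s (X s \<omega>) y z - f s (X s \<omega>) y' z'\<bar>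
             \<le> Lip m * (\<bar>y - y'\<bar> + L2_norm (v s (X s \<omega>)) (\<lambda>u. z u - z' u))"
        "0 < L" "\<forall>m\<ge>1. Lip m \<le> L + sqrt (ln (real m))"
    and Phi_lim: "\<forall>m\<ge>1. (\<lambda>n. Phi M X v t T (real m) (\<lambda>s u y z. fn n s u y z - f s u y z)) \<longlonglongrightarrow> 0"
    and \<xi>_lim: "(\<lambda>n. \<integral>\<omega>. \<bar>\<xi>n n \<omega> - \<xi> \<omega>\<bar>\<^sup>2 \<partial>M) \<longlonglongrightarrow> 0"
    and growth_fn: "0 < lam'"
        "AE \<omega> in M. \<forall>s\<in>{t..T}. \<forall>y. \<forall>z\<in>L2 (v s (X s \<omega>)). \<forall>n.
           \<bar>fn n s (X s \<omega>) y z\<bar>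
             \<le> lam' * (1 + \<bar>y\<bar> powr \<alpha> + L2_norm (v s (X s \<omega>)) z powr \<alpha>)"
    and sol_n: "\<And>n. bsde_solution M F E X v t T (fn n) (\<xi>n n) (Yn n) (Zn n)"
    and sol: "bsde_solution M F E X v t T f \<xi> Y Z"
begin

abbreviation dY :: "nat \<Rightarrow> real \<Rightarrow> 'a \<Rightarrow> real" where "dY n r \<omega> \<equiv> Yn n r \<omega> - Y r \<omega>"
abbreviation dZ :: "nat \<Rightarrow> real \<Rightarrow> 'a \<Rightarrow> 'b \<Rightarrow> real" where "dZ n r \<omega> u \<equiv> Zn n r \<omega> u - Z r \<omega> u"

definition dg :: "nat \<Rightarrow> real \<Rightarrow> 'a \<Rightarrow> real" where
  "dg n r \<omega> = gen_process X v (fn n) (Yn n) (Zn n) r \<omega> - gen_process X v f Y Z r \<omega>"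

text \<open>Where \<open>nsq\<close> is infinite, \<open>enn2real\<close> returns 0; for fields of
  finite norm this concerns a null set.\<close>

definition znorm :: "(real \<Rightarrow> 'a \<Rightarrow> 'b \<Rightarrow> real) \<Rightarrow> real \<times> 'a \<Rightarrow> real" where
  "znorm U p = sqrt (enn2real (nsq U (fst p) (snd p)))"

text \<open>The factors 2 here and in \<open>Q\<close> come from bounding the norm of
  \<open>Zn n\<close> by \<open>2 * znorm (dZ n) p + 2 * znorm Z p\<close>. Only the limit solution
  enters, so \<open>S\<close> does not depend on \<open>n\<close>.\<close>

definition S :: "real \<times> 'a \<Rightarrow> real" where
  "S p = \<bar>Y (fst p) (snd p)\<bar> + 2 * znorm Z p"

definition Q :: "nat \<Rightarrow> real \<times> 'a \<Rightarrow> real" where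
  "Q n p = S p + \<bar>dY n (fst p) (snd p)\<bar> + 2 * znorm (dZ n) p"

lemma Y_facts: "progressive F t T Y" "L2_field Z" "integrable N (\<lambda>p. (Y (fst p) (snd p))\<^sup>2)" "Y_norm_sq M t T Y < \<infinity>"
  using in_B_D[of Y Z] sol by (auto simp: bsde_solution_def)

lemma Yn_facts: "progressive F t T (Yn n)" "L2_field (Zn n)" "integrable N (\<lambda>p. (Yn n (fst p) (snd p))\<^sup>2)" "Y_norm_sq M t T (Yn n) < \<infinity>"
  using in_B_D[of "Yn n" "Zn n"] sol_n[of n] by (auto simp: bsde_solution_def)

lemma dZ_field: "L2_field (dZ n)"
  by (rule L2_field_diff[OF Yn_facts(2) Y_facts(2)])

lemma dY_prog: "progressive F t T (dY n)"
  by (rule progressive_diff[OF Yn_facts(1) Y_facts(1)])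

lemma dg_prog: "progressive F t T (dg n)"
proof -
  have "progressive F t T (gen_process X v (fn n) (Yn n) (Zn n))" "progressive F t T (gen_process X v f Y Z)"
    using gen_f gen_fn[of n] Y_facts Yn_facts[of n] by (auto simp: generator_def L2_field_def)
  from progressive_diff[OF this] show ?thesis by (simp add: dg_def[abs_def])
qed

lemmas dY_N [measurable] = progressive_N[OF dY_prog]
lemmas dg_N [measurable] = progressive_N[OF dg_prog]
lemmas Y_N [measurable] = progressive_N[OF Y_facts(1)]

lemma znorm_facts:
  assumes "L2_field U"
  shows "znorm U \<in> borel_measurable N" "integrable N (\<lambda>p. (znorm U p)\<^sup>2)" "0 \<le> znorm U p"
    "(znorm U p)\<^sup>2 = enn2real (nsq U (fst p) (snd p))"
  using L2_fieldD(2,5)[OF assms] by (auto simp: znorm_def[abs_def])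

lemmas znorm_meas [measurable] = znorm_facts(1)[OF Y_facts(2)] znorm_facts(1)[OF dZ_field]

lemma S_facts: "S \<in> borel_measurable N" "0 \<le> S p" "integrable N (\<lambda>p. (S p)\<^sup>2)"
proof -
  show "S \<in> borel_measurable N" unfolding S_def[abs_def] by measurable
  show "0 \<le> S p" using znorm_facts(3)[OF Y_facts(2)] by (simp add: S_def)
  show "integrable N (\<lambda>p. (S p)\<^sup>2)"
    using integrable_square_sum3(1)[where B=N and ?u1.0="\<lambda>p. \<bar>Y (fst p) (snd p)\<bar>" and ?u2.0="\<lambda>_. 0" and ?u3.0="znorm Z"]
      Y_facts(3) znorm_facts[OF Y_facts(2)]
    by (simp add: S_def)
qed

lemma dY_L2: "integrable N (\<lambda>p. (dY n (fst p) (snd p))\<^sup>2)"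
proof (rule Bochner_Integration.integrable_bound)
  show "integrable N (\<lambda>p. 2 * (Yn n (fst p) (snd p))\<^sup>2 + 2 * (Y (fst p) (snd p))\<^sup>2)"
    using Y_facts(3) Yn_facts(3) by simp
qed (use square_diff_le in auto)

lemma Q_facts: "Q n \<in> borel_measurable N" "0 \<le> Q n p" "integrable N (\<lambda>p. (Q n p)\<^sup>2)"
proof -
  note S_facts(1)[measurable]
  show "Q n \<in> borel_measurable N" unfolding Q_def[abs_def] by measurable
  show "0 \<le> Q n p" using znorm_facts(3)[OF dZ_field] S_facts(2) by (simp add: Q_def)
  show "integrable N (\<lambda>p. (Q n p)\<^sup>2)"
    unfolding Q_def
    by (rule integrable_square_sum3(1)) (use S_facts dY_L2 znorm_facts[OF dZ_field] in auto)
qed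

text \<open>Off a null set both fields have sections in their \<open>L2\<close> spaces and the
  single variable \<open>Q\<close> dominates all four norms in question. Therefore
  \<open>Q < m\<close> places both solutions inside the region of the local hypotheses at
  once.\<close>

lemma AE_sections:
  "AE p in N. fst p \<in> {t..T} \<and> snd p \<in> \<Omega>
    \<and> Z (fst p) (snd p) \<in> L2 (v (fst p) (X (fst p) (snd p))) \<and> Zn n (fst p) (snd p) \<in> L2 (v (fst p) (X (fst p) (snd p)))
    \<and> L2_norm (v (fst p) (X (fst p) (snd p))) (Z (fst p) (snd p)) \<le> Q n p
    \<and> L2_norm (v (fst p) (X (fst p) (snd p))) (Zn n (fst p) (snd p)) \<le> Q n p
    \<and> L2_norm (v (fst p) (X (fst p) (snd p))) (dZ n (fst p) (snd p)) = znorm (dZ n) p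
    \<and> \<bar>Y (fst p) (snd p)\<bar> \<le> Q n p \<and> \<bar>Yn n (fst p) (snd p)\<bar> \<le> Q n p"
  using L2_fieldD(4)[OF Y_facts(2)] L2_fieldD(4)[OF Yn_facts(2)[of n]] L2_fieldD(4)[OF dZ_field[of n]] AE_space
proof eventually_elim
  case (elim p)
  let ?r = "fst p" and ?\<omega> = "snd p"
  have r: "?r \<in> {t..T}" and \<omega>: "?\<omega> \<in> \<Omega>" using elim(4) by (auto simp: space_N)
  note m = L2_fieldD(1)[OF Y_facts(2)] and mn = L2_fieldD(1)[OF Yn_facts(2)[of n]] and md = L2_fieldD(1)[OF dZ_field[of n]]
  have n0: "0 \<le> znorm Z p" "0 \<le> znorm (dZ n) p"
    using znorm_facts(3)[OF Y_facts(2)] znorm_facts(3)[OF dZ_field] by auto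
  have "nsq (Zn n) ?r ?\<omega> \<le> 2 * nsq (dZ n) ?r ?\<omega> + 2 * nsq Z ?r ?\<omega>"
  proof -
    \<comment> \<open>Reading \<open>Zn\<close> as \<open>dZ - (- Z)\<close> lets the estimate for
      differences apply.\<close>
    have "nsq (Zn n) ?r ?\<omega> = nsq (\<lambda>r \<omega> y. dZ n r \<omega> y - - Z r \<omega> y) ?r ?\<omega>" by simp
    also have "\<dots> \<le> 2 * nsq (dZ n) ?r ?\<omega> + 2 * nsq (\<lambda>r \<omega> y. - Z r \<omega> y) ?r ?\<omega>"
      using borel_measurable_uminus[OF m] by (intro nsq_diff_le md r \<omega>) (simp add: case_prod_beta')
    finally show ?thesis by (simp add: nsq_def)
  qed
  then have "enn2real (nsq (Zn n) ?r ?\<omega>) \<le> enn2real (2 * nsq (dZ n) ?r ?\<omega> + 2 * nsq Z ?r ?\<omega>)"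
    using elim by (intro enn2real_mono) (auto simp: ennreal_mult_less_top)
  also have "\<dots> = 2 * (znorm (dZ n) p)\<^sup>2 + 2 * (znorm Z p)\<^sup>2"
    using elim by (simp add: znorm_def enn2real_plus enn2real_mult ennreal_mult_less_top)
  also have "\<dots> \<le> (2 * znorm (dZ n) p + 2 * znorm Z p)\<^sup>2"
    using n0 mult_nonneg_nonneg[OF n0] by (simp add: power2_eq_square algebra_simps)
  finally have zn: "sqrt (enn2real (nsq (Zn n) ?r ?\<omega>)) \<le> 2 * znorm (dZ n) p + 2 * znorm Z p"
    using n0 by (intro real_le_lsqrt) auto
  have yn: "\<bar>Yn n ?r ?\<omega>\<bar> \<le> \<bar>Y ?r ?\<omega>\<bar> + \<bar>dY n ?r ?\<omega>\<bar>" by linarith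
  have norms: "L2_norm (v ?r (X ?r ?\<omega>)) (Z ?r ?\<omega>) = znorm Z p"
    "L2_norm (v ?r (X ?r ?\<omega>)) (dZ n ?r ?\<omega>) = znorm (dZ n) p"
    using L2_norm_eq(1)[OF m r \<omega>] L2_norm_eq(1)[OF md r \<omega>] by (auto simp: znorm_def)
  show ?case
    using r \<omega> elim(1,2) L2_norm_eq(2)[OF m r \<omega>] L2_norm_eq(2)[OF mn r \<omega>] zn n0 yn abs_ge_zero[of "Y ?r ?\<omega>"]
    unfolding norms L2_norm_eq(1)[OF mn r \<omega>] Q_def S_def by auto
qed

lemma AE_growth: "AE p in N. \<bar>dg n (fst p) (snd p)\<bar> \<le> 2 * (lam + lam') * (1 + Q n p powr \<alpha>)"
  using AE_sections[of n] AE_snd_N[OF growth_fn(2)]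
proof eventually_elim
  case (elim p)
  let ?v = "v (fst p) (X (fst p) (snd p))" and ?q = "Q n p powr \<alpha>"
  have q: "c powr \<alpha> \<le> ?q" if "0 \<le> c" "c \<le> Q n p" for c
    using that growth_f by (intro powr_mono2) auto
  have nn: "0 \<le> L2_norm ?v u" for u by (simp add: L2_norm_def)
  have "X (fst p) (snd p) \<in> space E" using elim(1) t_nonneg by (intro X_space) auto
  then have "\<bar>f (fst p) (X (fst p) (snd p)) (Y (fst p) (snd p)) (Z (fst p) (snd p))\<bar>
    \<le> lam * (1 + \<bar>Y (fst p) (snd p)\<bar> powr \<alpha> + L2_norm ?v (Z (fst p) (snd p)) powr \<alpha>)"
    using growth_f(4) elim(1) t_nonneg by auto
  also have "\<dots> \<le> lam * (1 + ?q + ?q)"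
    using elim(1) growth_f(1) nn by (intro mult_left_mono add_mono q) auto
  finally have 1: "\<bar>f (fst p) (X (fst p) (snd p)) (Y (fst p) (snd p)) (Z (fst p) (snd p))\<bar> \<le> lam * (1 + ?q + ?q)" .
  have "\<bar>fn n (fst p) (X (fst p) (snd p)) (Yn n (fst p) (snd p)) (Zn n (fst p) (snd p))\<bar>
    \<le> lam' * (1 + \<bar>Yn n (fst p) (snd p)\<bar> powr \<alpha> + L2_norm ?v (Zn n (fst p) (snd p)) powr \<alpha>)"
    using elim by blast
  also have "\<dots> \<le> lam' * (1 + ?q + ?q)"
    using elim(1) growth_fn(1) nn by (intro mult_left_mono add_mono q) auto
  finally have 2: "\<bar>fn n (fst p) (X (fst p) (snd p)) (Yn n (fst p) (snd p)) (Zn n (fst p) (snd p))\<bar> \<le> lam' * (1 + ?q + ?q)" .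
  have "\<bar>dg n (fst p) (snd p)\<bar> \<le> lam' * (1 + ?q + ?q) + lam * (1 + ?q + ?q)"
    using 1 2 elim(1) unfolding dg_def gen_process_def by auto
  also have "\<dots> = (lam + lam') * (1 + 2 * ?q)" by (simp add: algebra_simps)
  also have "\<dots> \<le> (lam + lam') * (2 * (1 + ?q))"
    using growth_f(1) growth_fn(1) by (intro mult_left_mono) auto
  also have "\<dots> = 2 * (lam + lam') * (1 + ?q)" by (simp add: algebra_simps)
  finally show ?case .
qed

lemma dg_L2: "integrable N (\<lambda>p. (dg n (fst p) (snd p))\<^sup>2)"
  by (rule N.sublinear_growth(1)[OF AE_growth _ growth_f(2,3) Q_facts(2,3) dg_N])
     (use growth_f(1) growth_fn(1) in simp)

lemma difference_bsde: "linear_bsde \<Omega> E X P v T t x M F (dY n) (dZ n) (dg n) (\<lambda>\<omega>. \<xi>n n \<omega> - \<xi> \<omega>)"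
proof unfold_locales
  show "progressive F t T (dY n)" by (rule dY_prog)
  show "L2_field (dZ n)" by (rule dZ_field)
  show "progressive F t T (dg n)" by (rule dg_prog)
  show "integrable N (\<lambda>p. (dg n (fst p) (snd p))\<^sup>2)" by (rule dg_L2)
  show "(\<lambda>\<omega>. \<xi>n n \<omega> - \<xi> \<omega>) \<in> borel_measurable M" using \<xi>(1) \<xi>n(1) by simp
  show "integrable M (\<lambda>\<omega>. (\<xi>n n \<omega> - \<xi> \<omega>)\<^sup>2)"
  proof (rule Bochner_Integration.integrable_bound)
    show "integrable M (\<lambda>\<omega>. 2 * (\<xi>n n \<omega>)\<^sup>2 + 2 * (\<xi> \<omega>)\<^sup>2)" using \<xi>(2) \<xi>n(2) by simp
  qed (use square_diff_le \<xi>(1) \<xi>n(1) in auto)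
  show "integrable N (\<lambda>p. (dY n (fst p) (snd p))\<^sup>2)" by (rule dY_L2)
  fix s assume s: "s \<in> {t..T}"
  have 1: "AE \<omega> in M. set_integrable lborel {t..T} (\<lambda>r. gen_process X v f Y Z r \<omega>)"
    "AE \<omega> in M. set_integrable lborel {t..T} (\<lambda>r. gen_process X v (fn n) (Yn n) (Zn n) r \<omega>)"
    "AE \<omega> in M. Y s \<omega> = \<xi> \<omega> + (LINT r:{s..T}|lborel. gen_process X v f Y Z r \<omega>) - q_integral E X v t s T Z \<omega>"
    "AE \<omega> in M. Yn n s \<omega> = \<xi>n n \<omega> + (LINT r:{s..T}|lborel. gen_process X v (fn n) (Yn n) (Zn n) r \<omega>)
      - q_integral E X v t s T (Zn n) \<omega>"
    using sol sol_n[of n] s unfolding bsde_solution_def by blast+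
  show "AE \<omega> in M. dY n s \<omega> = \<xi>n n \<omega> - \<xi> \<omega> + (LINT r:{s..T}|lborel. dg n r \<omega>) - q_integral E X v t s T (dZ n) \<omega>"
    using 1 q_integral_diff[OF Yn_facts(2)[of n] Y_facts(2) s]
  proof eventually_elim
    case (elim \<omega>)
    have sub: "{s..T} \<subseteq> {t..T}" using s by auto
    have "(LINT r:{s..T}|lborel. dg n r \<omega>)
      = (LINT r:{s..T}|lborel. gen_process X v (fn n) (Yn n) (Zn n) r \<omega>) - (LINT r:{s..T}|lborel. gen_process X v f Y Z r \<omega>)"
      unfolding dg_def
      by (rule set_integral_diff) (rule set_integrable_subset[OF elim(2) _ sub] set_integrable_subset[OF elim(1) _ sub], simp)+
    then show ?case using elim by simp
  qed
qed

section \<open>Measurable majorants of the local distance of the generators\<close>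

abbreviation gen_dist :: "nat \<Rightarrow> nat \<Rightarrow> ennreal" where
  "gen_dist m n \<equiv> Phi M X v t T (real m) (\<lambda>s u y z. fn n s u y z - f s u y z)"

text \<open>All requirements on a majorant are packed into one predicate so that a single choice
  over \<open>m\<close> and \<open>n\<close> provides the whole family. The function
  \<open>w\<close> stands for the squared distance of the generators on the ball of radius
  \<open>m\<close>.\<close>

definition local_bound :: "nat \<Rightarrow> nat \<Rightarrow> (real \<times> 'a \<Rightarrow> real) \<Rightarrow> bool" where
  "local_bound m n w \<longleftrightarrow> integrable N w \<and> (\<forall>p. 0 \<le> w p)
     \<and> (m \<ge> 1 \<longrightarrow> (AE p in N. Q n p < real m \<longrightarrow> \<bar>dg n (fst p) (snd p)\<bar>
           \<le> sqrt (w p) + Lip m * (\<bar>dY n (fst p) (snd p)\<bar> + znorm (dZ n) p)))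
     \<and> (gen_dist m n < \<infinity> \<longrightarrow> (\<integral>p. w p \<partial>N) \<le> (enn2real (gen_dist m n))\<^sup>2 + 1 / real (Suc n))"

lemma local_bound_exists: "\<exists>w. local_bound m n w"
proof -
  define \<phi> where "\<phi> = (\<lambda>(s, \<omega>). SUP (y, z)\<in>{(y, z). \<bar>y\<bar> \<le> real m \<and> z \<in> L2 (v s (X s \<omega>)) \<and> L2_norm (v s (X s \<omega>)) z \<le> real m}.
        ennreal (\<bar>fn n s (X s \<omega>) y z - f s (X s \<omega>) y z\<bar>\<^sup>2))"
  let ?P = "gen_dist m n"
  have P: "?P = ennreal_sqrt (upper_nn_integral N \<phi>)" by (simp add: Phi_def \<phi>_def)
  show ?thesis
  proof (cases "?P < \<infinity>")
    case False
    \<comment> \<open>The distance is finite for all but finitely many \<open>n\<close>, so any bound will do here.\<close>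
    have l: "0 \<le> Lip m * (\<bar>dY n (fst p) (snd p)\<bar> + znorm (dZ n) p)" if "m \<ge> 1" for p
    proof -
      have "0 < Lip m" using lipschitz_f(1) that by simp
      then show ?thesis using znorm_facts(3)[OF dZ_field] by (intro mult_nonneg_nonneg add_nonneg_nonneg) auto
    qed
    show ?thesis
      by (rule exI[of _ "\<lambda>p. (dg n (fst p) (snd p))\<^sup>2"]) (use dg_L2 l False in \<open>auto simp: local_bound_def\<close>)
  next
    case True
    then have U: "upper_nn_integral N \<phi> < \<infinity>" unfolding P ennreal_sqrt_less_top .
    obtain w where w: "w \<in> borel_measurable N" "\<And>p. p \<in> space N \<Longrightarrow> \<phi> p \<le> w p" "(\<integral>\<^sup>+p. w p \<partial>N) < \<infinity>"
      "enn2real (\<integral>\<^sup>+p. w p \<partial>N) \<le> enn2real (upper_nn_integral N \<phi>) + 1 / real (Suc n)"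
      by (rule upper_nn_integral_approx[OF U, of "1 / real (Suc n)"]) auto
    have wfin: "AE p in N. w p < \<infinity>" using nn_integral_PInf_AE[OF w(1)] w(3) by (auto simp: less_top)
    have nn: "(\<integral>\<^sup>+p. ennreal (enn2real (w p)) \<partial>N) = (\<integral>\<^sup>+p. w p \<partial>N)"
      by (intro nn_integral_cong_AE eventually_mono[OF wfin]) auto
    have wi: "integrable N (\<lambda>p. enn2real (w p))" using w(1,3) nn by (intro integrableI_nonneg) auto
    have "(\<integral>p. enn2real (w p) \<partial>N) \<le> (enn2real ?P)\<^sup>2 + 1 / real (Suc n)"
      using w nn by (simp add: integral_eq_nn_integral P enn2real_ennreal_sqrt[OF U])
    moreover have "AE p in N. Q n p < real m \<longrightarrow> \<bar>dg n (fst p) (snd p)\<bar>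
           \<le> sqrt (enn2real (w p)) + Lip m * (\<bar>dY n (fst p) (snd p)\<bar> + znorm (dZ n) p)" if m: "m \<ge> 1"
      using AE_sections[of n] AE_snd_N[OF lipschitz_f(2)[rule_format, OF m]] wfin AE_space
    proof eventually_elim
      case (elim p)
      show ?case
      proof
        assume q: "Q n p < real m"
        let ?r = "fst p" and ?x = "X (fst p) (snd p)" and ?y = "Y (fst p) (snd p)" and ?y' = "Yn n (fst p) (snd p)"
          and ?z = "Z (fst p) (snd p)" and ?z' = "Zn n (fst p) (snd p)"
        \<comment> \<open>Inserting \<open>f\<close> at the perturbed solution separates the two
          effects: the first bracket is controlled by the distance of the generators, the second by
          the local Lipschitz constant of \<open>f\<close>.\<close>
        have d: "dg n ?r (snd p) = (fn n ?r ?x ?y' ?z' - f ?r ?x ?y' ?z') + (f ?r ?x ?y' ?z' - f ?r ?x ?y ?z)"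
          using elim(1) by (simp add: dg_def gen_process_def)
        have "ennreal (\<bar>fn n ?r ?x ?y' ?z' - f ?r ?x ?y' ?z'\<bar>\<^sup>2) \<le> \<phi> (?r, snd p)"
          unfolding \<phi>_def prod.case using elim(1) q by (intro SUP_upper2[of "(?y', ?z')"]) auto
        also have "\<dots> \<le> w p" using w(2)[OF elim(4)] by simp
        also have "\<dots> = ennreal (enn2real (w p))" using elim(3) by simp
        finally have "\<bar>fn n ?r ?x ?y' ?z' - f ?r ?x ?y' ?z'\<bar>\<^sup>2 \<le> enn2real (w p)"
          by (subst (asm) ennreal_le_iff) auto
        then have 1: "\<bar>fn n ?r ?x ?y' ?z' - f ?r ?x ?y' ?z'\<bar> \<le> sqrt (enn2real (w p))"
          by (rule real_le_rsqrt)
        have "\<bar>f ?r ?x ?y' ?z' - f ?r ?x ?y ?z\<bar>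
          \<le> Lip m * (\<bar>?y' - ?y\<bar> + L2_norm (v ?r ?x) (\<lambda>u. ?z' u - ?z u))"
        proof -
          have "?r \<in> {t..T}" "?z \<in> L2 (v ?r ?x)" "?z' \<in> L2 (v ?r ?x)" using elim(1) by auto
          moreover have "\<bar>?y\<bar> < real m" "\<bar>?y'\<bar> < real m" "L2_norm (v ?r ?x) ?z < real m" "L2_norm (v ?r ?x) ?z' < real m"
            using elim(1) q by auto
          ultimately show ?thesis using elim(2) by blast
        qed
        also have "L2_norm (v ?r ?x) (\<lambda>u. ?z' u - ?z u) = znorm (dZ n) p" using elim(1) by simp
        finally show "\<bar>dg n ?r (snd p)\<bar> \<le> sqrt (enn2real (w p)) + Lip m * (\<bar>dY n ?r (snd p)\<bar> + znorm (dZ n) p)"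
          using 1 unfolding d by linarith
      qed
    qed
    ultimately show ?thesis
      unfolding local_bound_def using wi by (intro exI[of _ "\<lambda>p. enn2real (w p)"]) auto
  qed
qed

theorem perturbation_limit:
  assumes s: "s \<in> {t..T}"
  shows "(\<lambda>n. Y_norm_sq M s T (dY n) + Z_norm_sq M X v s T (dZ n)) \<longlonglongrightarrow> 0"
proof -
  have "\<forall>m n. \<exists>w. local_bound m n w" using local_bound_exists by blast
  then obtain w where lb: "\<And>m n. local_bound m n (w m n)" unfolding choice_iff by blast
  then have w: "\<And>m n. integrable N (w m n)" "\<And>m n p. 0 \<le> w m n p"
    "\<And>m n. m \<ge> 1 \<Longrightarrow> AE p in N. Q n p < real m \<longrightarrow> \<bar>dg n (fst p) (snd p)\<bar>
           \<le> sqrt (w m n p) + Lip m * (\<bar>dY n (fst p) (snd p)\<bar> + znorm (dZ n) p)"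
    "\<And>m n. gen_dist m n < \<infinity> \<Longrightarrow> (\<integral>p. w m n p \<partial>N) \<le> (enn2real (gen_dist m n))\<^sup>2 + 1 / real (Suc n)"
    unfolding local_bound_def by blast+
  have wlim: "(\<lambda>n. \<integral>p. w m n p \<partial>N) \<longlonglongrightarrow> 0" if m: "m \<ge> 1" for m
  proof -
    let ?P = "gen_dist m"
    have P: "?P \<longlonglongrightarrow> 0" using Phi_lim m by blast
    \<comment> \<open>Only for finite distance is the integral of the majorant controlled;
      convergence to 0 guarantees this from some index on.\<close>
    then have "\<forall>\<^sub>F n in sequentially. ?P n < \<infinity>" by (rule order_tendstoD) simp
    then have up: "\<forall>\<^sub>F n in sequentially. (\<integral>p. w m n p \<partial>N) \<le> (enn2real (?P n))\<^sup>2 + 1 / real (Suc n)"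
      by eventually_elim (rule w(4))
    have "(\<lambda>n. enn2real (?P n)) \<longlonglongrightarrow> 0" using P by (intro tendsto_enn2real) auto
    moreover have "(\<lambda>n. 1 / real (Suc n)) \<longlonglongrightarrow> 0" by real_asymp
    ultimately have "(\<lambda>n. (enn2real (?P n))\<^sup>2 + 1 / real (Suc n)) \<longlonglongrightarrow> 0\<^sup>2 + 0"
      by (intro tendsto_add tendsto_power)
    then show ?thesis
      by (intro tendsto_sandwich[OF _ up tendsto_const]) (auto intro!: always_eventually integral_nonneg_AE w(2))
  qed
  have elim_lim: "(\<lambda>n. \<integral>\<omega>. (\<xi>n n \<omega> - \<xi> \<omega>)\<^sup>2 \<partial>M) \<longlonglongrightarrow> 0" using \<xi>_lim by simp
  interpret ST: stability \<Omega> E X P v T t x M F "\<lambda>n p. \<bar>dY n (fst p) (snd p)\<bar>" "\<lambda>n. znorm (dZ n)"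
    "\<lambda>n p. dg n (fst p) (snd p)" S w "\<lambda>n. \<integral>\<omega>. (\<xi>n n \<omega> - \<xi> \<omega>)\<^sup>2 \<partial>M" "2 * (lam + lam')" L \<alpha> Lip
  proof unfold_locales
    fix n s assume s: "s \<in> {t..T}"
    interpret D: linear_bsde \<Omega> E X P v T t x M F "dY n" "dZ n" "dg n" "\<lambda>\<omega>. \<xi>n n \<omega> - \<xi> \<omega>"
      by (rule difference_bsde)
    have le: "(\<integral>p. indicator {s..T} (fst p) * (dg n (fst p) (snd p) * dY n (fst p) (snd p)) \<partial>N)
      \<le> (\<integral>p. indicator {s..T} (fst p) * (\<bar>dg n (fst p) (snd p)\<bar> * \<bar>dY n (fst p) (snd p)\<bar>) \<partial>N)"
    proof (rule integral_mono)
      show "integrable N (\<lambda>p. indicator {s..T} (fst p) * (dg n (fst p) (snd p) * dY n (fst p) (snd p)))"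
        by (intro indicator_integrable integrable_square_sum dg_L2 dY_L2 dg_N dY_N) simp
      show "integrable N (\<lambda>p. indicator {s..T} (fst p) * (\<bar>dg n (fst p) (snd p)\<bar> * \<bar>dY n (fst p) (snd p)\<bar>))"
        by (intro indicator_integrable integrable_square_sum) (use dg_L2 dY_L2 dg_N dY_N in auto)
      show "indicator {s..T} (fst p) * (dg n (fst p) (snd p) * dY n (fst p) (snd p))
        \<le> indicator {s..T} (fst p) * (\<bar>dg n (fst p) (snd p)\<bar> * \<bar>dY n (fst p) (snd p)\<bar>)" for p
        by (intro mult_left_mono) (auto simp: abs_mult[symmetric])
    qed
    show "(\<integral>\<omega>. \<bar>dY n (fst (s, \<omega>)) (snd (s, \<omega>))\<bar>\<^sup>2 \<partial>M) + (\<integral>p. indicator {s..T} (fst p) * (znorm (dZ n) p)\<^sup>2 \<partial>N)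
      \<le> (\<integral>\<omega>. (\<xi>n n \<omega> - \<xi> \<omega>)\<^sup>2 \<partial>M)
        + 2 * (\<integral>p. indicator {s..T} (fst p) * (\<bar>dg n (fst p) (snd p)\<bar> * \<bar>dY n (fst p) (snd p)\<bar>) \<partial>N)"
      using D.energy_inequality[OF s] le by (simp add: znorm_facts(4)[OF dZ_field])
  qed (use S_facts Q_facts dY_L2 znorm_facts[OF dZ_field] growth_f(1-3) growth_fn(1) lipschitz_f AE_growth
        w wlim elim_lim in \<open>auto simp: Q_def[symmetric]\<close>)
  \<comment> \<open>Restricting to \<open>[s, T]\<close> only decreases the norms, so the limits
    over all of \<open>[t, T]\<close> suffice for every \<open>s\<close>.\<close>
  have bound: "Y_norm_sq M s T (dY n) + Z_norm_sq M X v s T (dZ n)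
    \<le> ennreal ((\<integral>p. \<bar>dY n (fst p) (snd p)\<bar>\<^sup>2 \<partial>N) + (\<integral>p. (znorm (dZ n) p)\<^sup>2 \<partial>N))" for n
  proof -
    have "Y_norm_sq M s T (dY n) \<le> (\<integral>\<^sup>+p. ennreal ((dY n (fst p) (snd p))\<^sup>2) \<partial>N)"
      unfolding Y_norm_sq_eq[OF dY_N s] by (intro nn_integral_mono) (auto simp: indicator_def)
    also have "\<dots> = ennreal (\<integral>p. \<bar>dY n (fst p) (snd p)\<bar>\<^sup>2 \<partial>N)"
      using dY_L2[of n] by (simp add: nn_integral_eq_integral)
    finally have 1: "Y_norm_sq M s T (dY n) \<le> ennreal (\<integral>p. \<bar>dY n (fst p) (snd p)\<bar>\<^sup>2 \<partial>N)" .
    note D = L2_fieldD[OF dZ_field[of n]]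
    have "Z_norm_sq M X v s T (dZ n) = ennreal (\<integral>p. indicator {s..T} (fst p) * (znorm (dZ n) p)\<^sup>2 \<partial>N)"
      unfolding Z_norm_sq_eq[OF D(1) s] znorm_facts(4)[OF dZ_field] by (rule D(6)) simp
    also have "\<dots> \<le> ennreal (\<integral>p. (znorm (dZ n) p)\<^sup>2 \<partial>N)"
      by (intro ennreal_leI integral_indicator_le znorm_facts[OF dZ_field]) auto
    finally have 2: "Z_norm_sq M X v s T (dZ n) \<le> ennreal (\<integral>p. (znorm (dZ n) p)\<^sup>2 \<partial>N)" .
    show ?thesis using add_mono[OF 1 2] by simp
  qed
  have "(\<lambda>n. ennreal ((\<integral>p. \<bar>dY n (fst p) (snd p)\<bar>\<^sup>2 \<partial>N) + (\<integral>p. (znorm (dZ n) p)\<^sup>2 \<partial>N))) \<longlonglongrightarrow> ennreal (0 + 0)"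
    by (intro tendsto_ennrealI tendsto_add ST.convergence)
  then have lim: "(\<lambda>n. ennreal ((\<integral>p. \<bar>dY n (fst p) (snd p)\<bar>\<^sup>2 \<partial>N) + (\<integral>p. (znorm (dZ n) p)\<^sup>2 \<partial>N))) \<longlonglongrightarrow> 0"
    by simp
  show ?thesis
    by (rule tendsto_sandwich[OF _ _ tendsto_const lim]) (use bound in auto)
qed

end

theorem theorem3:
  fixes \<Omega> :: "'w set" and E :: "'g measure"
    and X :: "real \<Rightarrow> 'w \<Rightarrow> 'g" and P :: "real \<Rightarrow> 'g \<Rightarrow> 'w measure"
    and v :: "real \<Rightarrow> 'g \<Rightarrow> 'g measure"
    and T t :: real and x :: 'g
    and M :: "'w measure" and F :: "real \<Rightarrow> 'w measure"
    and f :: "'g gen" and h :: "'g \<Rightarrow> real" and \<xi> :: "'w \<Rightarrow> real"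
    and fn :: "nat \<Rightarrow> 'g gen" and \<xi>n :: "nat \<Rightarrow> 'w \<Rightarrow> real"
    and lam lam' \<alpha> L :: real and Lip :: "nat \<Rightarrow> real"
    and Y :: "real \<Rightarrow> 'w \<Rightarrow> real" and Z :: "real \<Rightarrow> 'w \<Rightarrow> 'g \<Rightarrow> real"
    and Yn :: "nat \<Rightarrow> real \<Rightarrow> 'w \<Rightarrow> real" and Zn :: "nat \<Rightarrow> real \<Rightarrow> 'w \<Rightarrow> 'g \<Rightarrow> real"
  assumes "0 < T" and "0 \<le> t" and "t < T"
    and "\<forall>u\<in>space E. {u} \<in> sets E"
    and "normal_jump_markov \<Omega> E X P"
    and "rate_measure E X P v T"
    and "x \<in> space E"
    and "M = completion (P t x)"
    and "F = completed_filtration E X (P t x) t"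
    and "generator M F E X v t T f"
    and "bounded_field_measurable E T f"
    and "h \<in> borel_measurable E"
    and "\<xi> = (\<lambda>\<omega>. h (X T \<omega>))"
    and "integrable M (\<lambda>\<omega>. (\<xi> \<omega>)\<^sup>2)"
    and H1: "AE (s, \<omega>) in restrict_space lborel {t..T} \<Otimes>\<^sub>M M.
           continuous_on_L2 (v s (X s \<omega>)) (f s (X s \<omega>))"
    and H2: "0 < lam" "0 < \<alpha>" "\<alpha> < 1"
        "\<forall>s\<in>{0..T}. \<forall>u\<in>space E. \<forall>y. \<forall>z\<in>L2 (v s u).
           \<bar>f s u y z\<bar> \<le> lam * (1 + \<bar>y\<bar> powr \<alpha> + L2_norm (v s u) z powr \<alpha>)"
    and H3: "\<forall>m\<ge>1. 0 < Lip m"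
        "\<forall>m\<ge>1. AE \<omega> in M. \<forall>s\<in>{t..T}. \<forall>y y'. \<forall>z\<in>L2 (v s (X s \<omega>)). \<forall>z'\<in>L2 (v s (X s \<omega>)).
           \<bar>y\<bar> < real m \<and> \<bar>y'\<bar> < real m \<and>
           L2_norm (v s (X s \<omega>)) z < real m \<and> L2_norm (v s (X s \<omega>)) z' < real m \<longrightarrow>
           \<bar>f s (X s \<omega>) y z - f s (X s \<omega>) y' z'\<bar>
             \<le> Lip m * (\<bar>y - y'\<bar> + L2_norm (v s (X s \<omega>)) (\<lambda>u. z u - z' u))"
        "0 < L" "\<forall>m\<ge>1. Lip m \<le> L + sqrt (ln (real m))"
    and "\<forall>n. generator M F E X v t T (fn n)"
    and "\<forall>n. \<xi>n n \<in> borel_measurable (F T) \<and> integrable M (\<lambda>\<omega>. (\<xi>n n \<omega>)\<^sup>2)"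
    and H4: "\<forall>m\<ge>1. (\<lambda>n. Phi M X v t T (real m) (\<lambda>s u y z. fn n s u y z - f s u y z)) \<longlonglongrightarrow> 0"
    and H5: "(\<lambda>n. \<integral>\<omega>. \<bar>\<xi>n n \<omega> - \<xi> \<omega>\<bar>\<^sup>2 \<partial>M) \<longlonglongrightarrow> 0"
    and H6: "0 < lam'"
        "AE \<omega> in M. \<forall>s\<in>{t..T}. \<forall>y. \<forall>z\<in>L2 (v s (X s \<omega>)). \<forall>n.
           \<bar>fn n s (X s \<omega>) y z\<bar>
             \<le> lam' * (1 + \<bar>y\<bar> powr \<alpha> + L2_norm (v s (X s \<omega>)) z powr \<alpha>)"
    and "\<forall>n. bsde_solution M F E X v t T (fn n) (\<xi>n n) (Yn n) (Zn n)"
    and "bsde_solution M F E X v t T f \<xi> Y Z"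
  shows "\<forall>s\<in>{t..T}.
    (\<lambda>n. Y_norm_sq M s T (\<lambda>r \<omega>. Yn n r \<omega> - Y r \<omega>)
       + Z_norm_sq M X v s T (\<lambda>r \<omega> y. Zn n r \<omega> y - Z r \<omega> y)) \<longlonglongrightarrow> 0"
proof -
  interpret jump_process \<Omega> E X P v T t x M F
    by unfold_locales fact+
  have \<xi>_meas: "\<xi> \<in> borel_measurable M"
    unfolding \<open>\<xi> = (\<lambda>\<omega>. h (X T \<omega>))\<close>
    by (rule measurable_compose[OF measurable_X \<open>h \<in> borel_measurable E\<close>]) (use \<open>t < T\<close> in simp)
  have \<xi>n: "\<xi>n n \<in> borel_measurable M" "integrable M (\<lambda>\<omega>. (\<xi>n n \<omega>)\<^sup>2)" for n
    using \<open>\<forall>n. \<xi>n n \<in> borel_measurable (F T) \<and> integrable M (\<lambda>\<omega>. (\<xi>n n \<omega>)\<^sup>2)\<close>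
    by (auto intro: measurable_F_M)
  interpret bsde_perturbation \<Omega> E X P v T t x M F f \<xi> fn \<xi>n lam lam' \<alpha> L Lip Y Z Yn Zn
    by unfold_locales
      (fact | rule \<xi>_meas \<xi>n | fact H2 H3 H4 H5 H6
        | rule \<open>\<forall>n. generator M F E X v t T (fn n)\<close>[rule_format]
        | rule \<open>\<forall>n. bsde_solution M F E X v t T (fn n) (\<xi>n n) (Yn n) (Zn n)\<close>[rule_format])+
  show ?thesis
    using perturbation_limit by blast
qed

end
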